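(* Let $f$ be a partial map from a set $X$ to itself with a single orbit. Then $(X,f)$ is unary FA-presentable if and only if its graph can be obtained in one of the following ways: (1) Start with a finite directed cycle; attach finitely many inward rooted finite trees (at their roots) to the cycle; then to any vertices of the resulting finite graph attach finitely many inwardly oriented periodic paths (at their bases) and finitely many inwardly oriented shallow stars (at their centres). (2) Start with an inward rooted finite tree; to the root attach one outwardly oriented periodic path (at its base); then to any vertices of the resulting graph attach finitely many inwardly oriented periodic paths (at their bases) and finitely many inwardly oriented shallow stars (at their centres). (3) Start with an inward rooted finite tree; to any vertices of it attach finitely many inwardly oriented periodic paths (at their bases) and finitely many inwardly oriented shallow stars (at their centres).
   Context: The graph of a partial map $f:X\to X$ is the directed graph with vertex set $X$ and edges $(x,(x)f)$ for those $x$ with $(x)f$ defined; orbits are the connected components of this graph. $(X,f)$ is unary FA-presentable if there exist a regular language $L\subseteq a^*$ and a surjection $\phi:L\to X$ such that $\{(u,v)\in L^2:u\phi=v\phi\}$ and $\{(u,v)\in L^2:(u\phi)f=v\phi\}$ are regular relations (words $\mathrm{conv}(u,v)$ over $\{a,\$\}^2$, reading $u,v$ in parallel with the shorter padded by $\$$, form regular languages). Attaching $(T,\eta)$ at $t$ to a vertex $g$ of $(G,\gamma)$: take the disjoint union and identify $g$ with $t$. An inward rooted tree is a directed tree with a distinguished root such that every edge points towards the root. A template is $(T,\eta,t_0,t_1)$, $(T,\eta)$ a finite directed tree, $t_0,t_1\in T$, $t_0$ a leaf; $\mathcal{S}(T,\eta,t_0,t_1)$ is obtained from disjoint copies $(T^{(j)},\eta^{(j)},t^{(j)}_0,t^{(j)}_1)$,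 $j\ge0$, by identifying according to the equivalence relation generated by $\{(t_1^{(j)},t_0^{(j+1)})\}$. If $t_0=t_1$ it is a shallow star with centre the amalgamated vertex, inwardly oriented if every template edge is oriented towards $t_0$. If $t_0\neq t_1$ it is a periodic path with base $t_0^{(0)}$, inwardly oriented if every template edge is oriented towards $t_0$, outwardly oriented if every template edge is oriented towards $t_1$. *)

theory Defs
  imports Main
begin

section \<open>Partial maps, their graphs and orbits\<close>

definition partial_map_on :: "'x set \<Rightarrow> ('x \<Rightarrow> 'x option) \<Rightarrow> bool" where
  "partial_map_on X f \<longleftrightarrow> (\<forall>x\<in>X. \<forall>y. f x = Some y \<longrightarrow> y \<in> X)"

text \<open>Edge set of the graph of the partial map f on X: edges (x, (x)f).\<close>
definition graph_edges :: "'x set \<Rightarrow> ('x \<Rightarrow> 'x option) \<Rightarrow> ('x \<times> 'x) set" where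
  "graph_edges X f = {(x, y). x \<in> X \<and> f x = Some y}"

text \<open>Orbits are connected components of the graph; a single orbit means
  the (nonempty) graph is weakly connected.\<close>
definition single_orbit :: "'x set \<Rightarrow> ('x \<Rightarrow> 'x option) \<Rightarrow> bool" where
  "single_orbit X f \<longleftrightarrow> X \<noteq> {} \<and>
     (\<forall>x\<in>X. \<forall>y\<in>X. (x, y) \<in> (graph_edges X f \<union> (graph_edges X f)\<inverse>)\<^sup>*)"

section \<open>Regular languages and unary FA-presentability\<close>

text \<open>A language over the alphabet given by the (finite) type 'a is regular
  iff it is accepted by a deterministic finite automaton.\<close>
definition regular :: "'a list set \<Rightarrow> bool" where
  "regular L \<longleftrightarrow> (\<exists>(Q :: nat set) \<delta> q0 F. finite Q \<and> q0 \<in> Q \<and> F \<subseteq> Q \<and>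
      (\<forall>q\<in>Q. \<forall>c. \<delta> q c \<in> Q) \<and> L = {w. foldl \<delta> q0 w \<in> F})"

text \<open>The one-letter alphabet {a}.\<close>
datatype unary = Ltr_a

text \<open>Convolution of two words; the padding symbol \$ is represented by None.\<close>
definition conv :: "unary list \<Rightarrow> unary list \<Rightarrow> (unary option \<times> unary option) list" where
  "conv u v = map (\<lambda>i. (if i < length u then Some (u ! i) else None,
                        if i < length v then Some (v ! i) else None))
                  [0..<max (length u) (length v)]"

definition regular_rel :: "(unary list \<times> unary list) set \<Rightarrow> bool" where
  "regular_rel R \<longleftrightarrow> regular ((\<lambda>(u, v). conv u v) ` R)"

definition unary_FA_presentable :: "'x set \<Rightarrow> ('x \<Rightarrow> 'x option) \<Rightarrow> bool" where
  "unary_FA_presentable X f \<longleftrightarrow>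
     (\<exists>(L :: unary list set) (\<phi> :: unary list \<Rightarrow> 'x).
        regular L \<and> \<phi> ` L = X \<and>
        regular_rel {(u, v). u \<in> L \<and> v \<in> L \<and> \<phi> u = \<phi> v} \<and>
        regular_rel {(u, v). u \<in> L \<and> v \<in> L \<and> f (\<phi> u) = Some (\<phi> v)})"

section \<open>Directed graphs: isomorphism, trees, cycles\<close>

definition graph_iso :: "'v set \<Rightarrow> ('v \<times> 'v) set \<Rightarrow> 'w set \<Rightarrow> ('w \<times> 'w) set \<Rightarrow> bool" where
  "graph_iso V E W F \<longleftrightarrow> (\<exists>h. bij_betw h V W \<and>
      (\<forall>x\<in>V. \<forall>y\<in>V. (x, y) \<in> E \<longleftrightarrow> (h x, h y) \<in> F))"

text \<open>Isomorphism of graphs with a distinguished vertex.\<close>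
definition graph_iso_pt :: "'v set \<Rightarrow> ('v \<times> 'v) set \<Rightarrow> 'v \<Rightarrow> 'w set \<Rightarrow> ('w \<times> 'w) set \<Rightarrow> 'w \<Rightarrow> bool" where
  "graph_iso_pt V E v W F w \<longleftrightarrow> (\<exists>h. bij_betw h V W \<and> h v = w \<and>
      (\<forall>x\<in>V. \<forall>y\<in>V. (x, y) \<in> E \<longleftrightarrow> (h x, h y) \<in> F))"

text \<open>Finite directed tree: the underlying undirected graph is a finite tree
  (simple: no loops, no antiparallel pairs; connected with |E| = |V| - 1).\<close>
definition dtree :: "'v set \<Rightarrow> ('v \<times> 'v) set \<Rightarrow> bool" where
  "dtree V E \<longleftrightarrow> finite V \<and> E \<subseteq> V \<times> V \<and> (\<forall>x. (x, x) \<notin> E) \<and>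
      (\<forall>x y. (x, y) \<in> E \<longrightarrow> (y, x) \<notin> E) \<and>
      (\<forall>x\<in>V. \<forall>y\<in>V. (x, y) \<in> (E \<union> E\<inverse>)\<^sup>*) \<and> card E + 1 = card V"

definition leaf :: "'v set \<Rightarrow> ('v \<times> 'v) set \<Rightarrow> 'v \<Rightarrow> bool" where
  "leaf V E x \<longleftrightarrow> x \<in> V \<and> card {y. (x, y) \<in> E \<or> (y, x) \<in> E} = 1"

text \<open>Inward rooted tree: every edge points towards the root r, i.e. the
  root is reachable along directed edges from every vertex.\<close>
definition inward_rooted_tree :: "'v set \<Rightarrow> ('v \<times> 'v) set \<Rightarrow> 'v \<Rightarrow> bool" where
  "inward_rooted_tree V E r \<longleftrightarrow> dtree V E \<and> r \<in> V \<and> (\<forall>x\<in>V. (x, r) \<in> E\<^sup>*)"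

definition cycle_graph_V :: "nat \<Rightarrow> nat set" where
  "cycle_graph_V c = {0..<c}"

definition cycle_graph_E :: "nat \<Rightarrow> (nat \<times> nat) set" where
  "cycle_graph_E c = {(i, Suc i mod c) | i. i < c}"

definition finite_dcycle :: "'v set \<Rightarrow> ('v \<times> 'v) set \<Rightarrow> bool" where
  "finite_dcycle V E \<longleftrightarrow> (\<exists>c\<ge>1. graph_iso V E (cycle_graph_V c) (cycle_graph_E c))"

section \<open>Templates and the graphs S(T, eta, t0, t1)\<close>

definition template :: "nat set \<Rightarrow> (nat \<times> nat) set \<Rightarrow> nat \<Rightarrow> nat \<Rightarrow> bool" where
  "template T \<eta> t0 t1 \<longleftrightarrow> dtree T \<eta> \<and> t0 \<in> T \<and> t1 \<in> T \<and> leaf T \<eta> t0"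

text \<open>Equivalence relation on the disjoint copies T x N generated by
  identifying t1 of copy j with t0 of copy j+1.\<close>
definition S_rel :: "nat \<Rightarrow> nat \<Rightarrow> ((nat \<times> nat) \<times> (nat \<times> nat)) set" where
  "S_rel t0 t1 = ({((t1, j), (t0, Suc j)) | j. True} \<union> {((t1, j), (t0, Suc j)) | j. True}\<inverse>)\<^sup>*"

definition S_cls :: "nat \<Rightarrow> nat \<Rightarrow> nat \<times> nat \<Rightarrow> (nat \<times> nat) set" where
  "S_cls t0 t1 p = S_rel t0 t1 `` {p}"

definition S_V :: "nat set \<Rightarrow> nat \<Rightarrow> nat \<Rightarrow> (nat \<times> nat) set set" where
  "S_V T t0 t1 = S_cls t0 t1 ` (T \<times> UNIV)"

definition S_E :: "(nat \<times> nat) set \<Rightarrow> nat \<Rightarrow> nat \<Rightarrow> ((nat \<times> nat) set \<times> (nat \<times> nat) set) set" where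
  "S_E \<eta> t0 t1 = {(S_cls t0 t1 (x, j), S_cls t0 t1 (y, j)) | x y j. (x, y) \<in> \<eta>}"

text \<open>Base of a periodic path / centre of a shallow star: the class of t0 in copy 0.\<close>
definition S_base :: "nat \<Rightarrow> nat \<Rightarrow> (nat \<times> nat) set" where
  "S_base t0 t1 = S_cls t0 t1 (t0, 0)"

definition oriented_towards :: "nat set \<Rightarrow> (nat \<times> nat) set \<Rightarrow> nat \<Rightarrow> bool" where
  "oriented_towards T \<eta> t \<longleftrightarrow> (\<forall>x\<in>T. (x, t) \<in> \<eta>\<^sup>*)"

text \<open>(V,E) with distinguished vertex b is (isomorphic to) an inwardly oriented
  periodic path with base b, etc.\<close>
definition inward_periodic_path :: "'v set \<Rightarrow> ('v \<times> 'v) set \<Rightarrow> 'v \<Rightarrow> bool" where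
  "inward_periodic_path V E b \<longleftrightarrow> (\<exists>T \<eta> t0 t1. template T \<eta> t0 t1 \<and> t0 \<noteq> t1 \<and>
      oriented_towards T \<eta> t0 \<and>
      graph_iso_pt V E b (S_V T t0 t1) (S_E \<eta> t0 t1) (S_base t0 t1))"

definition outward_periodic_path :: "'v set \<Rightarrow> ('v \<times> 'v) set \<Rightarrow> 'v \<Rightarrow> bool" where
  "outward_periodic_path V E b \<longleftrightarrow> (\<exists>T \<eta> t0 t1. template T \<eta> t0 t1 \<and> t0 \<noteq> t1 \<and>
      oriented_towards T \<eta> t1 \<and>
      graph_iso_pt V E b (S_V T t0 t1) (S_E \<eta> t0 t1) (S_base t0 t1))"

definition inward_shallow_star :: "'v set \<Rightarrow> ('v \<times> 'v) set \<Rightarrow> 'v \<Rightarrow> bool" where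
  "inward_shallow_star V E c \<longleftrightarrow> (\<exists>T \<eta> t0. template T \<eta> t0 t0 \<and>
      oriented_towards T \<eta> t0 \<and>
      graph_iso_pt V E c (S_V T t0 t0) (S_E \<eta> t0 t0) (S_base t0 t0))"

section \<open>Attaching graphs\<close>

text \<open>(V,E) is obtained from the base graph (B,EB) by attaching the graphs
  (H k, EH k), k < n, each at its vertex g k which is identified with the vertex
  g k of the base (disjoint union modulo these identifications), described
  up to isomorphism via the images of the pieces inside (V,E).\<close>
definition attached :: "'v set \<Rightarrow> ('v \<times> 'v) set \<Rightarrow> 'v set \<Rightarrow> ('v \<times> 'v) set \<Rightarrow>
    nat \<Rightarrow> (nat \<Rightarrow> 'v set) \<Rightarrow> (nat \<Rightarrow> ('v \<times> 'v) set) \<Rightarrow> (nat \<Rightarrow> 'v) \<Rightarrow> bool" where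
  "attached V E B EB n H EH g \<longleftrightarrow>
     EB \<subseteq> B \<times> B \<and>
     (\<forall>k<n. EH k \<subseteq> H k \<times> H k \<and> g k \<in> B \<and> B \<inter> H k = {g k}) \<and>
     (\<forall>k<n. \<forall>l<n. k \<noteq> l \<longrightarrow> H k \<inter> H l \<subseteq> B) \<and>
     V = B \<union> (\<Union>k<n. H k) \<and> E = EB \<union> (\<Union>k<n. EH k)"

text \<open>Attach finitely many inwardly oriented periodic paths (at their bases) and
  finitely many inwardly oriented shallow stars (at their centres) to vertices of (B,EB).\<close>
definition attach_paths_stars :: "'v set \<Rightarrow> ('v \<times> 'v) set \<Rightarrow> 'v set \<Rightarrow> ('v \<times> 'v) set \<Rightarrow> bool" where
  "attach_paths_stars V E B EB \<longleftrightarrow> (\<exists>n H EH g. attached V E B EB n H EH g \<and>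
      (\<forall>k<n. inward_periodic_path (H k) (EH k) (g k) \<or> inward_shallow_star (H k) (EH k) (g k)))"

text \<open>Way (1): finite cycle with inward rooted finite trees attached at their roots.\<close>
definition cycle_with_trees :: "'v set \<Rightarrow> ('v \<times> 'v) set \<Rightarrow> bool" where
  "cycle_with_trees B EB \<longleftrightarrow> (\<exists>C EC m T ET r. attached B EB C EC m T ET r \<and>
      finite_dcycle C EC \<and> (\<forall>k<m. inward_rooted_tree (T k) (ET k) (r k)))"

text \<open>Way (2): inward rooted finite tree with one outwardly oriented periodic path
  attached at its base to the root.\<close>
definition tree_with_outward_path :: "'v set \<Rightarrow> ('v \<times> 'v) set \<Rightarrow> bool" where
  "tree_with_outward_path B EB \<longleftrightarrow> (\<exists>T ET r P EP. inward_rooted_tree T ET r \<and>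
      attached B EB T ET 1 (\<lambda>_. P) (\<lambda>_. EP) (\<lambda>_. r) \<and> outward_periodic_path P EP r)"

definition way1 :: "'v set \<Rightarrow> ('v \<times> 'v) set \<Rightarrow> bool" where
  "way1 V E \<longleftrightarrow> (\<exists>B EB. cycle_with_trees B EB \<and> attach_paths_stars V E B EB)"

definition way2 :: "'v set \<Rightarrow> ('v \<times> 'v) set \<Rightarrow> bool" where
  "way2 V E \<longleftrightarrow> (\<exists>B EB. tree_with_outward_path B EB \<and> attach_paths_stars V E B EB)"

definition way3 :: "'v set \<Rightarrow> ('v \<times> 'v) set \<Rightarrow> bool" where
  "way3 V E \<longleftrightarrow> (\<exists>B EB r. inward_rooted_tree B EB r \<and> attach_paths_stars V E B EB)"

end

theory Submission
  imports Defs
begin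

text \<open>
  A binary relation on words over one letter is regular iff, as a relation on word lengths, it is
  invariant under translation by some period \<open>p\<close>, both diagonally far from the axes and in one
  coordinate far from the diagonal. Choosing minimal representatives, an FA-presentable partial map
  therefore becomes a partial map \<open>g\<close> on a set \<open>V\<close> of natural numbers with, for large \<open>x\<close>, either
  \<open>g (x + p) = g x + p\<close> (and \<open>g x\<close> near \<open>x\<close>) or \<open>g (x + p) = g x\<close>.

  Let \<open>F\<close> be the forward closure of all small vertices and \<open>W = V - F\<close>. Then \<open>W\<close> is closed under
  \<open>x \<mapsto> x + p\<close> and under preimages, and every orbit leaves \<open>W\<close> through a last vertex, its root.
  Roots at which \<open>g\<close> is constant on the residue class produce shallow stars; roots \<open>r\<close> reached
  from some \<open>r + k p\<close> produce inward periodic paths; by a pigeonhole argument modulo \<open>p\<close> only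
  finitely many other vertices of \<open>W\<close> hang off any finite set. If \<open>g\<close> has a sink or a cycle, then
  \<open>F\<close> is finite and these other vertices complete the finite base graph. Otherwise
  connectedness yields \<open>y\<close> whose orbit passes through \<open>y + p\<close>, so the orbit of \<open>y\<close> with the
  finite trees hanging on it is an outward periodic path.
  Conversely, the copies of the templates can be enumerated periodically, and the resulting
  relation on word lengths is ultimately periodic.
\<close>

section \<open>Regular relations over a one-letter alphabet\<close>

text \<open>The obstacle is that a numerical threshold does not cut the graph: orbits of small
  vertices may climb above any bound, and large vertices may fall below it. Removing the forward
  closure \<open>F\<close> makes \<open>W\<close> closed under preimages at once; closure under
  translation is the point to prove (\<open>F_unshift\<close>). For it the period is enlarged until
  \<open>N \<le> p\<close>: a step crossing the cut-off \<open>K\<close> overshoots it by less than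
  one period. A set closed under adding q consists of the translates of those of its elements that
  are not translates themselves. This finite set, together with the base vertex, serves as the
  template of a piece. The period q of a piece need not be p: for an inward path it is
  \<open>k * p\<close>, with \<open>k\<close> taken from the definition of \<open>spine\<close>,
  because shorter translates of a root may lie in other trees. A vertex where the partial map is
  undefined is turned into a fixed point, so that one total map g serves all three kinds of orbits;
  its loop is deleted again when the graph is described.\<close>

definition ult_periodic :: "nat \<Rightarrow> nat \<Rightarrow> (nat \<Rightarrow> nat \<Rightarrow> bool) \<Rightarrow> bool" where
  "ult_periodic N p R \<longleftrightarrow> 0 < p \<and>
     (\<forall>m n. N \<le> m \<longrightarrow> N \<le> n \<longrightarrow> R (m + p) (n + p) = R m n) \<and>
     (\<forall>m n. m + N \<le> n \<longrightarrow> R m (n + p) = R m n) \<and>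
     (\<forall>m n. n + N \<le> m \<longrightarrow> R (m + p) n = R m n)"

text \<open>Needed to give two relations a common period and to make that period larger than the
  threshold.\<close>

lemma ult_periodic_mult:
  assumes "ult_periodic N p R" "N \<le> N'" "0 < k"
  shows "ult_periodic N' (k * p) R"
proof -
  have "R (m + k * p) (n + k * p) = R m n" if "N \<le> m" "N \<le> n" for m n k
  proof (induction k)
    case (Suc k)
    have "R (m + k * p + p) (n + k * p + p) = R (m + k * p) (n + k * p)"
      using assms(1) that unfolding ult_periodic_def by (meson le_add1 order_trans)
    with Suc show ?case by (simp add: ac_simps)
  qed simp
  moreover have "R m (n + k * p) = R m n" if "m + N \<le> n" for m n k
  proof (induction k)
    case (Suc k)
    have "R m (n + k * p + p) = R m (n + k * p)"
      using assms(1) that unfolding ult_periodic_def by (meson le_add1 order_trans)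
    with Suc show ?case by (simp add: ac_simps)
  qed simp
  moreover have "R (m + k * p) n = R m n" if "n + N \<le> m" for m n k
  proof (induction k)
    case (Suc k)
    have "R (m + k * p + p) n = R (m + k * p) n"
      using assms(1) that unfolding ult_periodic_def by (meson le_add1 order_trans)
    with Suc show ?case by (simp add: ac_simps)
  qed simp
  ultimately show ?thesis
    using assms unfolding ult_periodic_def by auto
qed

text \<open>Truncated subtraction leaves at most one of the two padded blocks nonempty.\<close>

definition cword :: "nat \<Rightarrow> nat \<Rightarrow> (unary option \<times> unary option) list" where
  "cword m n = replicate (min m n) (Some Ltr_a, Some Ltr_a)
     @ replicate (n - m) (None, Some Ltr_a) @ replicate (m - n) (Some Ltr_a, None)"

lemma length_cword [simp]: "length (cword m n) = max m n"
  by (simp add: cword_def)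

lemma nth_cword:
  "i < max m n \<Longrightarrow> cword m n ! i =
     (if i < m then Some Ltr_a else None, if i < n then Some Ltr_a else None)"
  by (auto simp: cword_def nth_append)

lemma conv_eq_cword: "conv u v = cword (length u) (length v)"
proof (rule nth_equalityI)
  fix i assume "i < length (conv u v)"
  moreover have "x = Ltr_a" for x by (cases x)
  ultimately show "conv u v ! i = cword (length u) (length v) ! i"
    by (auto simp: nth_cword conv_def)
qed (simp add: conv_def)

lemma take_cword: "take k (cword m n) = cword (min k m) (min k n)"
  by (rule nth_equalityI) (auto simp: nth_cword)

lemma drop_cword: "drop k (cword m n) = cword (m - k) (n - k)"
  by (rule nth_equalityI) (auto simp: nth_cword)

lemma cword_inject: "cword m n = cword m' n' \<longleftrightarrow> m = m' \<and> n = n'"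
proof
  have cnt: "length (filter (\<lambda>c. fst c \<noteq> None) (cword m n)) = m"
    "length (filter (\<lambda>c. snd c \<noteq> None) (cword m n)) = n" for m n
    by (auto simp: cword_def)
  show "cword m n = cword m' n' \<Longrightarrow> m = m' \<and> n = n'"
    by (metis cnt)
qed simp

text \<open>Padding never stops once it has begun, so only the longer word can still grow; both can
  grow only on the diagonal \<open>m = n\<close>.\<close>

lemma cword_append_eq_iff:
  "cword m n @ w = cword m' n' \<longleftrightarrow>
     (\<exists>i j. m' = m + i \<and> n' = n + j \<and> (m < n \<longrightarrow> i = 0) \<and> (n < m \<longrightarrow> j = 0) \<and> w = cword i j)"
proof
  assume eq: "cword m n @ w = cword m' n'"
  let ?k = "max m n"
  have "cword m n = take ?k (cword m' n')" and w: "w = drop ?k (cword m' n')"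
    by (simp_all flip: eq)
  then have "m = min ?k m'" "n = min ?k n'"
    by (simp_all add: take_cword cword_inject)
  then have "m' = m + (m' - ?k) \<and> n' = n + (n' - ?k) \<and> (m < n \<longrightarrow> m' - ?k = 0) \<and> (n < m \<longrightarrow> n' - ?k = 0)"
    by linarith
  with w show "\<exists>i j. m' = m + i \<and> n' = n + j \<and> (m < n \<longrightarrow> i = 0) \<and> (n < m \<longrightarrow> j = 0) \<and> w = cword i j"
    unfolding drop_cword by blast
next
  assume "\<exists>i j. m' = m + i \<and> n' = n + j \<and> (m < n \<longrightarrow> i = 0) \<and> (n < m \<longrightarrow> j = 0) \<and> w = cword i j"
  then obtain i j where ij: "m' = m + i" "n' = n + j" "m < n \<longrightarrow> i = 0" "n < m \<longrightarrow> j = 0" "w = cword i j"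
    by blast
  show "cword m n @ w = cword m' n'"
    by (rule nth_equalityI) (use ij in \<open>auto simp: nth_cword nth_append\<close>)
qed

text \<open>One half of the Myhill-Nerode theorem, with the derivatives as states. They are renamed
  by an injection \<open>e\<close> because \<open>regular\<close> asks for states that are natural
  numbers.\<close>

lemma regular_if_finite_derivatives:
  assumes fin: "finite (range (\<lambda>u. {w. u @ w \<in> K}))"
  shows "regular K"
proof -
  define D where "D u = {w. u @ w \<in> K}" for u
  let ?Q = "range D"
  have fin: "finite ?Q" using fin unfolding D_def .
  then obtain e :: "_ \<Rightarrow> nat" where e: "inj_on e ?Q"
    using finite_imp_inj_to_nat_seg by blast
  define \<delta> where "\<delta> q c = e {w. c # w \<in> inv_into ?Q e q}" for q c
  have step: "\<delta> (e (D u)) c = e (D (u @ [c]))" for u c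
    unfolding \<delta>_def inv_into_f_f[OF e rangeI] by (simp add: D_def)
  have run: "foldl \<delta> (e (D u)) w = e (D (u @ w))" for u w
    by (induction w arbitrary: u) (simp_all add: step)
  have "w \<in> K \<longleftrightarrow> foldl \<delta> (e (D [])) w \<in> e ` {A \<in> ?Q. [] \<in> A}" for w
  proof -
    have "foldl \<delta> (e (D [])) w \<in> e ` {A \<in> ?Q. [] \<in> A} \<longleftrightarrow> D w \<in> {A \<in> ?Q. [] \<in> A}"
      unfolding run append_Nil by (rule inj_on_image_mem_iff[OF e]) auto
    also have "\<dots> \<longleftrightarrow> w \<in> K" by (simp add: D_def)
    finally show ?thesis ..
  qed
  then show ?thesis
    unfolding regular_def using fin
    by (intro exI[of _ "e ` ?Q"] exI[of _ \<delta>] exI[of _ "e (D [])"] exI[of _ "e ` {A \<in> ?Q. [] \<in> A}"])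
       (auto simp: step)
qed

text \<open>The orbit of \<open>q\<close> repeats among its first \<open>card Q + 1\<close> terms,
  so its cycle length is at most \<open>card Q\<close> and divides the factorial. The factorial is
  thus a period that suits all states and all letters of an automaton at once.\<close>

lemma funpow_finite_periodic:
  assumes "finite Q" "h ` Q \<subseteq> Q" "q \<in> Q" "card Q \<le> n"
  shows "(h ^^ (n + fact (card Q))) q = (h ^^ n) q"
proof -
  have inQ: "(h ^^ i) q \<in> Q" for i
    by (induction i) (use assms in auto)
  have "\<not> inj_on (\<lambda>i. (h ^^ i) q) {..card Q}"
  proof
    assume "inj_on (\<lambda>i. (h ^^ i) q) {..card Q}"
    then have "card {..card Q} \<le> card Q"
      by (rule card_inj_on_le) (use inQ assms in auto)
    then show False by simp
  qed
  then obtain i j where "i \<noteq> j" "i \<le> card Q" "j \<le> card Q" "(h ^^ i) q = (h ^^ j) q"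
    unfolding inj_on_def by blast
  then obtain i j where ij: "i < j" "j \<le> card Q" "(h ^^ i) q = (h ^^ j) q"
    by (metis linorder_neqE_nat)
  let ?c = "j - i"
  have per: "(h ^^ (m + k * ?c)) q = (h ^^ m) q" if "i \<le> m" for m k
  proof (induction k)
    case (Suc k)
    have "m + Suc k * ?c = (m + k * ?c - i) + j"
      using ij that by simp
    then have "(h ^^ (m + Suc k * ?c)) q = (h ^^ (m + k * ?c - i)) ((h ^^ j) q)"
      by (simp only: funpow_add comp_apply)
    also have "\<dots> = (h ^^ (m + k * ?c - i + i)) q"
      unfolding ij(3)[symmetric] by (simp only: funpow_add comp_apply)
    also have "m + k * ?c - i + i = m + k * ?c"
      using that by simp
    finally show ?case using Suc by simp
  qed simp
  have "?c dvd fact (card Q)"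
    using ij by (intro dvd_fact) auto
  then obtain k where "fact (card Q) = k * ?c"
    by (metis dvd_def mult.commute)
  then show ?thesis using per[of n k] ij assms by (metis less_imp_le_nat order_trans)
qed

lemma foldl_replicate: "foldl \<delta> q (replicate n c) = ((\<lambda>q. \<delta> q c) ^^ n) q"
  by (induction n arbitrary: q) (simp_all add: funpow_Suc_right del: funpow.simps(2))

lemma conv_image:
  "(\<lambda>(u, v). conv u v) ` {(u, v). R (length u) (length v)} = {cword m n | m n. R m n}"
proof (intro set_eqI iffI)
  fix w assume "w \<in> {cword m n | m n. R m n}"
  then obtain m n where "w = cword m n" "R m n" by blast
  then show "w \<in> (\<lambda>(u, v). conv u v) ` {(u, v). R (length u) (length v)}"
    by (intro image_eqI[of _ _ "(replicate m Ltr_a, replicate n Ltr_a)"]) (auto simp: conv_eq_cword)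
qed (auto simp: conv_eq_cword)

lemma ult_periodic_if_regular_rel:
  assumes "regular_rel {(u, v). R (length u) (length v)}"
  shows "\<exists>N p. ult_periodic N p R"
proof -
  from assms obtain Q :: "nat set" and \<delta> q0 F where Q: "finite Q" "q0 \<in> Q" "\<forall>q\<in>Q. \<forall>c. \<delta> q c \<in> Q"
    and K: "{cword m n | m n. R m n} = {w. foldl \<delta> q0 w \<in> F}"
    unfolding regular_rel_def conv_image regular_def by (elim exE conjE) (rule that)
  have R: "R m n \<longleftrightarrow> foldl \<delta> q0 (cword m n) \<in> F" for m n
  proof -
    have "R m n \<longleftrightarrow> cword m n \<in> {cword m n | m n. R m n}"
      by (auto simp: cword_inject)
    then show ?thesis unfolding K by simp
  qed
  have in_Q: "foldl \<delta> q w \<in> Q" if "q \<in> Q" for q w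
    using that by (induction w arbitrary: q) (auto simp: Q)
  have per: "foldl \<delta> q (replicate (n + fact (card Q)) c) = foldl \<delta> q (replicate n c)"
    if "q \<in> Q" "card Q \<le> n" for q n c
    unfolding foldl_replicate by (rule funpow_finite_periodic) (use Q that in \<open>auto simp del: split_paired_All\<close>)
  \<comment> \<open>In each of the three situations \<open>cword m n\<close> contains a block of at
    least \<open>card Q\<close> equal letters, and adding \<open>fact (card Q)\<close> copies to
    that block does not change the state reached.\<close>
  have "ult_periodic (card Q) (fact (card Q)) R"
    unfolding ult_periodic_def
  proof (intro conjI allI impI)
    fix m n assume "card Q \<le> m" "card Q \<le> n"
    then show "R (m + fact (card Q)) (n + fact (card Q)) = R m n"
      unfolding R cword_def foldl_append by (simp add: per Q min_add_distrib_left[symmetric] del: min_add_distrib_left)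
  next
    fix m n assume "m + card Q \<le> n"
    then have "min m (n + fact (card Q)) = min m n" "n + fact (card Q) - m = (n - m) + fact (card Q)"
      "m - (n + fact (card Q)) = m - n" "card Q \<le> n - m"
      by auto
    then show "R m (n + fact (card Q)) = R m n"
      unfolding R cword_def foldl_append by (simp only: per in_Q[OF Q(2)])
  next
    fix m n assume "n + card Q \<le> m"
    then have "min (m + fact (card Q)) n = min m n" "m + fact (card Q) - n = (m - n) + fact (card Q)"
      "n - (m + fact (card Q)) = n - m" "card Q \<le> m - n"
      by auto
    then show "R (m + fact (card Q)) n = R m n"
      unfolding R cword_def foldl_append by (simp only: per in_Q[OF in_Q[OF Q(2)]])
  qed simp
  then show ?thesis by blast
qed

lemma regular_rel_if_ult_periodic:
  assumes "ult_periodic N p R"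
  shows "regular_rel {(u, v). R (length u) (length v)}"
proof -
  \<comment> \<open>With \<open>Suc N\<close> in place of \<open>N\<close>, being far from the
    diagonal implies being strictly off it, even if \<open>N = 0\<close>. Then the shorter word is
    already padded and cannot grow.\<close>
  have per: "ult_periodic (Suc N) p R"
    using ult_periodic_mult[OF assms, of "Suc N" 1] by simp
  let ?K = "{cword m n | m n. R m n}"
  define D where "D m n = {w. cword m n @ w \<in> ?K}" for m n
  have D: "w \<in> D m n \<longleftrightarrow> (\<exists>i j. R (m + i) (n + j) \<and> (m < n \<longrightarrow> i = 0) \<and> (n < m \<longrightarrow> j = 0) \<and> w = cword i j)" for w m n
    unfolding D_def by (auto simp: cword_append_eq_iff)
  note per' = per[unfolded ult_periodic_def, THEN conjunct2]
  have D1: "D (m + p) (n + p) = D m n" if "Suc N \<le> m" "Suc N \<le> n" for m n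
  proof -
    have "R (m + p + i) (n + p + j) = R (m + i) (n + j)" for i j
      using per'[THEN conjunct1, rule_format, of "m + i" "n + j"] that by (simp add: ac_simps)
    then show ?thesis by (auto simp: D)
  qed
  have D2: "D m (n + p) = D m n" if "m + Suc N \<le> n" for m n
  proof -
    have "R m (n + p + j) = R m (n + j)" for j
      using per'[THEN conjunct2, THEN conjunct1, rule_format, of m "n + j"] that by (simp add: ac_simps)
    then show ?thesis using that by (auto simp: D)
  qed
  have D3: "D (m + p) n = D m n" if "n + Suc N \<le> m" for m n
  proof -
    have "R (m + p + i) n = R (m + i) n" for i
      using per'[THEN conjunct2, THEN conjunct2, rule_format, of n "m + i"] that by (simp add: ac_simps)
    then show ?thesis using that by (auto simp: D)
  qed
  have p: "0 < p" using per by (simp add: ult_periodic_def)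
  \<comment> \<open>If neither the diagonal nor a one-sided reduction applies, one coordinate is
    below \<open>Suc N + p\<close> and the other exceeds it by less than
    \<open>Suc N + p\<close>.\<close>
  define C where "C = 2 * (Suc N + p)"
  have red: "\<exists>m'<C. \<exists>n'<C. D m n = D m' n'" for m n
  proof (induction "m + n" arbitrary: m n rule: less_induct)
    case less
    consider "Suc N + p \<le> m" "Suc N + p \<le> n" | "m + Suc N + p \<le> n" | "n + Suc N + p \<le> m" | "m < C" "n < C"
      unfolding C_def by atomize_elim arith
    then show ?case
    proof cases
      case 1
      then have "D m n = D (m - p) (n - p)" using D1[of "m - p" "n - p"] by simp
      then show ?thesis using less[of "m - p" "n - p"] p 1 by auto
    next
      case 2
      then have "D m n = D m (n - p)" using D2[of m "n - p"] by simp
      then show ?thesis using less[of m "n - p"] p 2 by auto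
    next
      case 3
      then have "D m n = D (m - p) n" using D3[of n "m - p"] by simp
      then show ?thesis using less[of "m - p" n] p 3 by auto
    qed blast
  qed
  \<comment> \<open>A word \<open>u\<close> that is no prefix of a convolution contributes only the
    empty derivative.\<close>
  have "{w. u @ w \<in> ?K} \<in> insert {} ((\<lambda>(m, n). D m n) ` ({..<C} \<times> {..<C}))" for u
  proof (cases "{w. u @ w \<in> ?K} = {}")
    case False
    then obtain w m n where "u @ w = cword m n" by blast
    then have "u = cword (min (length u) m) (min (length u) n)"
      by (metis append_eq_conv_conj take_cword)
    then obtain m n where "u = cword m n" by blast
    then have "{w. u @ w \<in> ?K} = D m n" unfolding D_def by simp
    then show ?thesis using red[of m n] by auto
  qed simp
  then have "range (\<lambda>u. {w. u @ w \<in> ?K}) \<subseteq> insert {} ((\<lambda>(m, n). D m n) ` ({..<C} \<times> {..<C}))"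
    by blast
  then have "finite (range (\<lambda>u. {w. u @ w \<in> ?K}))"
    by (rule finite_subset) simp
  then show ?thesis
    unfolding regular_rel_def conv_image by (rule regular_if_finite_derivatives)
qed

lemma regular_if_ult_periodic:
  fixes P :: "nat \<Rightarrow> bool"
  assumes "0 < p" "\<And>m. N \<le> m \<Longrightarrow> P (m + p) = P m"
  shows "regular {u :: unary list. P (length u)}"
proof -
  define D where "D m = {w :: unary list. P (m + length w)}" for m
  have step: "D (m + p) = D m" if "N \<le> m" for m
  proof -
    have "P (m + p + i) = P (m + i)" for i
      using assms(2)[of "m + i"] that by (simp add: ac_simps)
    then show ?thesis unfolding D_def by simp
  qed
  have "\<exists>m'<N + p. D m = D m'" for m
  proof (induction m rule: less_induct)
    case (less m)
    show ?case
    proof (cases "m < N + p")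
      case False
      then have "D m = D (m - p)" using step[of "m - p"] by simp
      then show ?thesis using less[of "m - p"] assms(1) False by auto
    qed blast
  qed
  then have "D (length u) \<in> D ` {..<N + p}" for u :: "unary list"
    by blast
  then have "range (\<lambda>u. {w. u @ w \<in> {u :: unary list. P (length u)}}) \<subseteq> D ` {..<N + p}"
    by (auto simp: D_def)
  then show ?thesis
    by (intro regular_if_finite_derivatives) (rule finite_subset, assumption, simp)
qed

section \<open>Template graphs\<close>

text \<open>\<open>v (x, j)\<close> is the image in \<open>H\<close> of the vertex \<open>x\<close> of the \<open>j\<close>-th copy of the template.\<close>

definition template_param ::
  "(nat \<times> nat \<Rightarrow> 'v) \<Rightarrow> nat set \<Rightarrow> (nat \<times> nat) set \<Rightarrow> nat \<Rightarrow> nat \<Rightarrow> 'v set \<Rightarrow> ('v \<times> 'v) set \<Rightarrow> 'v \<Rightarrow> bool" where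
  "template_param v T \<eta> t0 t1 H E b \<longleftrightarrow>
     v (t0, 0) = b \<and> (\<forall>j. v (t1, j) = v (t0, Suc j)) \<and> H = v ` (T \<times> UNIV) \<and>
     inj_on v (insert (t0, 0) ((T - {t0}) \<times> UNIV)) \<and>
     E = {(v (x, j), v (y, j)) | x y j. (x, y) \<in> \<eta>}"

text \<open>Canonical representative of a class of \<open>S_rel\<close>: \<open>t0\<close> of a
  later copy is renamed to \<open>t1\<close> of the copy before it, and in a star all copies of the
  centre collapse to \<open>(t0, 0)\<close>. The representatives form exactly the set on which
  \<open>template_param\<close> demands injectivity.\<close>

definition S_nf :: "nat \<Rightarrow> nat \<Rightarrow> nat \<times> nat \<Rightarrow> nat \<times> nat" where
  "S_nf t0 t1 = (\<lambda>(x, j). if x = t0 then (if j = 0 \<or> t1 = t0 then (t0, 0) else (t1, j - 1)) else (x, j))"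

lemma S_rel_induct:
  assumes "(p, q) \<in> S_rel t0 t1" "\<And>j. F (t1, j) = F (t0, Suc j)"
  shows "F p = F q"
  using assms(1) unfolding S_rel_def
proof (induction rule: rtrancl_induct)
  case (step q r)
  from step(2) have "F q = F r"
    by (elim UnE converseE) (clarsimp simp: assms(2))+
  with step show ?case by simp
qed simp

lemma S_rel_step: "((t1, j), (t0, Suc j)) \<in> S_rel t0 t1"
  unfolding S_rel_def by (rule r_into_rtrancl) blast

lemma S_rel_sym: "(p, q) \<in> S_rel t0 t1 \<Longrightarrow> (q, p) \<in> S_rel t0 t1"
  unfolding S_rel_def by (rule symD[OF sym_rtrancl[OF sym_Un_converse]])

lemma S_rel_trans: "(p, q) \<in> S_rel t0 t1 \<Longrightarrow> (q, r) \<in> S_rel t0 t1 \<Longrightarrow> (p, r) \<in> S_rel t0 t1"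
  unfolding S_rel_def by (rule rtrancl_trans)

lemma S_rel_refl: "(p, p) \<in> S_rel t0 t1"
  unfolding S_rel_def by simp

lemma S_cls_eq_iff: "S_cls t0 t1 p = S_cls t0 t1 q \<longleftrightarrow> (p, q) \<in> S_rel t0 t1"
  unfolding S_cls_def by (auto intro: S_rel_refl S_rel_sym S_rel_trans)

lemma S_rel_S_nf: "(p, S_nf t0 t1 p) \<in> S_rel t0 t1"
proof -
  have "((t0, j), (t0, 0)) \<in> S_rel t0 t0" for j
  proof (induction j)
    case (Suc j)
    then show ?case by (rule S_rel_trans[OF S_rel_sym[OF S_rel_step]])
  qed (rule S_rel_refl)
  moreover have "((t0, j), (t1, j - 1)) \<in> S_rel t0 t1" if "j \<noteq> 0" for j
    using S_rel_sym[OF S_rel_step, of t0 "j - 1" t1] that by simp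
  ultimately show ?thesis
    by (cases p) (auto simp: S_nf_def intro: S_rel_refl)
qed

lemma S_rel_iff_S_nf: "(p, q) \<in> S_rel t0 t1 \<longleftrightarrow> S_nf t0 t1 p = S_nf t0 t1 q"
proof
  show "(p, q) \<in> S_rel t0 t1 \<Longrightarrow> S_nf t0 t1 p = S_nf t0 t1 q"
    by (erule S_rel_induct) (auto simp: S_nf_def)
  show "S_nf t0 t1 p = S_nf t0 t1 q \<Longrightarrow> (p, q) \<in> S_rel t0 t1"
    by (metis S_rel_S_nf S_rel_sym S_rel_trans)
qed

lemma S_nf_in: "t1 \<in> T \<Longrightarrow> p \<in> T \<times> UNIV \<Longrightarrow> S_nf t0 t1 p \<in> insert (t0, 0) ((T - {t0}) \<times> UNIV)"
  by (cases p) (auto simp: S_nf_def)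

text \<open>Trades the equivalence classes for a parametrisation of \<open>H\<close> itself, sending
  a pair to the preimage of its class. With the converse
  \<open>graph_iso_pt_if_template_param\<close>, this keeps quotients out of all later
  arguments.\<close>

lemma template_param_exists:
  assumes iso: "graph_iso_pt H E b (S_V T t0 t1) (S_E \<eta> t0 t1) (S_base t0 t1)"
    and "E \<subseteq> H \<times> H" "b \<in> H" "t0 \<in> T" "t1 \<in> T" "\<eta> \<subseteq> T \<times> T"
  shows "\<exists>v. template_param v T \<eta> t0 t1 H E b"
proof -
  obtain h where h: "bij_betw h H (S_V T t0 t1)" "h b = S_base t0 t1"
    and hE: "\<And>x y. x \<in> H \<Longrightarrow> y \<in> H \<Longrightarrow> (x, y) \<in> E \<longleftrightarrow> (h x, h y) \<in> S_E \<eta> t0 t1"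
    using iso unfolding graph_iso_pt_def by blast
  have inj: "inj_on h H" using h(1) by (rule bij_betw_imp_inj_on)
  define v where "v p = inv_into H h (S_cls t0 t1 p)" for p
  have hv: "h (v p) = S_cls t0 t1 p" and vH: "v p \<in> H" if "p \<in> T \<times> UNIV" for p
  proof -
    have "S_cls t0 t1 p \<in> h ` H" using that h(1) unfolding S_V_def bij_betw_def by blast
    then show "h (v p) = S_cls t0 t1 p" "v p \<in> H"
      unfolding v_def by (rule f_inv_into_f, rule inv_into_into)
  qed
  have v_eqI: "v p = x" if "x \<in> H" "S_cls t0 t1 p = h x" for p x
    unfolding v_def that(2) by (rule inv_into_f_f[OF inj that(1)])
  have "H \<subseteq> v ` (T \<times> UNIV)"
  proof
    fix x assume x: "x \<in> H"
    then have "h x \<in> S_cls t0 t1 ` (T \<times> UNIV)"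
      using bij_betwE[OF h(1)] unfolding S_V_def by metis
    then obtain p where "p \<in> T \<times> UNIV" "h x = S_cls t0 t1 p" by (elim imageE)
    with v_eqI[OF x, of p] show "x \<in> v ` (T \<times> UNIV)" by (intro image_eqI) auto
  qed
  then have H: "H = v ` (T \<times> UNIV)" using vH by blast
  have "inj_on v (insert (t0, 0) ((T - {t0}) \<times> UNIV))"
  proof (rule inj_onI)
    fix p q assume pq: "p \<in> insert (t0, 0) ((T - {t0}) \<times> UNIV)" "q \<in> insert (t0, 0) ((T - {t0}) \<times> UNIV)"
      and "v p = v q"
    then have "S_cls t0 t1 p = S_cls t0 t1 q"
      using hv[of p] hv[of q] assms(4) by auto
    then have "S_nf t0 t1 p = S_nf t0 t1 q"
      unfolding S_cls_eq_iff S_rel_iff_S_nf .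
    then show "p = q" using pq by (auto simp: S_nf_def split: if_splits)
  qed
  moreover have "E = {(v (x, j), v (y, j)) | x y j. (x, y) \<in> \<eta>}"
  proof (intro equalityI subsetI)
    fix e assume e: "e \<in> E"
    then obtain a c where ac: "e = (a, c)" "a \<in> H" "c \<in> H" using assms(2) by blast
    with e hE have "(h a, h c) \<in> S_E \<eta> t0 t1" by blast
    then obtain x y j where "h a = S_cls t0 t1 (x, j)" "h c = S_cls t0 t1 (y, j)" "(x, y) \<in> \<eta>"
      unfolding S_E_def by blast
    moreover from this have "v (x, j) = a" "v (y, j) = c"
      using ac by (auto intro!: v_eqI)
    ultimately show "e \<in> {(v (x, j), v (y, j)) | x y j. (x, y) \<in> \<eta>}"
      using ac(1) by blast
  next
    fix e assume "e \<in> {(v (x, j), v (y, j)) | x y j. (x, y) \<in> \<eta>}"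
    then obtain x y j where xy: "e = (v (x, j), v (y, j))" "(x, y) \<in> \<eta>" by blast
    then have T: "x \<in> T" "y \<in> T" using assms(6) by auto
    have "(S_cls t0 t1 (x, j), S_cls t0 t1 (y, j)) \<in> S_E \<eta> t0 t1"
      unfolding S_E_def using xy by blast
    then show "e \<in> E" using hE[of "v (x, j)" "v (y, j)"] T hv vH xy by auto
  qed
  moreover have "v (t0, 0) = b" by (rule v_eqI) (use assms h in \<open>auto simp: S_base_def\<close>)
  moreover have "v (t1, j) = v (t0, Suc j)" for j
    unfolding v_def by (rule arg_cong[of _ _ "inv_into H h"]) (simp add: S_cls_eq_iff S_rel_step)
  ultimately show ?thesis unfolding template_param_def using H by blast
qed

lemma graph_iso_pt_if_template_param:
  assumes par: "template_param v T \<eta> t0 t1 H E b"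
    and T: "t0 \<in> T" "t1 \<in> T" "\<eta> \<subseteq> T \<times> T"
  shows "graph_iso_pt H E b (S_V T t0 t1) (S_E \<eta> t0 t1) (S_base t0 t1)"
proof -
  have v: "v (t0, 0) = b" "\<And>j. v (t1, j) = v (t0, Suc j)" "H = v ` (T \<times> UNIV)"
    "inj_on v (insert (t0, 0) ((T - {t0}) \<times> UNIV))"
    "E = {(v (x, j), v (y, j)) | x y j. (x, y) \<in> \<eta>}"
    using par unfolding template_param_def by auto
  have eq: "S_cls t0 t1 p = S_cls t0 t1 q \<longleftrightarrow> v p = v q" if "p \<in> T \<times> UNIV" "q \<in> T \<times> UNIV" for p q
  proof
    show "S_cls t0 t1 p = S_cls t0 t1 q \<Longrightarrow> v p = v q"
      unfolding S_cls_eq_iff by (erule S_rel_induct) (rule v(2))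
  next
    assume "v p = v q"
    moreover have "v p = v (S_nf t0 t1 p)" "v q = v (S_nf t0 t1 q)"
      using S_rel_S_nf v(2) by (metis S_rel_induct)+
    ultimately have "S_nf t0 t1 p = S_nf t0 t1 q"
      using v(4) S_nf_in[OF T(2)] that unfolding inj_on_def by (metis (no_types, lifting))
    then show "S_cls t0 t1 p = S_cls t0 t1 q" unfolding S_cls_eq_iff S_rel_iff_S_nf .
  qed
  define h where "h x = S_cls t0 t1 (inv_into (T \<times> UNIV) v x)" for x
  have hv: "h (v p) = S_cls t0 t1 p" if "p \<in> T \<times> UNIV" for p
    unfolding h_def using that by (subst eq) (auto intro!: inv_into_into f_inv_into_f)
  have "bij_betw h H (S_V T t0 t1)"
  proof (rule bij_betw_imageI)
    show "inj_on h H"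
      unfolding v(3) by (rule inj_onI) (use hv eq in auto)
    show "h ` H = S_V T t0 t1"
      unfolding v(3) S_V_def image_image by (rule image_cong) (simp_all add: hv)
  qed
  moreover have "h b = S_base t0 t1"
    unfolding v(1)[symmetric] S_base_def by (rule hv) (use T in simp)
  moreover have "(x, y) \<in> E \<longleftrightarrow> (h x, h y) \<in> S_E \<eta> t0 t1" if xy: "x \<in> H" "y \<in> H" for x y
  proof
    assume "(x, y) \<in> E"
    then obtain a c j where "x = v (a, j)" "y = v (c, j)" "(a, c) \<in> \<eta>" unfolding v(5) by blast
    then show "(h x, h y) \<in> S_E \<eta> t0 t1"
      using T(3) hv[of "(a, j)"] hv[of "(c, j)"] unfolding S_E_def by blast
  next
    assume "(h x, h y) \<in> S_E \<eta> t0 t1"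
    then obtain a c j where ac: "h x = S_cls t0 t1 (a, j)" "h y = S_cls t0 t1 (c, j)" "(a, c) \<in> \<eta>"
      unfolding S_E_def by blast
    obtain p q where pq: "p \<in> T \<times> UNIV" "x = v p" "q \<in> T \<times> UNIV" "y = v q"
      using xy v(3) by blast
    have "v p = v (a, j)" "v q = v (c, j)"
      using ac pq hv eq T(3) by (metis SigmaD1 SigmaD2 SigmaI UNIV_I subsetD)+
    then show "(x, y) \<in> E" using ac pq v(5) by blast
  qed
  ultimately show ?thesis unfolding graph_iso_pt_def by blast
qed

section \<open>The graphs of the three kinds are presentable\<close>

text \<open>A sequence lists the copies of one template vertex. The index falls when an edge enters
  the next template's \<open>t0\<close> (which is \<open>t1\<close> one copy earlier), stays inside
  a copy, and rises at \<open>t1\<close> of an outward path; the constant case is an edge into the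
  centre of a star. In the falling case nothing is said about \<open>f (s 0)\<close>, whose value is
  the base vertex.\<close>

definition sequence_step :: "'x set \<Rightarrow> ('x \<Rightarrow> 'x option) \<Rightarrow> (nat \<Rightarrow> 'x) set \<Rightarrow> (nat \<Rightarrow> 'x) \<Rightarrow> bool" where
  "sequence_step X f S s \<longleftrightarrow>
     (\<exists>s'\<in>S. (\<forall>j. f (s (Suc j)) = Some (s' j)) \<or> (\<forall>j. f (s j) = Some (s' j)) \<or>
              (\<forall>j. f (s j) = Some (s' (Suc j)))) \<or>
     (\<exists>c\<in>X. \<forall>j. f (s j) = Some c)"

text \<open>\<open>Y\<close> is the part of the graph coded so far and \<open>X\<close> the whole
  graph, so that pieces can be added one at a time while constant values may lie anywhere in
  \<open>X\<close>.\<close>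

definition sequence_coded :: "'x set \<Rightarrow> ('x \<Rightarrow> 'x option) \<Rightarrow> 'x set \<Rightarrow> bool" where
  "sequence_coded X f Y \<longleftrightarrow> (\<exists>B S. finite B \<and> finite S \<and>
     inj_on (\<lambda>(s, j). s j) (S \<times> UNIV) \<and> Y = B \<union> (\<Union>s\<in>S. range s) \<and>
     B \<inter> (\<Union>s\<in>S. range s) = {} \<and> (\<forall>s\<in>S. sequence_step X f S s))"

lemma sequence_coded_finite: "finite Y \<Longrightarrow> sequence_coded X f Y"
  unfolding sequence_coded_def by (rule exI[of _ Y], rule exI[of _ "{}"]) auto

lemma sequence_step_mono: "sequence_step X f S s \<Longrightarrow> S \<subseteq> S' \<Longrightarrow> sequence_step X f S' s"
  unfolding sequence_step_def by blast

lemma sequence_stepI: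
  shows "s' \<in> S \<Longrightarrow> (\<And>j. f (s (Suc j)) = Some (s' j)) \<Longrightarrow> sequence_step X f S s"
    and "s' \<in> S \<Longrightarrow> (\<And>j. f (s j) = Some (s' j)) \<Longrightarrow> sequence_step X f S s"
    and "s' \<in> S \<Longrightarrow> (\<And>j. f (s j) = Some (s' (Suc j))) \<Longrightarrow> sequence_step X f S s"
    and "c \<in> X \<Longrightarrow> (\<And>j. f (s j) = Some c) \<Longrightarrow> sequence_step X f S s"
  unfolding sequence_step_def by blast+

lemma out_edge_if_reaches:
  assumes "(x, t) \<in> \<eta>\<^sup>*" "x \<noteq> t"
  shows "\<exists>y. (x, y) \<in> \<eta>"
  using assms by (metis converse_rtranclE)

text \<open>Every template vertex other than \<open>t0\<close> contributes one new sequence; the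
  copies of \<open>t0\<close> are already named, either as the base or as copies of
  \<open>t1\<close>.\<close>

lemma sequence_coded_attach:
  assumes "sequence_coded X f Y"
    and par: "template_param v T \<eta> t0 t1 H E b"
    and T: "template T \<eta> t0 t1"
    and orient: "oriented_towards T \<eta> t0 \<or> t0 \<noteq> t1 \<and> oriented_towards T \<eta> t1"
    and YH: "Y \<inter> H = {b}" and HX: "H \<subseteq> X" and E: "E \<subseteq> graph_edges X f"
  shows "sequence_coded X f (Y \<union> H)"
proof -
  from assms(1) obtain B S where B: "finite B" "finite S" "inj_on (\<lambda>(s, j). s j) (S \<times> UNIV)" "Y = B \<union> (\<Union>s\<in>S. range s)"
    "B \<inter> (\<Union>s\<in>S. range s) = {}" "\<forall>s\<in>S. sequence_step X f S s"
    unfolding sequence_coded_def by (elim exE conjE) (rule that)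
  have v: "v (t0, 0) = b" "\<And>j. v (t1, j) = v (t0, Suc j)" "H = v ` (T \<times> UNIV)"
    "inj_on v (insert (t0, 0) ((T - {t0}) \<times> UNIV))"
    "E = {(v (x, j), v (y, j)) | x y j. (x, y) \<in> \<eta>}"
    using par unfolding template_param_def by auto
  have T': "finite T" "t0 \<in> T" "t1 \<in> T" "\<eta> \<subseteq> T \<times> T" "\<And>x. (x, x) \<notin> \<eta>"
    using T unfolding template_def dtree_def by auto
  define S' where "S' = (\<lambda>x j. v (x, j)) ` (T - {t0})"
  have edge: "f (v (x, j)) = Some (v (y, j))" if "(x, y) \<in> \<eta>" for x y j
  proof -
    have "(v (x, j), v (y, j)) \<in> E" unfolding v(5) using that by blast
    then show ?thesis using E unfolding graph_edges_def by blast
  qed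
  have v_ne_b: "v (x, j) \<noteq> b" if "x \<in> T - {t0}" for x j
  proof
    assume "v (x, j) = b"
    then have "(x, j) = (t0, 0)"
      using v(1) that by (intro inj_onD[OF v(4)]) auto
    then show False using that by simp
  qed
  have H: "H = insert b (\<Union>s\<in>S'. range s)"
  proof -
    have "v (t0, j) \<in> insert b (\<Union>s\<in>S'. range s)" for j
    proof (induction j)
      case (Suc j)
      show ?case
      proof (cases "t1 = t0")
        case True
        then show ?thesis using Suc v(2)[of j] by simp
      next
        case False
        then show ?thesis unfolding v(2)[symmetric] S'_def using T' by blast
      qed
    qed (simp add: v(1))
    then have "v ` (T \<times> UNIV) \<subseteq> insert b (\<Union>s\<in>S'. range s)"
      unfolding S'_def by blast
    moreover have "insert b (\<Union>s\<in>S'. range s) \<subseteq> v ` (T \<times> UNIV)"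
      unfolding S'_def v(1)[symmetric] using T' by auto
    ultimately show ?thesis unfolding v(3) by blast
  qed
  have new: "s j \<in> H - Y" if "s \<in> S'" for s j
    using that YH v_ne_b H unfolding S'_def by blast
  have old: "s j \<in> Y" if "s \<in> S" for s j
    using that B(4) by blast
  have "inj_on (\<lambda>(s, j). s j) ((S \<union> S') \<times> UNIV)"
  proof (rule inj_onI, clarify)
    fix s j s' j' assume *: "s \<in> S \<union> S'" "s' \<in> S \<union> S'" and eq: "s j = s' (j' :: nat)"
    consider "s \<in> S" "s' \<in> S" | "s \<in> S'" "s' \<in> S'"
      using * new old eq by (metis DiffD2 UnE)
    then show "s = s' \<and> j = j'"
    proof cases
      case 1
      then show ?thesis using inj_onD[OF B(3), of "(s, j)" "(s', j')"] eq by auto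
    next
      case 2
      then obtain x y where xy: "x \<in> T - {t0}" "y \<in> T - {t0}" "s = (\<lambda>j. v (x, j))" "s' = (\<lambda>j. v (y, j))"
        unfolding S'_def by blast
      then have "(x, j) = (y, j')"
        using eq by (intro inj_onD[OF v(4)]) auto
      then show ?thesis using xy by simp
    qed
  qed
  moreover have "sequence_step X f (S \<union> S') s" if s: "s \<in> S'" for s
  proof -
    obtain x where x: "x \<in> T - {t0}" and s_eq: "s = (\<lambda>j. v (x, j))"
      using s unfolding S'_def by blast
    have S'I: "(\<lambda>j. v (y, j)) \<in> S \<union> S'" if "y \<in> T" "y \<noteq> t0" for y
      unfolding S'_def using that by blast
    have via: "sequence_step X f (S \<union> S') s" if xy: "(x, y) \<in> \<eta>" for y
    proof (cases "y = t0")
      case False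
      then have "(\<lambda>j. v (y, j)) \<in> S \<union> S'" using xy T'(4) S'I by blast
      then show ?thesis by (rule sequence_stepI(2)) (simp add: edge[OF xy] s_eq)
    next
      case y: True
      show ?thesis
      proof (cases "t1 = t0")
        case True
        then have "v (t0, j) = b" for j
        proof (induction j)
          case (Suc j)
          then show ?case using True v(2)[of j] by simp
        qed (rule v(1))
        then have "f (s j) = Some b" for j using edge[OF xy] s_eq y by simp
        moreover have "b \<in> X" using H HX by blast
        ultimately show ?thesis by (intro sequence_stepI(4))
      next
        \<comment> \<open>An edge of copy \<open>Suc j\<close> into \<open>t0\<close> ends at
          \<open>t1\<close> of copy \<open>j\<close>.\<close>
        case False
        then have "(\<lambda>j. v (t1, j)) \<in> S \<union> S'" using T' S'I by blast
        then show ?thesis by (rule sequence_stepI(1)) (simp add: edge[OF xy] s_eq y v(2))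
      qed
    qed
    show ?thesis
    proof (cases "\<exists>y. (x, y) \<in> \<eta>")
      case True
      then show ?thesis using via by blast
    next
      \<comment> \<open>A vertex without an out-edge can only be \<open>t1\<close> of an outward
        template. In the next copy it is \<open>t0\<close>, which does have an out-edge, so the
        index rises by one.\<close>
      case no_edge: False
      with orient x have o: "t0 \<noteq> t1" "oriented_towards T \<eta> t1" and xt: "x = t1"
        unfolding oriented_towards_def by (metis DiffD1 DiffD2 out_edge_if_reaches singletonI)+
      then obtain y where y: "(t0, y) \<in> \<eta>"
        using T' unfolding oriented_towards_def by (metis out_edge_if_reaches)
      then have "y \<in> T" "y \<noteq> t0" using T' by auto
      then have "(\<lambda>j. v (y, j)) \<in> S \<union> S'" by (rule S'I)
      then show ?thesis by (rule sequence_stepI(3)) (simp add: edge[OF y] s_eq xt v(2))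
    qed
  qed
  moreover have "sequence_step X f (S \<union> S') s" if "s \<in> S" for s
    using B(6)[rule_format, OF that] by (rule sequence_step_mono) simp
  moreover have "Y \<union> H = B \<union> (\<Union>s\<in>S \<union> S'. range s)"
    using B(4) H YH by blast
  moreover have "B \<inter> (\<Union>s\<in>S \<union> S'. range s) = {}"
    using B(4,5) new by blast
  moreover have "finite (S \<union> S')" using B(2) T'(1) unfolding S'_def by simp
  ultimately show ?thesis
    unfolding sequence_coded_def using B(1) by (intro exI[of _ B] exI[of _ "S \<union> S'"]) blast
qed

lemma unary_FA_presentable_if_ult_periodic:
  assumes inj: "inj_on \<psi> {m. P m}" and X: "\<psi> ` {m. P m} = X"
    and per: "ult_periodic N p (\<lambda>m n. P m \<and> P n \<and> f (\<psi> m) = Some (\<psi> n))"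
    and P: "0 < p'" "\<And>m. N' \<le> m \<Longrightarrow> P (m + p') = P m"
  shows "unary_FA_presentable X f"
proof -
  have "ult_periodic (Suc N') p' (\<lambda>m n. m = n \<and> P m)"
    unfolding ult_periodic_def using P by auto
  then have eq: "regular_rel {(u, v). length u = length v \<and> P (length u)}"
    by (rule regular_rel_if_ult_periodic)
  have sets: "{(u, v). u \<in> {u. P (length u)} \<and> v \<in> {u. P (length u)} \<and> \<psi> (length u) = \<psi> (length v)}
      = {(u :: unary list, v :: unary list). length u = length v \<and> P (length u)}"
    using inj by (auto dest: inj_onD)
  have "\<psi> ` length ` {u :: unary list. P (length u)} = X"
  proof -
    have "length ` {u :: unary list. P (length u)} = {m. P m}"
      by (auto intro!: image_eqI[of _ _ "replicate _ Ltr_a"])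
    then show ?thesis using X by simp
  qed
  then have "(\<lambda>u. \<psi> (length u)) ` {u :: unary list. P (length u)} = X"
    by (simp add: image_image)
  moreover have "regular_rel {(u, v). u \<in> {u. P (length u)} \<and> v \<in> {u. P (length u)} \<and>
      f (\<psi> (length u)) = Some (\<psi> (length v))}"
    using regular_rel_if_ult_periodic[OF per] by simp
  ultimately show ?thesis
    unfolding unary_FA_presentable_def
    using regular_if_ult_periodic[of p' N' P] P eq sets
    by (intro exI[of _ "{u. P (length u)}"] exI[of _ "\<lambda>u. \<psi> (length u)"]) simp
qed

lemma unary_FA_presentable_if_finite:
  assumes "finite X"
  shows "unary_FA_presentable X f"
proof -
  obtain b where b: "bij_betw b {0..<card X} X"
    using ex_bij_betw_nat_finite[OF assms] by blast
  show ?thesis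
  proof (rule unary_FA_presentable_if_ult_periodic)
    show "inj_on b {m. m < card X}" "b ` {m. m < card X} = X"
      using b by (auto simp: bij_betw_def lessThan_def atLeast0LessThan)
    show "ult_periodic (card X) 1 (\<lambda>m n. m < card X \<and> n < card X \<and> f (b m) = Some (b n))"
      unfolding ult_periodic_def by auto
    show "m + 1 < card X \<longleftrightarrow> m < card X" if "card X \<le> m" for m using that by simp
  qed simp
qed

text \<open>Beyond \<open>M\<close> the map either commutes with translation by \<open>q\<close> and
  stays near the diagonal, or is bounded and does not change under that translation. These are just
  the two ways in which the edge relation can be ultimately periodic.\<close>

lemma unary_FA_presentable_if_eventually_equivariant:
  fixes \<psi> :: "nat \<Rightarrow> 'x"
  assumes bij: "bij_betw \<psi> UNIV X" and q: "0 < q"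
    and step: "\<And>m. M \<le> m \<Longrightarrow>
       (\<exists>n. f (\<psi> m) = Some (\<psi> n) \<and> f (\<psi> (m + q)) = Some (\<psi> (n + q)) \<and> n \<le> m + 2 * q \<and> m \<le> n + 2 * q)
     \<or> (\<exists>n\<le>C. f (\<psi> m) = Some (\<psi> n) \<and> f (\<psi> (m + q)) = Some (\<psi> n))"
  shows "unary_FA_presentable X f"
proof -
  have inj: "\<psi> m = \<psi> n \<longleftrightarrow> m = n" for m n
    using bij unfolding bij_betw_def by (auto dest: inj_onD)
  define val where "val m = (SOME n. f (\<psi> m) = Some (\<psi> n))" for m
  have val: "n = val m" if "f (\<psi> m) = Some (\<psi> n)" for m n
    using someI[of "\<lambda>n. f (\<psi> m) = Some (\<psi> n)", OF that] that inj unfolding val_def by simp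
  \<comment> \<open>\<open>N\<close> exceeds the drift \<open>2 * q\<close>, the bound
    \<open>C\<close> and, through \<open>Max\<close>, the values at the finitely many
    \<open>m < M\<close>. Hence there are no edges from \<open>m\<close> to any
    \<open>n \<ge> m + N\<close>, and those from \<open>m\<close> to \<open>n\<close> with
    \<open>n + N \<le> m\<close> come from constant steps.\<close>
  define N where "N = M + C + 3 * q + 1 + Max (insert 0 (val ` {..<M}))"
  have N: "M \<le> N" "C < N" "3 * q < N" unfolding N_def by simp_all
  have small: "n < N" if "m < M" "f (\<psi> m) = Some (\<psi> n)" for m n
  proof -
    have "n \<le> Max (insert 0 (val ` {..<M}))"
      using that val by (intro Max_ge) auto
    then show ?thesis unfolding N_def by simp
  qed
  let ?R = "\<lambda>m n. f (\<psi> m) = Some (\<psi> n)"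
  have "ult_periodic N q ?R"
    unfolding ult_periodic_def
  proof (intro conjI allI impI q)
    fix m n assume mn: "N \<le> m" "N \<le> n"
    then have "M \<le> m" using N by simp
    from step[OF this] show "?R (m + q) (n + q) = ?R m n"
      using mn N inj by auto
  next
    fix m n assume mn: "m + N \<le> n"
    have "\<not> ?R m n'" if "n \<le> n'" for n'
    proof (cases "M \<le> m")
      case True
      from step[OF this] show ?thesis using mn N inj that by auto
    next
      case False
      then show ?thesis using small[of m n'] mn that by auto
    qed
    then show "?R m (n + q) = ?R m n" by simp
  next
    fix m n assume mn: "n + N \<le> m"
    then have "M \<le> m" using N by simp
    from step[OF this] show "?R (m + q) n = ?R m n"
      using mn N inj by auto
  qed
  then show ?thesis
    using bij unfolding bij_betw_def
    by (intro unary_FA_presentable_if_ult_periodic[of \<psi> "\<lambda>_. True" X N q f 1 0]) auto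
qed

text \<open>After the finite set \<open>B\<close>, the sequences are listed in parallel, index by
  index. Raising the index by one then becomes translation by \<open>q = card S\<close>.\<close>

lemma unary_FA_presentable_if_sequence_coded:
  assumes "sequence_coded X f X"
  shows "unary_FA_presentable X f"
proof -
  from assms obtain B S where B: "finite B" and S: "finite S" "inj_on (\<lambda>(s, j). s j) (S \<times> UNIV)"
    and X: "X = B \<union> (\<Union>s\<in>S. range s)" "B \<inter> (\<Union>s\<in>S. range s) = {}"
    and step: "\<forall>s\<in>S. sequence_step X f S s"
    unfolding sequence_coded_def by (elim exE conjE) (rule that)
  define k where "k = card B"
  define q where "q = card S"
  obtain b where b: "bij_betw b {0..<k} B"
    using ex_bij_betw_nat_finite[OF B] k_def by blast
  obtain e where e: "bij_betw e {0..<q} S"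
    using ex_bij_betw_nat_finite[OF S(1)] q_def by blast
  show ?thesis
  proof (cases "S = {}")
    case True
    then show ?thesis using X B by (intro unary_FA_presentable_if_finite) simp
  next
    case False
    then have q: "0 < q" using S(1) unfolding q_def by (simp add: card_gt_0_iff)
    define \<psi> where "\<psi> m = (if m < k then b m else e ((m - k) mod q) ((m - k) div q))" for m
    have \<psi>_seq: "\<psi> (k + j * q + i) = e i j" if "i < q" for i j
      using that by (simp add: \<psi>_def)
    have decomp: "\<exists>i j. i < q \<and> m = k + j * q + i" if "k \<le> m" for m
    proof -
      have "m = k + ((m - k) div q) * q + (m - k) mod q"
        using that div_mult_mod_eq[of "m - k" q] by simp
      then show ?thesis using q mod_less_divisor by blast
    qed
    have eS: "e i \<in> S" if "i < q" for i
      using e that unfolding bij_betw_def by auto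
    have e_inj: "i = i' \<and> j = j'" if "i < q" "i' < q" "e i j = e i' j'" for i i' j j'
    proof -
      have "(e i, j) = (e i', j')"
        by (rule inj_onD[OF S(2)]) (use that eS in auto)
      then show ?thesis using e that unfolding bij_betw_def by (auto dest: inj_onD)
    qed
    have "bij_betw \<psi> UNIV X"
      unfolding bij_betw_def
    proof
      show "inj \<psi>"
      proof (rule injI)
        fix m n assume eq: "\<psi> m = \<psi> n"
        have B_iff: "\<psi> m \<in> B \<longleftrightarrow> m < k" for m
        proof (cases "m < k")
          case True
          then show ?thesis using b unfolding bij_betw_def by (auto simp: \<psi>_def)
        next
          case False
          then show ?thesis using X(2) eS[of "(m - k) mod q"] q by (auto simp: \<psi>_def)
        qed
        show "m = n"
        proof (cases "m < k")
          case True
          then have "n < k" using B_iff eq by metis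
          then show ?thesis using True eq b unfolding bij_betw_def by (auto simp: \<psi>_def dest: inj_onD)
        next
          case False
          then have "\<not> n < k" using B_iff eq by metis
          then show ?thesis using False decomp[of m] decomp[of n] eq \<psi>_seq e_inj
            by (metis linorder_not_less)
        qed
      qed
      show "range \<psi> = X"
      proof (intro equalityI subsetI)
        fix x assume "x \<in> range \<psi>"
        then obtain m where m: "x = \<psi> m" by blast
        show "x \<in> X"
        proof (cases "m < k")
          case True
          then show ?thesis using b m unfolding X(1) bij_betw_def by (auto simp: \<psi>_def)
        next
          case False
          then have "x = e ((m - k) mod q) ((m - k) div q)" using m by (simp add: \<psi>_def)
          moreover have "e ((m - k) mod q) \<in> S" using eS q by simp
          ultimately show ?thesis unfolding X(1) by blast
        qed
      next
        fix x assume "x \<in> X"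
        then consider "x \<in> B" | s j where "s \<in> S" "x = s j" using X(1) by blast
        then show "x \<in> range \<psi>"
        proof cases
          case 1
          then obtain m where "m < k" "x = b m" using b unfolding bij_betw_def by auto
          then show ?thesis by (auto simp: \<psi>_def intro!: image_eqI[of _ _ m])
        next
          case 2
          then obtain i where "i < q" "s = e i" using e unfolding bij_betw_def by auto
          then show ?thesis using \<psi>_seq[of i j] 2 by (metis rangeI)
        qed
      qed
    qed
    then have bij: "bij_betw \<psi> UNIV X" .
    \<comment> \<open>Where the sequence has no constant value this number is arbitrary and at most
      enlarges \<open>C\<close>.\<close>
    define cst where "cst i = (SOME n. \<forall>j. f (e i j) = Some (\<psi> n))" for i
    define C where "C = Max (cst ` {..<q})"
    \<comment> \<open>The threshold \<open>k + q\<close> skips \<open>B\<close> and the terms of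
      index 0, about which the falling case of \<open>sequence_step\<close> says nothing.\<close>
    show ?thesis
    proof (rule unary_FA_presentable_if_eventually_equivariant[OF bij q, where M = "k + q" and C = C])
      fix m assume "k + q \<le> m"
      then obtain i j where m: "i < q" "m = k + j * q + i"
        using decomp[of m] by auto
      have j: "j \<noteq> 0" using m \<open>k + q \<le> m\<close> by (cases j) auto
      have mq: "m + q = k + Suc j * q + i" using m by simp
      from step[rule_format, OF eS[OF m(1)]] consider
          s' where "s' \<in> S" "\<And>j. f (e i (Suc j)) = Some (s' j)"
        | s' where "s' \<in> S" "\<And>j. f (e i j) = Some (s' j)"
        | s' where "s' \<in> S" "\<And>j. f (e i j) = Some (s' (Suc j))"
        | c where "c \<in> X" "\<And>j. f (e i j) = Some c"
        unfolding sequence_step_def by metis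
      \<comment> \<open>The index changes by \<open>a - 1\<close>, that is by -1, 0 or 1; the offset
        keeps the expression within the naturals.\<close>
      then have "(\<exists>i' a. i' < q \<and> a \<le> 2 \<and> f (e i j) = Some (e i' (j + a - 1)) \<and> f (e i (Suc j)) = Some (e i' (Suc j + a - 1)))
          \<or> (\<exists>c\<in>X. \<forall>j. f (e i j) = Some c)"
      proof cases
        case 1
        then obtain i' where "i' < q" "s' = e i'" using e unfolding bij_betw_def by auto
        then show ?thesis using 1(2)[of "j - 1"] 1(2)[of j] j by (intro disjI1 exI[of _ i'] exI[of _ 0]) auto
      next
        case 2
        then obtain i' where "i' < q" "s' = e i'" using e unfolding bij_betw_def by auto
        then show ?thesis using 2 by (intro disjI1 exI[of _ i'] exI[of _ 1]) auto
      next
        case 3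
        then obtain i' where "i' < q" "s' = e i'" using e unfolding bij_betw_def by auto
        then show ?thesis using 3 by (intro disjI1 exI[of _ i'] exI[of _ 2]) auto
      qed blast
      then show "(\<exists>n. f (\<psi> m) = Some (\<psi> n) \<and> f (\<psi> (m + q)) = Some (\<psi> (n + q)) \<and> n \<le> m + 2 * q \<and> m \<le> n + 2 * q)
        \<or> (\<exists>n\<le>C. f (\<psi> m) = Some (\<psi> n) \<and> f (\<psi> (m + q)) = Some (\<psi> n))"
      proof (elim disjE exE conjE bexE)
        fix i' a assume a: "i' < q" "a \<le> 2" "f (e i j) = Some (e i' (j + a - 1))"
          "f (e i (Suc j)) = Some (e i' (Suc j + a - 1))"
        let ?n = "k + (j + a - 1) * q + i'"
        have nq: "?n + q = k + (Suc j + a - 1) * q + i'" using j by (cases j) simp_all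
        have "f (\<psi> m) = Some (\<psi> ?n)" "f (\<psi> (m + q)) = Some (\<psi> (?n + q))"
          unfolding nq mq unfolding m(2) \<psi>_seq[OF m(1)] \<psi>_seq[OF a(1)] by (rule a)+
        moreover have "(j + a - 1) * q \<le> Suc j * q" "j * q \<le> Suc (j + a - 1) * q"
          using a(2) j by (intro mult_right_mono; simp)+
        then have "?n \<le> m + 2 * q" "m \<le> ?n + 2 * q"
          using m a(1) by simp_all
        ultimately show ?thesis by blast
      next
        fix c assume c: "c \<in> X" "\<forall>j. f (e i j) = Some c"
        then obtain n where "c = \<psi> n" using bij unfolding bij_betw_def by blast
        with c have "\<forall>j. f (e i j) = Some (\<psi> (cst i))"
          unfolding cst_def by (intro someI[of "\<lambda>n. \<forall>j. f (e i j) = Some (\<psi> n)"]) simp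
        then have "f (\<psi> m) = Some (\<psi> (cst i))" "f (\<psi> (m + q)) = Some (\<psi> (cst i))"
          unfolding mq unfolding m(2) \<psi>_seq[OF m(1)] by blast+
        moreover have "cst i \<le> C" unfolding C_def using m(1) by (intro Max_ge) auto
        ultimately show ?thesis by blast
      qed
    qed
  qed
qed

lemma template_param_if_inward_piece:
  assumes "inward_periodic_path H E b \<or> inward_shallow_star H E b" "E \<subseteq> H \<times> H" "b \<in> H"
  shows "\<exists>v T \<eta> t0 t1. template_param v T \<eta> t0 t1 H E b \<and> template T \<eta> t0 t1 \<and> oriented_towards T \<eta> t0"
proof -
  obtain T \<eta> t0 t1 where T: "template T \<eta> t0 t1" "oriented_towards T \<eta> t0"
      "graph_iso_pt H E b (S_V T t0 t1) (S_E \<eta> t0 t1) (S_base t0 t1)"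
    using assms(1) unfolding inward_periodic_path_def inward_shallow_star_def by blast
  then have "\<exists>v. template_param v T \<eta> t0 t1 H E b"
    using assms by (intro template_param_exists) (auto simp: template_def dtree_def)
  then show ?thesis using T by blast
qed

text \<open>Pieces are added one at a time. Two of them overlap only inside \<open>B\<close>, so a
  new piece meets everything already present in its base alone.\<close>

lemma sequence_coded_attached:
  assumes att: "attached V E B EB n H EH g" and V: "V \<subseteq> X" and E: "E \<subseteq> graph_edges X f"
    and pieces: "\<And>k. k < n \<Longrightarrow> inward_periodic_path (H k) (EH k) (g k) \<or> inward_shallow_star (H k) (EH k) (g k)"
    and B: "sequence_coded X f B"
  shows "sequence_coded X f V"
proof -
  have att': "\<And>k. k < n \<Longrightarrow> EH k \<subseteq> H k \<times> H k \<and> g k \<in> B \<and> B \<inter> H k = {g k}"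
    "\<And>k l. k < n \<Longrightarrow> l < n \<Longrightarrow> k \<noteq> l \<Longrightarrow> H k \<inter> H l \<subseteq> B"
    "V = B \<union> (\<Union>k<n. H k)" "E = EB \<union> (\<Union>k<n. EH k)"
    using att unfolding attached_def by blast+
  have "sequence_coded X f (B \<union> (\<Union>k<i. H k))" if "i \<le> n" for i
    using that
  proof (induction i)
    case (Suc i)
    then have i: "i < n" by simp
    obtain v T \<eta> t0 t1 where v: "template_param v T \<eta> t0 t1 (H i) (EH i) (g i)" "template T \<eta> t0 t1"
        "oriented_towards T \<eta> t0"
      using template_param_if_inward_piece[OF pieces[OF i]] att'(1)[OF i] by blast
    have "(B \<union> (\<Union>k<i. H k)) \<inter> H i = {g i}"
    proof -
      have "H k \<inter> H i \<subseteq> {g i}" if "k < i" for k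
        using att'(2)[of k i] att'(1)[OF i] i that by force
      then show ?thesis using att'(1)[OF i] by blast
    qed
    moreover have "H i \<subseteq> X" "EH i \<subseteq> graph_edges X f"
      using V E i unfolding att'(3,4) by blast+
    ultimately have "sequence_coded X f ((B \<union> (\<Union>k<i. H k)) \<union> H i)"
      using Suc v by (intro sequence_coded_attach[OF _ v(1,2)]) auto
    then show ?case by (simp add: lessThan_Suc Un_ac)
  qed (simp add: B)
  then show ?thesis unfolding att'(3) by blast
qed

lemma finite_cycle_with_trees:
  assumes "cycle_with_trees B EB"
  shows "finite B"
proof -
  obtain C EC m T ET r where att: "attached B EB C EC m T ET r" and C: "finite_dcycle C EC"
    and T: "\<forall>k<m. inward_rooted_tree (T k) (ET k) (r k)"
    using assms unfolding cycle_with_trees_def by blast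
  obtain c h where "bij_betw h C (cycle_graph_V c)"
    using C unfolding finite_dcycle_def graph_iso_def by blast
  then have "finite C" by (simp add: bij_betw_finite cycle_graph_V_def)
  then show ?thesis
    using att T unfolding attached_def inward_rooted_tree_def dtree_def by auto
qed

lemma sequence_coded_tree_with_outward_path:
  assumes "tree_with_outward_path B EB" "B \<subseteq> X" "EB \<subseteq> graph_edges X f"
  shows "sequence_coded X f B"
proof -
  obtain T0 ET r P EP where T0: "inward_rooted_tree T0 ET r"
    and att: "attached B EB T0 ET 1 (\<lambda>_. P) (\<lambda>_. EP) (\<lambda>_. r)"
    and P: "outward_periodic_path P EP r"
    using assms(1) unfolding tree_with_outward_path_def by blast
  have att': "EP \<subseteq> P \<times> P" "T0 \<inter> P = {r}" "B = T0 \<union> P" "EB = ET \<union> EP"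
    using att unfolding attached_def by auto
  obtain T \<eta> t0 t1 where T: "template T \<eta> t0 t1" "t0 \<noteq> t1" "oriented_towards T \<eta> t1"
      "graph_iso_pt P EP r (S_V T t0 t1) (S_E \<eta> t0 t1) (S_base t0 t1)"
    using P unfolding outward_periodic_path_def by blast
  then have "\<exists>v. template_param v T \<eta> t0 t1 P EP r"
    using att' by (intro template_param_exists) (auto simp: template_def dtree_def)
  then obtain v where "template_param v T \<eta> t0 t1 P EP r" by blast
  moreover have "sequence_coded X f T0"
    using T0 by (intro sequence_coded_finite) (simp add: inward_rooted_tree_def dtree_def)
  ultimately show ?thesis
    unfolding att'(3) using T att' assms(2,3) by (intro sequence_coded_attach) auto
qed

lemma unary_FA_presentable_if_ways:
  assumes "way1 X (graph_edges X f) \<or> way2 X (graph_edges X f) \<or> way3 X (graph_edges X f)"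
  shows "unary_FA_presentable X f"
proof -
  obtain B EB where B: "cycle_with_trees B EB \<or> tree_with_outward_path B EB \<or> (\<exists>r. inward_rooted_tree B EB r)"
    and att: "attach_paths_stars X (graph_edges X f) B EB"
    using assms unfolding way1_def way2_def way3_def by blast
  from att obtain n H EH g where att: "attached X (graph_edges X f) B EB n H EH g"
     and pieces: "\<forall>k<n. inward_periodic_path (H k) (EH k) (g k) \<or> inward_shallow_star (H k) (EH k) (g k)"
    unfolding attach_paths_stars_def by (elim exE conjE) (rule that)
  have "X = B \<union> (\<Union>k<n. H k)" using att unfolding attached_def by (elim conjE)
  moreover have "graph_edges X f = EB \<union> (\<Union>k<n. EH k)" using att unfolding attached_def by (elim conjE)
  ultimately have BX: "B \<subseteq> X" "EB \<subseteq> graph_edges X f" by (metis Un_upper1)+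
  have "sequence_coded X f B"
    using B
  proof (elim disjE exE)
    assume "tree_with_outward_path B EB"
    then show ?thesis using BX by (rule sequence_coded_tree_with_outward_path)
  next
    assume "cycle_with_trees B EB"
    then show ?thesis by (intro sequence_coded_finite finite_cycle_with_trees)
  next
    fix r assume "inward_rooted_tree B EB r"
    then show ?thesis by (intro sequence_coded_finite) (simp add: inward_rooted_tree_def dtree_def)
  qed
  then have "sequence_coded X f X"
    using pieces by (intro sequence_coded_attached[OF att order_refl order_refl]) simp_all
  then show ?thesis by (rule unary_FA_presentable_if_sequence_coded)
qed

section \<open>Invariance under isomorphism\<close>

lemma map_prod_image_mem_iff:
  assumes "inj_on h V" "E \<subseteq> V \<times> V" "x \<in> V" "y \<in> V"
  shows "(h x, h y) \<in> map_prod h h ` E \<longleftrightarrow> (x, y) \<in> E"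
  using inj_on_image_mem_iff[OF map_prod_inj_on[OF assms(1,1)], of "(x, y)" E] assms by simp

text \<open>The decomposition will be found on a set of natural numbers; this and the following
  image lemmas carry it to \<open>X\<close> along an injection.\<close>

lemma graph_iso_pt_image:
  assumes iso: "graph_iso_pt H E b S F s" and inj: "inj_on h H" and "E \<subseteq> H \<times> H" "b \<in> H"
  shows "graph_iso_pt (h ` H) (map_prod h h ` E) (h b) S F s"
proof -
  obtain k where k: "bij_betw k H S" "k b = s" "\<And>x y. x \<in> H \<Longrightarrow> y \<in> H \<Longrightarrow> (x, y) \<in> E \<longleftrightarrow> (k x, k y) \<in> F"
    using iso unfolding graph_iso_pt_def by blast
  let ?k = "\<lambda>z. k (inv_into H h z)"
  have "bij_betw ?k (h ` H) S"
    using bij_betw_trans[OF bij_betw_inv_into[OF inj_on_imp_bij_betw[OF inj]] k(1)] by (simp add: o_def)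
  moreover have "(h x, h y) \<in> map_prod h h ` E \<longleftrightarrow> (x, y) \<in> E" if "x \<in> H" "y \<in> H" for x y
    using inj assms(3) that by (rule map_prod_image_mem_iff)
  ultimately show ?thesis
    unfolding graph_iso_pt_def using k inv_into_f_f[OF inj] assms(4)
    by (intro exI[of _ ?k]) auto
qed

lemma graph_iso_image:
  assumes iso: "graph_iso H E S F" and inj: "inj_on h H" and "E \<subseteq> H \<times> H"
  shows "graph_iso (h ` H) (map_prod h h ` E) S F"
proof (cases "H = {}")
  case True
  then show ?thesis using iso assms(3) by (auto simp: graph_iso_def bij_betw_def)
next
  case False
  then obtain b where b: "b \<in> H" by blast
  obtain k where "bij_betw k H S" "\<forall>x\<in>H. \<forall>y\<in>H. (x, y) \<in> E \<longleftrightarrow> (k x, k y) \<in> F"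
    using iso unfolding graph_iso_def by blast
  then have "graph_iso_pt H E b S F (k b)" unfolding graph_iso_pt_def by blast
  from graph_iso_pt_image[OF this inj assms(3) b] show ?thesis
    unfolding graph_iso_pt_def graph_iso_def by blast
qed

lemma rtrancl_map_prod: "(x, y) \<in> R\<^sup>* \<Longrightarrow> (h x, h y) \<in> (map_prod h h ` R)\<^sup>*"
proof (induction rule: rtrancl_induct)
  case (step y z)
  then have "(h y, h z) \<in> map_prod h h ` R" by force
  with step show ?case by (meson rtrancl.rtrancl_into_rtrancl)
qed simp

lemma inward_rooted_tree_image:
  assumes "inward_rooted_tree V E r" and inj: "inj_on h V"
  shows "inward_rooted_tree (h ` V) (map_prod h h ` E) (h r)"
proof -
  have d: "finite V" "E \<subseteq> V \<times> V" "\<And>x. (x, x) \<notin> E" "\<And>x y. (x, y) \<in> E \<Longrightarrow> (y, x) \<notin> E"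
    "\<And>x y. x \<in> V \<Longrightarrow> y \<in> V \<Longrightarrow> (x, y) \<in> (E \<union> E\<inverse>)\<^sup>*" "card E + 1 = card V"
    and r: "r \<in> V" "\<And>x. x \<in> V \<Longrightarrow> (x, r) \<in> E\<^sup>*"
    using assms(1) unfolding inward_rooted_tree_def dtree_def by blast+
  have mem: "(h x, h y) \<in> map_prod h h ` E \<longleftrightarrow> (x, y) \<in> E" if "x \<in> V" "y \<in> V" for x y
    using inj d(2) that by (rule map_prod_image_mem_iff)
  have sub: "map_prod h h ` E \<subseteq> h ` V \<times> h ` V" using d(2) by auto
  have conv: "map_prod h h ` (E \<union> E\<inverse>) = map_prod h h ` E \<union> (map_prod h h ` E)\<inverse>" by force
  have "card (map_prod h h ` E) = card E"
    by (rule card_image, rule inj_on_subset[OF map_prod_inj_on[OF inj inj] d(2)])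
  moreover have "card (h ` V) = card V" using inj by (rule card_image)
  moreover have "(a, c) \<in> (map_prod h h ` E \<union> (map_prod h h ` E)\<inverse>)\<^sup>*" if "a \<in> h ` V" "c \<in> h ` V" for a c
  proof -
    obtain x y where "x \<in> V" "y \<in> V" "a = h x" "c = h y" using \<open>a \<in> h ` V\<close> \<open>c \<in> h ` V\<close> by blast
    then show ?thesis using rtrancl_map_prod[OF d(5)[of x y], of h] by (simp add: conv)
  qed
  moreover have "(a, a) \<notin> map_prod h h ` E" for a
  proof
    assume a: "(a, a) \<in> map_prod h h ` E"
    then obtain x where "x \<in> V" "a = h x" using sub by blast
    then show False using mem[of x x] a d(3)[of x] by simp
  qed
  moreover have "(c, a) \<notin> map_prod h h ` E" if ac: "(a, c) \<in> map_prod h h ` E" for a c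
  proof -
    obtain x y where "x \<in> V" "y \<in> V" "a = h x" "c = h y" using ac sub by blast
    then show ?thesis using mem[of x y] mem[of y x] ac d(4)[of x y] by simp
  qed
  moreover have "(a, h r) \<in> (map_prod h h ` E)\<^sup>*" if "a \<in> h ` V" for a
    using that rtrancl_map_prod[OF r(2)] by blast
  ultimately show ?thesis
    unfolding inward_rooted_tree_def dtree_def using d r sub by simp
qed

lemma attached_image:
  assumes att: "attached V E B EB n H EH g" and inj: "inj_on h V"
  shows "attached (h ` V) (map_prod h h ` E) (h ` B) (map_prod h h ` EB) n
           (\<lambda>k. h ` H k) (\<lambda>k. map_prod h h ` EH k) (\<lambda>k. h (g k))"
proof -
  have att': "EB \<subseteq> B \<times> B" "\<And>k. k < n \<Longrightarrow> EH k \<subseteq> H k \<times> H k" "\<And>k. k < n \<Longrightarrow> g k \<in> B"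
    "\<And>k. k < n \<Longrightarrow> B \<inter> H k = {g k}"
    "\<And>k l. k < n \<Longrightarrow> l < n \<Longrightarrow> k \<noteq> l \<Longrightarrow> H k \<inter> H l \<subseteq> B"
    and V: "V = B \<union> (\<Union>k<n. H k)" and E: "E = EB \<union> (\<Union>k<n. EH k)"
    using att unfolding attached_def by auto
  have HV: "B \<subseteq> V" "\<And>k. k < n \<Longrightarrow> H k \<subseteq> V" unfolding V by auto
  have "h ` B \<inter> h ` H k = {h (g k)}" if "k < n" for k
    using inj_on_image_Int[OF inj HV(1) HV(2)[OF that]] att'(4)[OF that] by simp
  moreover have "h ` H k \<inter> h ` H l \<subseteq> h ` B" if "k < n" "l < n" "k \<noteq> l" for k l
    using inj_on_image_Int[OF inj HV(2)[OF that(1)] HV(2)[OF that(2)]] att'(5)[OF that] by blast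
  moreover have "map_prod h h ` EB \<subseteq> h ` B \<times> h ` B" using att'(1) by auto
  moreover have "map_prod h h ` EH k \<subseteq> h ` H k \<times> h ` H k" if "k < n" for k
    using att'(2)[OF that] by auto
  moreover have "h ` V = h ` B \<union> (\<Union>k<n. h ` H k)" unfolding V by auto
  moreover have "map_prod h h ` E = map_prod h h ` EB \<union> (\<Union>k<n. map_prod h h ` EH k)"
    unfolding E by auto
  ultimately show ?thesis unfolding attached_def using att'(3) by simp
qed

lemma attached_piece:
  assumes "attached V E B EB n H EH g" "k < n"
  shows "EH k \<subseteq> H k \<times> H k" "g k \<in> H k" "H k \<subseteq> V"
proof -
  have "\<forall>k<n. EH k \<subseteq> H k \<times> H k \<and> g k \<in> B \<and> B \<inter> H k = {g k}"
    using assms(1) unfolding attached_def by (elim conjE)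
  then show "EH k \<subseteq> H k \<times> H k" "g k \<in> H k" using assms(2) by blast+
  have "V = B \<union> (\<Union>k<n. H k)" using assms(1) unfolding attached_def by (elim conjE)
  then show "H k \<subseteq> V" using assms(2) by (metis UN_upper le_supI2 lessThan_iff)
qed

lemma attached_base:
  assumes "attached V E B EB n H EH g"
  shows "EB \<subseteq> B \<times> B" "B \<subseteq> V"
proof -
  show "EB \<subseteq> B \<times> B" using assms unfolding attached_def by (elim conjE)
  have "V = B \<union> (\<Union>k<n. H k)" using assms(1) unfolding attached_def by (elim conjE)
  then show "B \<subseteq> V" by (metis Un_upper1)
qed

lemma piece_image:
  assumes "inj_on h H" "E \<subseteq> H \<times> H" "b \<in> H"
  shows "inward_periodic_path H E b \<Longrightarrow> inward_periodic_path (h ` H) (map_prod h h ` E) (h b)"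
    and "inward_shallow_star H E b \<Longrightarrow> inward_shallow_star (h ` H) (map_prod h h ` E) (h b)"
    and "outward_periodic_path H E b \<Longrightarrow> outward_periodic_path (h ` H) (map_prod h h ` E) (h b)"
  unfolding inward_periodic_path_def inward_shallow_star_def outward_periodic_path_def
  using graph_iso_pt_image[OF _ assms] by fast+

lemma attach_paths_stars_image:
  assumes "attach_paths_stars V E B EB" and inj: "inj_on h V"
  shows "attach_paths_stars (h ` V) (map_prod h h ` E) (h ` B) (map_prod h h ` EB)"
proof -
  from assms(1) obtain n H EH g where att: "attached V E B EB n H EH g"
    and pieces: "\<forall>k<n. inward_periodic_path (H k) (EH k) (g k) \<or> inward_shallow_star (H k) (EH k) (g k)"
    unfolding attach_paths_stars_def by (elim exE conjE) (rule that)
  have "inward_periodic_path (h ` H k) (map_prod h h ` EH k) (h (g k)) \<or>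
      inward_shallow_star (h ` H k) (map_prod h h ` EH k) (h (g k))" if "k < n" for k
    using pieces[rule_format, OF that]
      piece_image(1,2)[OF inj_on_subset[OF inj attached_piece(3)[OF att that]] attached_piece(1,2)[OF att that]]
    by argo
  then show ?thesis
    unfolding attach_paths_stars_def using attached_image[OF att inj]
    by (intro exI[of _ n] exI[of _ "\<lambda>k. h ` H k"] exI[of _ "\<lambda>k. map_prod h h ` EH k"] exI[of _ "\<lambda>k. h (g k)"]) blast
qed

lemma attach_paths_stars_base:
  assumes "attach_paths_stars V E B EB"
  shows "B \<subseteq> V"
  using assms attached_base(2) unfolding attach_paths_stars_def by (elim exE conjE)

lemma way1_image:
  assumes "way1 V E" and inj: "inj_on h V"
  shows "way1 (h ` V) (map_prod h h ` E)"
proof -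
  obtain B EB where B: "cycle_with_trees B EB" and att: "attach_paths_stars V E B EB"
    using assms(1) unfolding way1_def by blast
  have injB: "inj_on h B" using inj attach_paths_stars_base[OF att] by (rule inj_on_subset)
  from B obtain C EC m T ET r where C: "attached B EB C EC m T ET r" "finite_dcycle C EC"
    and T: "\<forall>k<m. inward_rooted_tree (T k) (ET k) (r k)"
    unfolding cycle_with_trees_def by (elim exE conjE) (rule that)
  have "finite_dcycle (h ` C) (map_prod h h ` EC)"
    using C(2) graph_iso_image[OF _ inj_on_subset[OF injB attached_base(2)[OF C(1)]] attached_base(1)[OF C(1)]]
    unfolding finite_dcycle_def by blast
  moreover have "inward_rooted_tree (h ` T k) (map_prod h h ` ET k) (h (r k))" if "k < m" for k
    using T[rule_format, OF that] inj_on_subset[OF injB attached_piece(3)[OF C(1) that]]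
    by (rule inward_rooted_tree_image)
  ultimately have "cycle_with_trees (h ` B) (map_prod h h ` EB)"
    unfolding cycle_with_trees_def using attached_image[OF C(1) injB]
    by (intro exI[of _ "h ` C"] exI[of _ "map_prod h h ` EC"] exI[of _ m] exI[of _ "\<lambda>k. h ` T k"]
        exI[of _ "\<lambda>k. map_prod h h ` ET k"] exI[of _ "\<lambda>k. h (r k)"]) blast
  then show ?thesis unfolding way1_def using attach_paths_stars_image[OF att inj] by blast
qed

lemma way2_image:
  assumes "way2 V E" and inj: "inj_on h V"
  shows "way2 (h ` V) (map_prod h h ` E)"
proof -
  obtain B EB where B: "tree_with_outward_path B EB" and att: "attach_paths_stars V E B EB"
    using assms(1) unfolding way2_def by blast
  have injB: "inj_on h B" using inj attach_paths_stars_base[OF att] by (rule inj_on_subset)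
  from B obtain T ET r P EP where T: "inward_rooted_tree T ET r"
    and P: "attached B EB T ET 1 (\<lambda>_. P) (\<lambda>_. EP) (\<lambda>_. r)" "outward_periodic_path P EP r"
    unfolding tree_with_outward_path_def by (elim exE conjE) (rule that)
  have "outward_periodic_path (h ` P) (map_prod h h ` EP) (h r)"
    using P(2) by (rule piece_image(3)[OF inj_on_subset[OF injB attached_piece(3)[OF P(1) zero_less_one]]
        attached_piece(1,2)[OF P(1) zero_less_one]])
  moreover have "inward_rooted_tree (h ` T) (map_prod h h ` ET) (h r)"
    using T inj_on_subset[OF injB attached_base(2)[OF P(1)]] by (rule inward_rooted_tree_image)
  ultimately have "tree_with_outward_path (h ` B) (map_prod h h ` EB)"
    unfolding tree_with_outward_path_def using attached_image[OF P(1) injB] by blast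
  then show ?thesis unfolding way2_def using attach_paths_stars_image[OF att inj] by blast
qed

lemma way3_image:
  assumes "way3 V E" and inj: "inj_on h V"
  shows "way3 (h ` V) (map_prod h h ` E)"
proof -
  obtain B EB r where B: "inward_rooted_tree B EB r" and att: "attach_paths_stars V E B EB"
    using assms(1) unfolding way3_def by blast
  have "inward_rooted_tree (h ` B) (map_prod h h ` EB) (h r)"
    using B inj_on_subset[OF inj attach_paths_stars_base[OF att]] by (rule inward_rooted_tree_image)
  then show ?thesis unfolding way3_def using attach_paths_stars_image[OF att inj] by blast
qed

section \<open>Trees cut out of the graph of a function\<close>

lemma inward_rooted_treeI:
  assumes fin: "finite V" and r: "r \<in> V" and closed: "\<And>x. x \<in> V \<Longrightarrow> x \<noteq> r \<Longrightarrow> g x \<in> V"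
    and reach: "\<And>x. x \<in> V \<Longrightarrow> \<exists>n. (g ^^ n) x = r"
  shows "inward_rooted_tree V {(x, g x) | x. x \<in> V - {r}} r"
proof -
  let ?E = "{(x, g x) | x. x \<in> V - {r}}"
  have "(x, r) \<in> ?E\<^sup>*" if "x \<in> V" "(g ^^ n) x = r" for x n
    using that
  proof (induction n arbitrary: x)
    case (Suc n)
    show ?case
    proof (cases "x = r")
      case False
      then have "(g x, r) \<in> ?E\<^sup>*"
        using Suc closed by (simp add: funpow_swap1)
      moreover have "(x, g x) \<in> ?E" using Suc False by blast
      ultimately show ?thesis by (rule converse_rtrancl_into_rtrancl[rotated])
    qed simp
  qed simp
  then have path: "(x, r) \<in> ?E\<^sup>*" if "x \<in> V" for x using that reach by blast
  have conn: "(x, y) \<in> (?E \<union> ?E\<inverse>)\<^sup>*" if "x \<in> V" "y \<in> V" for x y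
  proof -
    have "(x, r) \<in> (?E \<union> ?E\<inverse>)\<^sup>*"
      using path[OF that(1)] rtrancl_mono[of ?E "?E \<union> ?E\<inverse>"] by blast
    moreover have "(r, y) \<in> (?E \<union> ?E\<inverse>)\<^sup>*"
      using path[OF that(2)] rtrancl_mono[of "?E\<inverse>" "?E \<union> ?E\<inverse>"] by (auto simp: rtrancl_converse)
    ultimately show ?thesis by (rule rtrancl_trans)
  qed
  \<comment> \<open>A loop or a pair of antiparallel edges would trap the orbit in a set that misses
    the root; \<open>x = y\<close> covers the loop.\<close>
  have no2: "False" if "x \<in> V" "x \<noteq> r" "y \<noteq> r" "g x = y" "g y = x" for x y
  proof -
    have "(g ^^ n) x \<in> {x, y}" for n by (induction n) (use that in auto)
    then show False using reach[OF that(1)] that by (metis empty_iff insert_iff)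
  qed
  \<comment> \<open>Each vertex except the root has exactly one out-edge, which gives the edge count
    of a tree.\<close>
  have "?E = (\<lambda>x. (x, g x)) ` (V - {r})" by blast
  then have "card ?E = card (V - {r})" by (simp add: card_image inj_on_def)
  then have "card ?E + 1 = card V" using card_Suc_Diff1[OF fin r] by simp
  then show ?thesis
    unfolding inward_rooted_tree_def dtree_def
  proof (intro conjI ballI allI impI)
    show "?E \<subseteq> V \<times> V" using closed by blast
    show "(x, x) \<notin> ?E" for x
    proof
      assume "(x, x) \<in> ?E"
      then have "x \<in> V" "x \<noteq> r" "g x = x" by auto
      then show False using no2[of x x] by simp
    qed
    show "(y, x) \<notin> ?E" if "(x, y) \<in> ?E" for x y
    proof
      assume "(y, x) \<in> ?E"
      with that have "x \<in> V" "x \<noteq> r" "y \<noteq> r" "g x = y" "g y = x" by auto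
      then show False by (rule no2)
    qed
  qed (use fin r path conn in auto)
qed

section \<open>Shift-invariant sets of natural numbers\<close>

text \<open>If \<open>A\<close> is closed under adding \<open>q\<close>, each of its elements is
  \<open>d + j * q\<close> for a unique pair of a \<open>d\<close> in this set and a
  \<open>j\<close>. These generators are going to be the template vertices other than the
  base.\<close>

definition shift_gen :: "nat set \<Rightarrow> nat \<Rightarrow> nat set" where
  "shift_gen A q = {x \<in> A. \<forall>y\<in>A. x \<noteq> y + q}"

locale shift_closed =
  fixes A :: "nat set" and q :: nat
  assumes q_pos: "0 < q" and shift: "\<And>x. x \<in> A \<Longrightarrow> x + q \<in> A"
begin

lemma shift_mult: "x \<in> A \<Longrightarrow> x + j * q \<in> A"
proof (induction j)
  case (Suc j)
  then show ?case using shift[of "x + j * q"] by (simp add: ac_simps)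
qed simp

lemma shift_gen_decomp: "x \<in> A \<Longrightarrow> \<exists>d\<in>shift_gen A q. \<exists>j. x = d + j * q"
proof (induction x rule: less_induct)
  case (less x)
  show ?case
  proof (cases "x \<in> shift_gen A q")
    case True
    then show ?thesis by (intro bexI[of _ x] exI[of _ 0]) auto
  next
    case False
    then obtain y where y: "y \<in> A" "x = y + q" using less unfolding shift_gen_def by blast
    then obtain d j where "d \<in> shift_gen A q" "y = d + j * q" using less q_pos by (metis less_add_same_cancel1)
    then show ?thesis using y by (intro bexI[of _ d] exI[of _ "Suc j"]) auto
  qed
qed

lemma shift_gen_no_mult:
  assumes "d \<in> shift_gen A q" "x \<in> A" "d = x + j * q"
  shows "j = 0"
proof (cases j)
  case (Suc i)
  then have "d = (x + i * q) + q" using assms by simp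
  moreover have "x + i * q \<in> A" using assms by (intro shift_mult)
  ultimately show ?thesis using assms(1) unfolding shift_gen_def by blast
qed

lemma shift_gen_unique:
  assumes "d \<in> shift_gen A q" "d' \<in> shift_gen A q" "d + j * q = d' + j' * q"
  shows "d = d' \<and> j = j'"
proof -
  have "i = i'" if "d \<in> shift_gen A q" "d' \<in> shift_gen A q" "d + i * q = d' + i' * q" "i \<le> i'" for d d' i i'
  proof -
    have "d = d' + (i' - i) * q" using that by (simp add: diff_mult_distrib)
    then have "i' - i = 0" using that by (intro shift_gen_no_mult[of d d']) (auto simp: shift_gen_def)
    then show ?thesis using that by simp
  qed
  from this[of d d' j j'] this[of d' d j' j] have "j = j'" using assms by (metis linear)
  then show ?thesis using assms by simp
qed

text \<open>A residue class modulo \<open>q\<close> contains at most one generator.\<close>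

lemma finite_shift_gen: "finite (shift_gen A q)"
proof -
  have "inj_on (\<lambda>x. x mod q) (shift_gen A q)"
  proof (rule inj_onI)
    fix x y assume xy: "x \<in> shift_gen A q" "y \<in> shift_gen A q" "x mod q = y mod q"
    have "x + (y div q) * q = y + (x div q) * q"
      using xy(3) div_mult_mod_eq[of x q] div_mult_mod_eq[of y q] by linarith
    then show "x = y" using shift_gen_unique[OF xy(1,2)] by blast
  qed
  moreover have "(\<lambda>x. x mod q) ` shift_gen A q \<subseteq> {..<q}" using q_pos by auto
  ultimately show ?thesis by (meson finite_imageD finite_lessThan finite_subset)
qed

lemma shift_gen_subset: "shift_gen A q \<subseteq> A"
  unfolding shift_gen_def by blast

text \<open>With \<open>t0 = b\<close> and \<open>t1 = b + q\<close>, the vertex \<open>t1\<close>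
  of copy \<open>j\<close> and \<open>t0\<close> of copy \<open>Suc j\<close> are the same number,
  so the identification holds by arithmetic.\<close>

lemma template_param_shift:
  assumes b: "b \<notin> A" "b + q \<in> A"
  defines "T \<equiv> insert b (shift_gen A q)"
  shows "template_param (\<lambda>(x, j). x + j * q) T \<eta> b (b + q) (insert b A)
    {(x + j * q, y + j * q) | x y j. (x, y) \<in> \<eta>} b" and "b + q \<in> shift_gen A q"
proof -
  let ?v = "\<lambda>(x, j). x + j * q"
  have T: "T - {b} = shift_gen A q" unfolding T_def using b shift_gen_subset by blast
  show "b + q \<in> shift_gen A q" using b unfolding shift_gen_def by auto
  have "b + j * q \<in> insert b A" for j
  proof (cases j)
    case (Suc i)
    then show ?thesis using shift_mult[OF b(2), of i] by (simp add: ac_simps)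
  qed simp
  moreover have "x + j * q \<in> A" if "x \<in> shift_gen A q" for x j
    using that shift_mult shift_gen_subset by blast
  ultimately have "?v ` (T \<times> UNIV) \<subseteq> insert b A" unfolding T_def by force
  moreover have "insert b A \<subseteq> ?v ` (T \<times> UNIV)"
  proof
    fix x assume "x \<in> insert b A"
    then consider "x = b" | d j where "d \<in> shift_gen A q" "x = d + j * q" using shift_gen_decomp by blast
    then show "x \<in> ?v ` (T \<times> UNIV)"
    proof cases
      case 1
      then show ?thesis unfolding T_def by (intro image_eqI[of _ _ "(b, 0)"]) auto
    next
      case 2
      then show ?thesis unfolding T_def by (intro image_eqI[of _ _ "(d, j)"]) auto
    qed
  qed
  moreover have "inj_on ?v (insert (b, 0) (shift_gen A q \<times> UNIV))"
  proof (rule inj_onI, clarify)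
    fix x j x' j' assume *: "(x, j) \<in> insert (b, 0) (shift_gen A q \<times> UNIV)"
      "(x', j') \<in> insert (b, 0) (shift_gen A q \<times> UNIV)" and eq: "x + j * q = x' + j' * q"
    have ne: "y + i * q \<noteq> b" if "y \<in> shift_gen A q" for y i
      using that b(1) shift_mult shift_gen_subset by blast
    from * have "x = b \<and> j = 0 \<or> x \<in> shift_gen A q" "x' = b \<and> j' = 0 \<or> x' \<in> shift_gen A q" by auto
    then show "x = x' \<and> j = j'"
    proof (elim disjE conjE)
      assume "x \<in> shift_gen A q" "x' \<in> shift_gen A q"
      then show ?thesis using eq by (rule shift_gen_unique)
    qed (use eq ne[of x j] ne[of x' j'] in simp_all)
  qed
  ultimately show "template_param (\<lambda>(x, j). x + j * q) T \<eta> b (b + q) (insert b A)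
    {(x + j * q, y + j * q) | x y j. (x, y) \<in> \<eta>} b"
    unfolding template_param_def T by auto
qed

text \<open>All copies of the centre must coincide, so \<open>v\<close> ignores the copy index at
  \<open>b\<close> and translates everything else.\<close>

lemma template_param_star:
  assumes b: "b \<notin> A"
  defines "T \<equiv> insert b (shift_gen A q)" and "v \<equiv> \<lambda>(x, j). if x = b then b else x + j * q"
  shows "template_param v T \<eta> b b (insert b A) {(v (x, j), v (y, j)) | x y j. (x, y) \<in> \<eta>} b"
proof -
  have T: "T - {b} = shift_gen A q" unfolding T_def using b shift_gen_subset by blast
  have "x + j * q \<in> A" if "x \<in> shift_gen A q" for x j
    using that shift_mult shift_gen_subset by blast
  then have "v ` (T \<times> UNIV) \<subseteq> insert b A" unfolding T_def v_def by (auto split: if_splits)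
  moreover have "insert b A \<subseteq> v ` (T \<times> UNIV)"
  proof
    fix x assume x: "x \<in> insert b A"
    show "x \<in> v ` (T \<times> UNIV)"
    proof (cases "x = b")
      case True
      then show ?thesis unfolding T_def v_def by (intro image_eqI[of _ _ "(b, 0)"]) auto
    next
      case False
      then obtain d j where "d \<in> shift_gen A q" "x = d + j * q" using x shift_gen_decomp by blast
      then show ?thesis unfolding T_def v_def using b shift_gen_subset
        by (intro image_eqI[of _ _ "(d, j)"]) auto
    qed
  qed
  moreover have "inj_on v (insert (b, 0) (shift_gen A q \<times> UNIV))"
  proof (rule inj_onI, clarify)
    fix x j x' j' assume *: "(x, j) \<in> insert (b, 0) (shift_gen A q \<times> UNIV)"
      "(x', j') \<in> insert (b, 0) (shift_gen A q \<times> UNIV)" and eq: "v (x, j) = v (x', j')"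
    have ne: "y + i * q \<noteq> b" "y \<noteq> b" if "y \<in> shift_gen A q" for y i
      using that b shift_mult shift_gen_subset by blast+
    from * have "x = b \<and> j = 0 \<or> x \<in> shift_gen A q" "x' = b \<and> j' = 0 \<or> x' \<in> shift_gen A q" by auto
    then show "x = x' \<and> j = j'"
    proof (elim disjE conjE)
      assume "x \<in> shift_gen A q" "x' \<in> shift_gen A q"
      then show ?thesis using eq ne unfolding v_def by (intro shift_gen_unique) simp_all
    qed (use eq ne(1)[of x j] ne(2)[of x] ne(1)[of x' j'] ne(2)[of x'] in \<open>simp_all add: v_def\<close>)
  qed
  moreover have "v (b, j) = b" for j unfolding v_def by simp
  ultimately show ?thesis
    unfolding template_param_def T by auto
qed

end

section \<open>Recognising periodic paths and shallow stars\<close>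

text \<open>By \<open>pull\<close> an edge into a proper translate starts at a proper translate, so
  a generator is mapped to a generator or to \<open>b\<close> and the template is closed. Uniqueness
  of \<open>\<rho>\<close> makes \<open>b\<close> a leaf. The alternative \<open>kind\<close>
  separates the two outcomes: edges into the base keep their target under translation (star), or the
  target moves along (path).\<close>

lemma inward_piece:
  fixes A :: "nat set"
  assumes "shift_closed A q" and b: "b \<notin> A"
    and gA: "\<And>x. x \<in> A \<Longrightarrow> g x \<in> A \<or> g x = b"
    and reach: "\<And>x. x \<in> A \<Longrightarrow> \<exists>n. (g ^^ n) x = b"
    and equi: "\<And>x. x \<in> A \<Longrightarrow> g x \<in> A \<Longrightarrow> g (x + q) = g x + q"
    and pull: "\<And>x y. x \<in> A \<Longrightarrow> y \<in> A \<Longrightarrow> g x = y + q \<Longrightarrow> \<exists>x'\<in>A. x = x' + q"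
    and root: "\<rho> \<in> shift_gen A q" "g \<rho> = b" "\<And>x. x \<in> shift_gen A q \<Longrightarrow> g x = b \<Longrightarrow> x = \<rho>"
    and kind: "(\<forall>x\<in>A. g x = b \<longrightarrow> g (x + q) = b) \<or> b + q \<in> A \<and> (\<forall>x\<in>A. g x = b \<longrightarrow> g (x + q) = b + q)"
  shows "inward_periodic_path (insert b A) {(x, g x) | x. x \<in> A} b \<or>
         inward_shallow_star (insert b A) {(x, g x) | x. x \<in> A} b"
proof -
  interpret shift_closed A q by fact
  let ?D = "shift_gen A q"
  let ?T = "insert b ?D"
  let ?\<eta> = "{(x, g x) | x. x \<in> ?T - {b}}"
  have TD: "?T - {b} = ?D" using b shift_gen_subset by blast
  have gD: "g x \<in> ?T" if "x \<in> ?D" for x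
  proof (rule ccontr)
    assume "g x \<notin> ?T"
    moreover have "x \<in> A" using that shift_gen_subset by blast
    ultimately obtain y where "y \<in> A" "g x = y + q" using gA unfolding shift_gen_def by blast
    then show False using pull[OF \<open>x \<in> A\<close>] that unfolding shift_gen_def by blast
  qed
  have tree: "inward_rooted_tree ?T ?\<eta> b"
  proof (rule inward_rooted_treeI)
    show "\<exists>n. (g ^^ n) x = b" if "x \<in> ?T" for x
    proof (cases "x = b")
      case True
      then show ?thesis by (intro exI[of _ 0]) simp
    qed (use that reach shift_gen_subset in blast)
  qed (use gD finite_shift_gen in auto)
  have "{y. (b, y) \<in> ?\<eta> \<or> (y, b) \<in> ?\<eta>} = {\<rho>}"
    unfolding TD using root b shift_gen_subset by blast
  then have "leaf ?T ?\<eta> b" unfolding leaf_def by simp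
  moreover have orient: "oriented_towards ?T ?\<eta> b"
    using tree unfolding inward_rooted_tree_def oriented_towards_def by blast
  ultimately have templ: "template ?T ?\<eta> b t1" if "t1 \<in> ?T" for t1
    using tree that unfolding template_def inward_rooted_tree_def by blast
  have sub: "?\<eta> \<subseteq> ?T \<times> ?T" using gD by blast
  have iter: "g (d + j * q) = g d + j * q" if "d \<in> A" "g d \<in> A" for d j
  proof (induction j)
    case (Suc j)
    then show ?case
      using equi[of "d + j * q"] shift_mult[OF that(1)] shift_mult[OF that(2)] by (simp add: ac_simps)
  qed simp
  from kind show ?thesis
  proof (elim disjE conjE)
    assume star: "\<forall>x\<in>A. g x = b \<longrightarrow> g (x + q) = b"
    have iter_b: "g (d + j * q) = b" if "d \<in> A" "g d = b" for d j
    proof (induction j)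
      case (Suc j)
      then have "g (d + j * q + q) = b" using star shift_mult[OF that(1), of j] by blast
      then show ?case by (simp add: ac_simps)
    qed (simp add: that)
    let ?v = "\<lambda>(x, j). if x = b then b else x + j * q"
    have gv: "g (x + j * q) = ?v (g x, j)" if "x \<in> ?D" for x j
      using that iter iter_b gA[of x] shift_gen_subset b by auto
    have "{(x, g x) | x. x \<in> A} = {(?v (x, j), ?v (y, j)) | x y j. (x, y) \<in> ?\<eta>}"
    proof (intro equalityI subsetI)
      fix e assume "e \<in> {(x, g x) | x. x \<in> A}"
      then obtain x where x: "x \<in> A" "e = (x, g x)" by blast
      then obtain d j where d: "d \<in> ?D" "x = d + j * q" using shift_gen_decomp by blast
      then have "e = (?v (d, j), ?v (g d, j))" "(d, g d) \<in> ?\<eta>"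
        using x gv b shift_gen_subset by auto
      then show "e \<in> {(?v (x, j), ?v (y, j)) | x y j. (x, y) \<in> ?\<eta>}" by blast
    next
      fix e assume "e \<in> {(?v (x, j), ?v (y, j)) | x y j. (x, y) \<in> ?\<eta>}"
      then obtain x j where x: "x \<in> ?D" "x \<noteq> b" "e = (?v (x, j), ?v (g x, j))" by blast
      then have "e = (x + j * q, g (x + j * q))" "x + j * q \<in> A"
        using gv shift_mult shift_gen_subset by auto
      then show "e \<in> {(x, g x) | x. x \<in> A}" by blast
    qed
    then have "template_param ?v ?T ?\<eta> b b (insert b A) {(x, g x) | x. x \<in> A} b"
      using template_param_star[OF b, of ?\<eta>] by simp
    then have "graph_iso_pt (insert b A) {(x, g x) | x. x \<in> A} b (S_V ?T b b) (S_E ?\<eta> b b) (S_base b b)"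
      by (rule graph_iso_pt_if_template_param) (use sub in auto)
    then show ?thesis
      unfolding inward_shallow_star_def using templ orient by blast
  next
    assume bq: "b + q \<in> A" and path: "\<forall>x\<in>A. g x = b \<longrightarrow> g (x + q) = b + q"
    have iter_b: "g (d + j * q) = b + j * q" if "d \<in> A" "g d = b" for d j
    proof (cases j)
      case (Suc i)
      have "g (d + q + i * q) = g (d + q) + i * q"
        using iter[of "d + q" i] that path bq shift by simp
      then show ?thesis using Suc that path by (simp add: ac_simps)
    qed (simp add: that)
    have gv: "g (x + j * q) = g x + j * q" if "x \<in> ?D" for x j
    proof -
      have "x \<in> A" using that shift_gen_subset by blast
      then show ?thesis using iter[of x j] iter_b[of x j] gA[of x] by auto
    qed
    have "{(x, g x) | x. x \<in> A} = {(x + j * q, y + j * q) | x y j. (x, y) \<in> ?\<eta>}"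
    proof (intro equalityI subsetI)
      fix e assume "e \<in> {(x, g x) | x. x \<in> A}"
      then obtain x where x: "x \<in> A" "e = (x, g x)" by blast
      then obtain d j where d: "d \<in> ?D" "x = d + j * q" using shift_gen_decomp by blast
      then have "e = (d + j * q, g d + j * q)" "(d, g d) \<in> ?\<eta>"
        using x gv b shift_gen_subset by auto
      then show "e \<in> {(x + j * q, y + j * q) | x y j. (x, y) \<in> ?\<eta>}" by blast
    next
      fix e assume "e \<in> {(x + j * q, y + j * q) | x y j. (x, y) \<in> ?\<eta>}"
      then obtain x j where x: "x \<in> ?D" "e = (x + j * q, g x + j * q)" by blast
      then have "e = (x + j * q, g (x + j * q))" "x + j * q \<in> A"
        using gv shift_mult shift_gen_subset by auto
      then show "e \<in> {(x, g x) | x. x \<in> A}" by blast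
    qed
    then have "template_param (\<lambda>(x, j). x + j * q) ?T ?\<eta> b (b + q) (insert b A) {(x, g x) | x. x \<in> A} b"
      using template_param_shift(1)[OF b bq, of ?\<eta>] by simp
    moreover have bT: "b + q \<in> ?T" using template_param_shift(2)[OF b bq] by blast
    ultimately have "graph_iso_pt (insert b A) {(x, g x) | x. x \<in> A} b (S_V ?T b (b + q)) (S_E ?\<eta> b (b + q)) (S_base b (b + q))"
      by (intro graph_iso_pt_if_template_param) (use sub in auto)
    moreover have "b \<noteq> b + q" using q_pos by simp
    ultimately show ?thesis
      unfolding inward_periodic_path_def using templ[OF bT] orient by blast
  qed
qed

text \<open>The template gives \<open>b + q\<close> no out-edge, because that edge is the one of
  \<open>t0\<close> in the next copy. An orbit of the template that missed \<open>b + q\<close>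
  would stay among finitely many generators and become periodic; aperiodicity thus yields the
  orientation towards \<open>t1\<close>.\<close>

lemma outward_piece:
  fixes A :: "nat set"
  assumes "shift_closed A q" and b: "b \<notin> A" "b + q \<in> A"
    and gA: "\<And>x. x \<in> insert b A \<Longrightarrow> g x \<in> A"
    and aperiodic: "\<And>x n. x \<in> A \<Longrightarrow> 0 < n \<Longrightarrow> (g ^^ n) x \<noteq> x"
    and equi: "\<And>x. x \<in> insert b A \<Longrightarrow> g (x + q) = g x + q"
    and pull: "\<And>x y. x \<in> insert b A \<Longrightarrow> y \<in> A \<Longrightarrow> g x = y + q \<Longrightarrow> \<exists>x'\<in>insert b A. x = x' + q"
  shows "outward_periodic_path (insert b A) {(x, g x) | x. x \<in> insert b A} b"
proof -
  interpret shift_closed A q by fact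
  let ?D = "shift_gen A q"
  let ?T = "insert b ?D"
  let ?t = "b + q"
  let ?\<eta> = "{(x, g x) | x. x \<in> ?T - {?t}}"
  have tD: "?t \<in> ?D" by (rule template_param_shift(2)[OF b])
  have t_ne: "?t \<noteq> b" using q_pos by simp
  have gD: "g x \<in> ?D" if "x \<in> ?T" "x \<noteq> ?t" for x
  proof (rule ccontr)
    assume "g x \<notin> ?D"
    moreover have x: "x \<in> insert b A" using that shift_gen_subset by blast
    ultimately obtain y where "y \<in> A" "g x = y + q" using gA unfolding shift_gen_def by blast
    then obtain x' where "x' \<in> insert b A" "x = x' + q" using pull[OF x] by blast
    then show False using that b shift unfolding shift_gen_def by blast
  qed
  have tree: "inward_rooted_tree ?T ?\<eta> ?t"
  proof (rule inward_rooted_treeI)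
    show "\<exists>n. (g ^^ n) x = ?t" if x: "x \<in> ?T" for x
    proof (rule ccontr)
      assume no: "\<nexists>n. (g ^^ n) x = ?t"
      have D: "(g ^^ Suc n) x \<in> ?D" for n
      proof (induction n)
        case 0
        have "x \<noteq> ?t" using no by (metis funpow_0)
        then show ?case using gD x by simp
      next
        case (Suc n)
        moreover have "(g ^^ Suc n) x \<noteq> ?t" using no by blast
        ultimately show ?case using gD by simp
      qed
      have "\<not> inj (\<lambda>n. (g ^^ Suc n) x)"
        using D finite_shift_gen finite_subset[of "range (\<lambda>n. (g ^^ Suc n) x)" ?D]
        by (meson finite_imageD image_subsetI infinite_UNIV_nat)
      then obtain m n where "m < n" "(g ^^ Suc m) x = (g ^^ Suc n) x"
        unfolding inj_def by (metis linorder_neqE_nat)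
      moreover have "(g ^^ Suc n) x = (g ^^ (n - m)) ((g ^^ Suc m) x)" if "m < n"
        using that by (metis funpow_add comp_apply add_Suc_right le_add_diff_inverse2 less_imp_le_nat)
      ultimately show False
        using aperiodic[of "(g ^^ Suc m) x" "n - m"] D shift_gen_subset by auto
    qed
  qed (use gD finite_shift_gen tD in auto)
  have "{y. (b, y) \<in> ?\<eta> \<or> (y, b) \<in> ?\<eta>} = {g b}"
  proof -
    have "(y, b) \<notin> ?\<eta>" for y using gD b shift_gen_subset by blast
    moreover have "(b, y) \<in> ?\<eta> \<longleftrightarrow> y = g b" for y using t_ne by auto
    ultimately show ?thesis by blast
  qed
  then have "leaf ?T ?\<eta> b" unfolding leaf_def by simp
  then have templ: "template ?T ?\<eta> b ?t"
    using tree unfolding template_def inward_rooted_tree_def by blast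
  have orient: "oriented_towards ?T ?\<eta> ?t"
    using tree unfolding inward_rooted_tree_def oriented_towards_def by blast
  have sub: "?\<eta> \<subseteq> ?T \<times> ?T" using gD by blast
  have bj: "b + j * q \<in> insert b A" for j
  proof (cases j)
    case (Suc i)
    then show ?thesis using shift_mult[OF b(2), of i] by (simp add: ac_simps)
  qed simp
  have iter: "g (x + j * q) = g x + j * q" if "x \<in> insert b A" for x j
  proof (induction j)
    case (Suc j)
    have "x + j * q \<in> insert b A" using that shift_mult bj by blast
    then show ?case using equi[of "x + j * q"] Suc by (simp add: ac_simps)
  qed simp
  have "{(x, g x) | x. x \<in> insert b A} = {(x + j * q, y + j * q) | x y j. (x, y) \<in> ?\<eta>}"
  proof (intro equalityI subsetI)
    fix e assume "e \<in> {(x, g x) | x. x \<in> insert b A}"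
    then obtain x where x: "x \<in> insert b A" "e = (x, g x)" by blast
    have "\<exists>d j. d \<in> ?T \<and> d \<noteq> ?t \<and> x = d + j * q"
    proof (cases "x = b")
      case True
      then show ?thesis using t_ne by (intro exI[of _ b] exI[of _ 0]) auto
    next
      case False
      then obtain d j where d: "d \<in> ?D" "x = d + j * q" using x shift_gen_decomp by blast
      show ?thesis
      proof (cases "d = ?t")
        case True
        then show ?thesis using d t_ne by (intro exI[of _ b] exI[of _ "Suc j"]) auto
      qed (use d in blast)
    qed
    then obtain d j where d: "d \<in> ?T" "d \<noteq> ?t" "x = d + j * q" by blast
    then have "e = (d + j * q, g d + j * q)" "(d, g d) \<in> ?\<eta>"
      using x iter[of d j] shift_gen_subset by auto
    then show "e \<in> {(x + j * q, y + j * q) | x y j. (x, y) \<in> ?\<eta>}" by blast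
  next
    fix e assume "e \<in> {(x + j * q, y + j * q) | x y j. (x, y) \<in> ?\<eta>}"
    then obtain x j where x: "x \<in> ?T" "e = (x + j * q, g x + j * q)" by blast
    then have xA: "x \<in> insert b A" using shift_gen_subset by blast
    then have "x + j * q \<in> insert b A" using shift_mult bj by blast
    then show "e \<in> {(x, g x) | x. x \<in> insert b A}" using x(2) iter[OF xA, of j] by auto
  qed
  then have "template_param (\<lambda>(x, j). x + j * q) ?T ?\<eta> b ?t (insert b A) {(x, g x) | x. x \<in> insert b A} b"
    using template_param_shift(1)[OF b, of ?\<eta>] by simp
  then have "graph_iso_pt (insert b A) {(x, g x) | x. x \<in> insert b A} b (S_V ?T b ?t) (S_E ?\<eta> b ?t) (S_base b ?t)"
    by (rule graph_iso_pt_if_template_param) (use sub tD in auto)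
  then show ?thesis
    unfolding outward_periodic_path_def using templ orient t_ne
    by (intro exI[of _ ?T] exI[of _ ?\<eta>] exI[of _ b] exI[of _ ?t]) simp
qed

section \<open>Eventually equivariant maps\<close>

text \<open>\<open>M0\<close> separates the values that stay fixed under translation of the argument
  from those that move with it; \<open>conn\<close> is connectedness, since in a functional graph
  two vertices are connected iff their orbits meet.\<close>

locale equivariant_map =
  fixes V :: "nat set" and g :: "nat \<Rightarrow> nat" and p M0 M N :: nat
  assumes nonempty: "V \<noteq> {}"
    and g_in: "x \<in> V \<Longrightarrow> g x \<in> V"
    and conn: "x \<in> V \<Longrightarrow> y \<in> V \<Longrightarrow> \<exists>a b. (g ^^ a) x = (g ^^ b) y"
    and p_pos: "0 < p" and N_le: "N \<le> p" and M0_le: "M0 \<le> M"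
    and V_shift: "M0 \<le> x \<Longrightarrow> x + p \<in> V \<longleftrightarrow> x \<in> V"
    and const_step: "x \<in> V \<Longrightarrow> M \<le> x \<Longrightarrow> g x < M0 \<Longrightarrow> g (x + p) = g x"
    and local_step: "x \<in> V \<Longrightarrow> M \<le> x \<Longrightarrow> M0 \<le> g x \<Longrightarrow> g (x + p) = g x + p \<and> g x \<le> x + N \<and> x \<le> g x + N"
begin

lemma pow_in: "x \<in> V \<Longrightarrow> (g ^^ n) x \<in> V"
  by (induction n) (auto intro: g_in)

lemma pow_add: "(g ^^ (m + n)) x = (g ^^ m) ((g ^^ n) x)"
  by (simp add: funpow_add)

text \<open>Without periodic points an orbit is injective and finally stays above \<open>M\<close>,
  where it commutes with translation. The orbits of a late vertex \<open>z\<close> and of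
  \<open>z + p\<close> must meet, so the orbit of \<open>z\<close> contains two vertices at distance
  \<open>p\<close>.\<close>

lemma exists_ray:
  assumes aperiodic: "\<And>x n. x \<in> V \<Longrightarrow> 0 < n \<Longrightarrow> (g ^^ n) x \<noteq> x"
  shows "\<exists>y s. y \<in> V \<and> 0 < s \<and> (g ^^ s) y = y + p \<and> (\<forall>t. M \<le> (g ^^ t) y)"
proof -
  obtain x where x: "x \<in> V" using nonempty by blast
  have inj: "inj (\<lambda>t. (g ^^ t) x)"
  proof (rule linorder_injI)
    fix i j :: nat assume "i < j"
    then have "(g ^^ j) x = (g ^^ (j - i)) ((g ^^ i) x)" using pow_add[of "j - i" i x] by simp
    then show "(g ^^ i) x \<noteq> (g ^^ j) x"
      using aperiodic[OF pow_in[OF x], of "j - i" i] \<open>i < j\<close> by simp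
  qed
  have "finite ((\<lambda>t. (g ^^ t) x) -` {..<M})"
    by (rule finite_vimageI[OF _ inj]) simp
  then obtain t1 where "\<And>t. (g ^^ t) x < M \<Longrightarrow> t < t1"
    unfolding finite_nat_set_iff_bounded by auto
  then have ge: "M \<le> (g ^^ t) x" if "t1 \<le> t" for t using that by (meson linorder_not_less)
  define z where "z = (g ^^ t1) x"
  have z: "z \<in> V" unfolding z_def using x by (rule pow_in)
  have z_ge: "M \<le> (g ^^ t) z" for t
    unfolding z_def pow_add[symmetric] by (rule ge) simp
  have shift: "(g ^^ n) (w + p) = (g ^^ n) w + p" if "w = (g ^^ t) z" for w t n
  proof (induction n)
    case (Suc n)
    have w: "(g ^^ i) w = (g ^^ (i + t)) z" for i by (simp add: that pow_add)
    have "M0 \<le> g ((g ^^ n) w)" using z_ge[of "Suc n + t"] w[of "Suc n"] M0_le by simp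
    then have "g ((g ^^ n) w + p) = g ((g ^^ n) w) + p"
      using local_step[of "(g ^^ n) w"] w[of n] z_ge[of "n + t"] pow_in[OF z] by simp
    then show ?case using Suc by simp
  qed simp
  have "z + p \<in> V" using V_shift[of z] z z_ge[of 0] M0_le by simp
  then obtain a b where ab: "(g ^^ a) z = (g ^^ b) (z + p)" using conn[OF z] by blast
  then have ab: "(g ^^ a) z = (g ^^ b) z + p" using shift[of z 0 b] by simp
  \<comment> \<open>Otherwise the vertex \<open>p\<close> lower would come later on the orbit or
    coincide with its partner. Repeating the descent would subtract \<open>p\<close> more often than
    \<open>w\<close> allows.\<close>
  have "b < a"
  proof (rule ccontr)
    assume "\<not> b < a"
    define n where "n = b - a"
    define w where "w = (g ^^ a) z"
    have w: "w = (g ^^ n) w + p"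
      using ab \<open>\<not> b < a\<close> pow_add[of n a z] unfolding w_def n_def by simp
    have "w = (g ^^ (n * t)) w + t * p" for t
    proof (induction t)
      case (Suc t)
      have "(g ^^ (n * t)) w = (g ^^ (n * t)) ((g ^^ n) w + p)" using w by simp
      also have "\<dots> = (g ^^ (n * t)) ((g ^^ n) w) + p"
        by (rule shift[of _ "n + a"]) (simp add: w_def pow_add)
      also have "(g ^^ (n * t)) ((g ^^ n) w) = (g ^^ (n * Suc t)) w"
        by (simp add: pow_add[symmetric] add.commute)
      finally show ?case using Suc by simp
    qed simp
    from this[of "Suc w"] have "Suc w * p \<le> w" by linarith
    moreover have "Suc w * 1 \<le> Suc w * p" using p_pos by (intro mult_le_mono2) simp
    ultimately show False by simp
  qed
  define y where "y = (g ^^ b) z"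
  have "(g ^^ (a - b)) y = y + p"
    unfolding y_def pow_add[symmetric] using ab \<open>b < a\<close> by simp
  moreover have "M \<le> (g ^^ t) y" for t unfolding y_def pow_add[symmetric] by (rule z_ge)
  moreover have "y \<in> V" unfolding y_def using z by (rule pow_in)
  ultimately show ?thesis using \<open>b < a\<close> by (intro exI[of _ y] exI[of _ "a - b"]) simp
qed

end

text \<open>\<open>K_ge\<close> keeps \<open>x - p\<close> at or above \<open>M\<close> for all
  \<open>x \<ge> K\<close>. \<open>K_gt\<close> forces an orbit that crosses \<open>K\<close> from
  below to do so from a vertex at or above \<open>M\<close>, where the step is controlled.\<close>

locale equivariant_cut = equivariant_map +
  fixes K :: nat
  assumes K_ge: "M + p \<le> K" and K_gt: "z \<in> V \<Longrightarrow> z < M \<Longrightarrow> g z < K" and K_small: "\<exists>z\<in>V. z < K"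
begin

section \<open>Cutting off the orbits of the small vertices\<close>

definition F :: "nat set" where "F = {(g ^^ i) z | i z. z \<in> V \<and> z < K}"

definition W :: "nat set" where "W = V - F"

lemma F_in: "x \<in> F \<Longrightarrow> x \<in> V"
  unfolding F_def using pow_in by blast

lemma F_closed: "x \<in> F \<Longrightarrow> g x \<in> F"
proof -
  assume "x \<in> F"
  then obtain i z where z: "x = (g ^^ i) z" "z \<in> V" "z < K" unfolding F_def by blast
  then have "g x = (g ^^ Suc i) z" by simp
  then show "g x \<in> F" unfolding F_def using z by blast
qed

lemma F_pow: "x \<in> F \<Longrightarrow> (g ^^ n) x \<in> F"
  by (induction n) (auto intro: F_closed)

lemma small_F: "x \<in> V \<Longrightarrow> x < K \<Longrightarrow> x \<in> F"
  unfolding F_def using funpow_0[of g x] by (metis (mono_tags, lifting) mem_Collect_eq)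

lemma W_in: "x \<in> W \<Longrightarrow> x \<in> V" and W_F: "x \<in> V \<Longrightarrow> x \<notin> W \<longleftrightarrow> x \<in> F" and W_ge: "x \<in> W \<Longrightarrow> K \<le> x"
  unfolding W_def using small_F by (auto simp: not_less[symmetric])

lemma W_ge_M: "x \<in> W \<Longrightarrow> M \<le> x" and W_ge_M0: "x \<in> W \<Longrightarrow> M0 \<le> x" and W_ge_p: "x \<in> W \<Longrightarrow> M + p \<le> x"
  using W_ge K_ge M0_le by (meson add_leD1 order_trans)+

text \<open>Follows the orbit of \<open>z\<close>. A step that crosses \<open>K\<close> is local,
  rises by at most \<open>N \<le> p\<close>, and so lands less than \<open>p\<close> above
  \<open>K\<close>: its translate down is a small vertex. A step that starts above \<open>K\<close>
  is also taken by the vertex \<open>p\<close> lower, which is in \<open>F\<close> by induction; it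
  is not a constant step, since it leads to a value at least \<open>K\<close>.\<close>

lemma F_unshift:
  assumes "z \<in> V" "z < K" "K \<le> (g ^^ t) z"
  shows "(g ^^ t) z - p \<in> F"
  using assms(3)
proof (induction t)
  case (Suc t)
  let ?u = "(g ^^ t) z"
  have u: "?u \<in> V" using assms(1) by (rule pow_in)
  have gu: "K \<le> g ?u" using Suc by simp
  have gu_V: "g ?u - p \<in> V"
    using V_shift[of "g ?u - p"] gu K_ge M0_le g_in[OF u] by simp
  show ?case
  proof (cases "?u < K")
    case True
    then have "M \<le> ?u" using K_gt[OF u] gu by (meson linorder_not_less)
    then have "g ?u \<le> ?u + N" using local_step[OF u] gu K_ge M0_le by simp
    then have "g ?u - p < K" using True N_le gu K_ge p_pos by linarith
    then show ?thesis using small_F[OF gu_V] by simp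
  next
    case False
    then have F: "?u - p \<in> F" using Suc by simp
    have "M \<le> ?u - p" "?u - p + p = ?u" using False K_ge by auto
    then have "g ?u = g (?u - p) + p"
      using local_step[OF F_in[OF F]] const_step[OF F_in[OF F]] gu K_ge M0_le p_pos
      by (cases "M0 \<le> g (?u - p)") auto
    then show ?thesis using F_closed[OF F] by simp
  qed
qed (use assms(2) in simp)

lemma W_shift: "x \<in> W \<Longrightarrow> x + p \<in> W"
proof -
  assume x: "x \<in> W"
  then have "x + p \<in> V" using V_shift W_ge_M0 W_in by blast
  moreover have "x + p \<notin> F"
  proof
    assume "x + p \<in> F"
    then obtain i z where z: "x + p = (g ^^ i) z" "z \<in> V" "z < K" unfolding F_def by blast
    then have "(g ^^ i) z - p \<in> F" using W_ge[OF x] by (intro F_unshift) linarith+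
    then have "x \<in> F" by (simp flip: z(1))
    then show False using x unfolding W_def by blast
  qed
  ultimately show "x + p \<in> W" unfolding W_def by blast
qed

sublocale W: shift_closed W p
  by unfold_locales (auto intro: p_pos W_shift)

lemma W_pre: "x \<in> V \<Longrightarrow> g x \<in> W \<Longrightarrow> x \<in> W"
  unfolding W_def using F_closed by blast

lemma W_pow_pre: "x \<in> V \<Longrightarrow> (g ^^ n) x \<in> W \<Longrightarrow> x \<in> W"
  unfolding W_def using F_pow by blast

lemma W_pow_le: "x \<in> V \<Longrightarrow> (g ^^ n) x \<in> W \<Longrightarrow> m \<le> n \<Longrightarrow> (g ^^ m) x \<in> W"
  using W_pow_pre[of "(g ^^ m) x" "n - m"] pow_in[of x m] by (simp flip: pow_add)

lemma W_exit: "x \<in> W \<Longrightarrow> \<exists>n. (g ^^ n) x \<notin> W"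
proof -
  assume x: "x \<in> W"
  obtain z where z: "z \<in> V" "z < K" using K_small by blast
  then obtain a b where "(g ^^ a) x = (g ^^ b) z" using conn W_in[OF x] by blast
  then have "(g ^^ a) x \<in> F" using F_pow small_F z by simp
  then show ?thesis unfolding W_def by blast
qed

lemma const_F: "x \<in> W \<Longrightarrow> g x < M0 \<Longrightarrow> g x \<in> F"
  using W_ge_M0[of "g x"] W_F g_in W_in by (meson linorder_not_less)

lemma W_const: "x \<in> W \<Longrightarrow> g x < M0 \<Longrightarrow> g (x + p) = g x"
  using const_step W_in W_ge_M by blast

lemma W_local: "x \<in> W \<Longrightarrow> M0 \<le> g x \<Longrightarrow> g (x + p) = g x + p \<and> g x \<le> x + N \<and> x \<le> g x + N"
  using local_step W_in W_ge_M by blast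

lemma W_local_mult: "x \<in> W \<Longrightarrow> M0 \<le> g x \<Longrightarrow> g (x + k * p) = g x + k * p"
proof (induction k)
  case (Suc k)
  then show ?case using W_local[of "x + k * p"] W.shift_mult[of x k] by (simp add: ac_simps)
qed simp

text \<open>\<open>x - p\<close> may lie in \<open>F\<close>, yet it is at least \<open>M\<close>.
  If its step were constant, \<open>g x\<close> would be the same value below
  \<open>M0\<close>.\<close>

lemma W_unshift:
  assumes "x \<in> W"
  shows "x - p \<in> V" "x = (x - p) + p" "M0 \<le> g x \<Longrightarrow> g x = g (x - p) + p"
proof -
  have x: "M \<le> x - p" "x = (x - p) + p" using W_ge_p[OF assms] by auto
  then show "x = (x - p) + p" by simp
  show V: "x - p \<in> V" using V_shift[of "x - p"] x M0_le W_in[OF assms] by simp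
  show "g x = g (x - p) + p" if "M0 \<le> g x"
  proof (cases "M0 \<le> g (x - p)")
    case True
    then show ?thesis using local_step[OF V x(1)] x(2) by simp
  next
    case False
    then show ?thesis using const_step[OF V x(1)] x(2) that by simp
  qed
qed

text \<open>Peels off one period at a time. Each vertex on the way down has its image in
  \<open>W\<close>, hence lies in \<open>W\<close> itself, and \<open>W_unshift\<close> applies
  again.\<close>

lemma W_pull:
  assumes "x \<in> V" "y \<in> W" "g x = y + k * p"
  shows "\<exists>x'\<in>W. x = x' + k * p \<and> g x' = y"
  using assms
proof (induction k arbitrary: x)
  case 0
  then show ?case using W_pre by auto
next
  case (Suc k)
  have x: "x \<in> W" using Suc W_pre[of x] W.shift_mult[of y "Suc k"] by simp
  have "M0 \<le> g x" using Suc W_ge_M0[of y] by simp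
  then have "g (x - p) = y + k * p" using W_unshift(3)[OF x] Suc(4) by simp
  then obtain x' where "x' \<in> W" "x - p = x' + k * p" "g x' = y"
    using Suc W_unshift(1)[OF x] by blast
  then show ?case using W_unshift(2)[OF x] by (intro bexI[of _ x']) auto
qed

lemma W_pow_shift: "x \<in> V \<Longrightarrow> (g ^^ n) x \<in> W \<Longrightarrow> (g ^^ n) (x + k * p) = (g ^^ n) x + k * p"
proof (induction n)
  case (Suc n)
  have "(g ^^ n) x \<in> W" using Suc W_pow_le[of x "Suc n" n] by simp
  moreover have "M0 \<le> g ((g ^^ n) x)" using Suc W_ge_M0 by simp
  ultimately show ?case using Suc W_local_mult by simp
qed simp

section \<open>Last vertices in \<open>W\<close> and the trees above them\<close>

definition root :: "nat \<Rightarrow> bool" where "root r \<longleftrightarrow> r \<in> W \<and> g r \<notin> W"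

definition tree :: "nat \<Rightarrow> nat set" where "tree r = {x \<in> V. \<exists>n. (g ^^ n) x = r}"

lemma root_F: "root r \<Longrightarrow> g r \<in> F"
  unfolding root_def using W_F g_in W_in by blast

lemma root_W: "root r \<Longrightarrow> r \<in> W"
  unfolding root_def by blast

lemma root_exists: "x \<in> W \<Longrightarrow> \<exists>n. root ((g ^^ n) x)"
proof -
  assume x: "x \<in> W"
  define n where "n = (LEAST n. (g ^^ n) x \<notin> W)"
  have n: "(g ^^ n) x \<notin> W" unfolding n_def using W_exit[OF x] by (rule LeastI_ex)
  have "n \<noteq> 0" using n x by (cases n) auto
  then obtain m where m: "n = Suc m" by (cases n) auto
  then have "(g ^^ m) x \<in> W" unfolding n_def using not_less_Least[of m "\<lambda>n. (g ^^ n) x \<notin> W"] by auto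
  then show ?thesis using n m unfolding root_def by (intro exI[of _ m]) simp
qed

lemma root_tree: "x \<in> W \<Longrightarrow> \<exists>r. root r \<and> x \<in> tree r"
  using root_exists W_in unfolding tree_def by blast

lemma tree_W: "r \<in> W \<Longrightarrow> tree r \<subseteq> W"
  unfolding tree_def using W_pow_pre by blast

lemma tree_self: "r \<in> V \<Longrightarrow> r \<in> tree r"
  unfolding tree_def by (auto intro: exI[of _ 0])

lemma tree_pre: "x \<in> V \<Longrightarrow> g x \<in> tree r \<Longrightarrow> x \<in> tree r"
proof -
  assume x: "x \<in> V" "g x \<in> tree r"
  then obtain n where "(g ^^ n) (g x) = r" unfolding tree_def by blast
  then have "(g ^^ Suc n) x = r" by (simp add: funpow_swap1)
  then show "x \<in> tree r" using x unfolding tree_def by blast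
qed

lemma tree_step: "x \<in> tree r \<Longrightarrow> x \<noteq> r \<Longrightarrow> g x \<in> tree r"
proof -
  assume x: "x \<in> tree r" "x \<noteq> r"
  then obtain n where n: "x \<in> V" "(g ^^ n) x = r" unfolding tree_def by blast
  then obtain m where "n = Suc m" using x by (cases n) auto
  then have "(g ^^ m) (g x) = r" using n by (simp add: funpow_swap1)
  then show "g x \<in> tree r" using n g_in unfolding tree_def by blast
qed

text \<open>An orbit that has left \<open>W\<close> stays in \<open>F\<close>, so it passes through
  only one root.\<close>

lemma tree_unique: "root r \<Longrightarrow> root r' \<Longrightarrow> x \<in> tree r \<Longrightarrow> x \<in> tree r' \<Longrightarrow> r = r'"
proof -
  have *: "r = r'" if r: "root r" "root r'" "x \<in> V" "(g ^^ n) x = r" "(g ^^ m) x = r'" "n \<le> m" for r r' n m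
  proof (rule ccontr)
    assume "r \<noteq> r'"
    then have "n < m" using r by (cases "n = m") auto
    moreover have "(g ^^ m) x \<in> W" using r root_W by simp
    ultimately have "(g ^^ Suc n) x \<in> W" using W_pow_le[OF r(3), of m "Suc n"] by simp
    then show False using r unfolding root_def by simp
  qed
  assume r: "root r" "root r'" "x \<in> tree r" "x \<in> tree r'"
  then obtain n m where nm: "x \<in> V" "(g ^^ n) x = r" "(g ^^ m) x = r'" unfolding tree_def by blast
  show "r = r'"
  proof (cases "n \<le> m")
    case True
    then show ?thesis using * [OF r(1,2) nm] by blast
  next
    case False
    then show ?thesis using * [OF r(2,1) nm(1,3,2)] by simp
  qed
qed

lemma tree_root: "root r \<Longrightarrow> x \<in> tree r \<Longrightarrow> g x \<notin> W \<Longrightarrow> x = r"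
  using tree_unique[of r x x] tree_W[of r] tree_self[of x] W_in root_W unfolding root_def by blast

lemma tree_shift: "r \<in> W \<Longrightarrow> x \<in> tree r \<Longrightarrow> x + k * p \<in> tree (r + k * p)"
proof -
  assume r: "r \<in> W" "x \<in> tree r"
  then obtain n where n: "x \<in> V" "(g ^^ n) x = r" unfolding tree_def by blast
  then have "(g ^^ n) (x + k * p) = r + k * p" using W_pow_shift r by simp
  moreover have "x + k * p \<in> V" using W.shift_mult W_in tree_W r by blast
  ultimately show "x + k * p \<in> tree (r + k * p)" unfolding tree_def by blast
qed

section \<open>Star roots, path roots and their pieces\<close>

definition const_roots :: "nat set" where "const_roots = {x \<in> W. g x < M0}"

sublocale C: shift_closed const_roots p
  unfolding const_roots_def by unfold_locales (auto intro: p_pos W_shift simp: W_const)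

lemma const_roots_const: "d \<in> const_roots \<Longrightarrow> g (d + j * p) = g d"
proof (induction j)
  case (Suc j)
  then have "d + j * p \<in> const_roots" by (intro C.shift_mult)
  then have "g (d + j * p + p) = g d" using W_const Suc unfolding const_roots_def by auto
  then show ?case by (simp add: ac_simps)
qed simp

lemma const_roots_root: "d \<in> const_roots \<Longrightarrow> root d"
  unfolding const_roots_def root_def using const_F W_F F_in by blast

text \<open>In the residue class of a spine vertex an inward ray descends through infinitely many
  translates of that vertex.\<close>

definition spine :: "nat \<Rightarrow> bool" where "spine y \<longleftrightarrow> (\<exists>k>0. \<exists>n. (g ^^ n) (y + k * p) = y)"

definition path_roots :: "nat set" where "path_roots = {r. root r \<and> M0 \<le> g r \<and> spine r}"

definition star_roots :: "nat set" where "star_roots = shift_gen const_roots p"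

text \<open>All translates of a constant root have the same image, so their trees together form one
  star. The tree of a path root is a piece by itself.\<close>

definition piece :: "nat \<Rightarrow> nat set" where
  "piece i = (if g i < M0 then (\<Union>j. tree (i + j * p)) else tree i)"

lemma star_roots_const: "i \<in> star_roots \<Longrightarrow> i \<in> const_roots"
  unfolding star_roots_def using C.shift_gen_subset by blast

lemma piece_star: "i \<in> star_roots \<Longrightarrow> piece i = (\<Union>j. tree (i + j * p))"
  using star_roots_const unfolding piece_def const_roots_def by auto

lemma piece_path: "i \<in> path_roots \<Longrightarrow> piece i = tree i"
  unfolding piece_def path_roots_def by auto

text \<open>Shows that the base translated by \<open>k * p\<close> lies in the piece, which is the
  condition under which \<open>inward_piece\<close> yields a path.\<close>

lemma spine_root_step:
  assumes "root r" "M0 \<le> g r" "0 < k" "(g ^^ n) (r + k * p) = r"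
  shows "g (r + k * p) \<in> tree r" "g r + k * p \<in> tree r" "g (r + k * p) = g r + k * p"
proof -
  have "r + k * p \<in> V" using W.shift_mult W_in root_W[OF assms(1)] by blast
  then have "r + k * p \<in> tree r" using assms(4) unfolding tree_def by blast
  then show t: "g (r + k * p) \<in> tree r" using assms(3) p_pos by (intro tree_step) auto
  show e: "g (r + k * p) = g r + k * p" using W_local_mult[OF root_W[OF assms(1)] assms(2)] .
  show "g r + k * p \<in> tree r" using t e by simp
qed

text \<open>If \<open>a0\<close> is a spine root, the image of \<open>a0 + k * p\<close> is still in
  \<open>tree a0\<close>, hence in \<open>W\<close>. Higher translates then also have their images
  in \<open>W\<close>, so no larger number of this residue class is a root from there on. An
  infinite set of path roots would contain such numbers by the pigeonhole principle.\<close>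

lemma finite_path_roots: "finite path_roots"
proof (rule ccontr)
  assume inf: "infinite path_roots"
  have "finite ((\<lambda>x. x mod p) ` path_roots)"
    by (rule finite_subset[of _ "{..<p}"]) (use p_pos in auto)
  then obtain a0 where a0: "a0 \<in> path_roots" and inf: "infinite {a \<in> path_roots. a mod p = a0 mod p}"
    using pigeonhole_infinite[OF inf] by blast
  obtain k n where k: "root a0" "M0 \<le> g a0" "0 < k" "(g ^^ n) (a0 + k * p) = a0"
    using a0 unfolding path_roots_def spine_def by blast
  obtain a where a: "a \<in> path_roots" "a mod p = a0 mod p" "a0 + k * p \<le> a"
    using inf unfolding finite_nat_set_iff_bounded by (auto simp: not_less)
  then have "p dvd a - (a0 + k * p)"
    by (intro mod_eq_dvd_iff_nat[THEN iffD1]) auto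
  then obtain j where j: "a - (a0 + k * p) = p * j" by blast
  then have a_eq: "a = (a0 + k * p) + j * p" using a(3) by (simp add: mult.commute)
  have "g (a0 + k * p) \<in> W" using spine_root_step(1)[OF k] tree_W root_W k(1) by blast
  moreover have "g a = g (a0 + k * p) + j * p"
    unfolding a_eq
  proof (rule W_local_mult)
    show "a0 + k * p \<in> W" using W.shift_mult root_W[OF k(1)] by blast
    show "M0 \<le> g (a0 + k * p)" using calculation by (rule W_ge_M0)
  qed
  ultimately have "g a \<in> W" using W.shift_mult by simp
  then show False using a(1) unfolding path_roots_def root_def by blast
qed

lemma finite_piece_roots: "finite (star_roots \<union> path_roots)"
  unfolding star_roots_def using C.finite_shift_gen finite_path_roots by blast

text \<open>Lets the facts about pieces treat stars and paths uniformly.\<close>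

lemma piece_root:
  assumes "i \<in> star_roots \<union> path_roots" "x \<in> piece i"
  shows "\<exists>j. root (i + j * p) \<and> x \<in> tree (i + j * p) \<and> g (i + j * p) = g i \<and> (i \<in> path_roots \<longrightarrow> j = 0)"
proof (cases "i \<in> star_roots")
  case True
  then obtain j where "x \<in> tree (i + j * p)" using assms(2) piece_star by auto
  moreover have i: "i \<in> const_roots" using True by (rule star_roots_const)
  moreover have "root (i + j * p)" using i by (intro const_roots_root C.shift_mult)
  moreover have "i \<notin> path_roots" using i unfolding const_roots_def path_roots_def by auto
  ultimately show ?thesis using const_roots_const by blast
next
  case False
  then have "i \<in> path_roots" using assms(1) by blast
  then show ?thesis using assms(2) piece_path unfolding path_roots_def by (intro exI[of _ 0]) auto
qed

lemma piece_W: "i \<in> star_roots \<union> path_roots \<Longrightarrow> piece i \<subseteq> W"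
  using piece_root tree_W root_W by blast

lemma piece_base: "i \<in> star_roots \<union> path_roots \<Longrightarrow> g i \<in> F"
  using star_roots_const const_roots_root root_F unfolding path_roots_def by blast

lemma piece_pre: "x \<in> V \<Longrightarrow> g x \<in> piece i \<Longrightarrow> x \<in> piece i"
  unfolding piece_def using tree_pre by (auto split: if_splits)

text \<open>A common vertex forces a common root and hence \<open>g i = g i'\<close>. Comparing this
  value with \<open>M0\<close> shows that both pieces are of the same kind.\<close>

lemma piece_disjoint:
  assumes "i \<in> star_roots \<union> path_roots" "i' \<in> star_roots \<union> path_roots" "x \<in> piece i" "x \<in> piece i'"
  shows "i = i'"
proof -
  obtain j where j: "root (i + j * p)" "x \<in> tree (i + j * p)" "g (i + j * p) = g i" "i \<in> path_roots \<longrightarrow> j = 0"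
    using piece_root[OF assms(1,3)] by blast
  obtain j' where j': "root (i' + j' * p)" "x \<in> tree (i' + j' * p)" "g (i' + j' * p) = g i'" "i' \<in> path_roots \<longrightarrow> j' = 0"
    using piece_root[OF assms(2,4)] by blast
  have eq: "i + j * p = i' + j' * p" using tree_unique j(1,2) j'(1,2) by blast
  then have "g i = g i'" using j(3) j'(3) by simp
  then consider "i \<in> star_roots" "i' \<in> star_roots" | "i \<in> path_roots" "i' \<in> path_roots"
    using assms(1,2) star_roots_const unfolding path_roots_def const_roots_def by fastforce
  then show ?thesis
  proof cases
    case 1
    then show ?thesis using C.shift_gen_unique eq unfolding star_roots_def by blast
  next
    case 2
    then show ?thesis using j(4) j'(4) eq by simp
  qed
qed

lemma piece_step: "i \<in> star_roots \<union> path_roots \<Longrightarrow> x \<in> piece i \<Longrightarrow> g x \<in> piece i \<or> g x = g i"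
proof -
  assume i: "i \<in> star_roots \<union> path_roots" "x \<in> piece i"
  obtain j where j: "root (i + j * p)" "x \<in> tree (i + j * p)" "g (i + j * p) = g i"
    using piece_root[OF i] by blast
  show ?thesis
  proof (cases "x = i + j * p")
    case False
    then have "g x \<in> tree (i + j * p)" using j(2) tree_step by blast
    then have "g x \<in> W" using tree_W j(1) root_W by blast
    show ?thesis
    proof (rule disjI1, cases "i \<in> star_roots")
      case True
      then show "g x \<in> piece i" using piece_star \<open>g x \<in> tree (i + j * p)\<close> by blast
    next
      case nstar: False
      then have "i \<in> path_roots" using i by blast
      then have "piece i = tree i" "x \<in> tree i" using piece_path i by auto
      moreover have "root i" using \<open>i \<in> path_roots\<close> unfolding path_roots_def by blast
      ultimately show "g x \<in> piece i"
        using tree_step[of x i] root_def \<open>g x \<in> W\<close> by auto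
    qed
  qed (use j in simp)
qed

lemma piece_reach: "i \<in> star_roots \<union> path_roots \<Longrightarrow> x \<in> piece i \<Longrightarrow> \<exists>n. (g ^^ n) x = g i"
proof -
  assume i: "i \<in> star_roots \<union> path_roots" "x \<in> piece i"
  obtain j where j: "x \<in> tree (i + j * p)" "g (i + j * p) = g i"
    using piece_root[OF i] by blast
  then obtain n where "(g ^^ n) x = i + j * p" unfolding tree_def by blast
  then have "(g ^^ Suc n) x = g i" using j by simp
  then show ?thesis by blast
qed

text \<open>Stars are handled with period \<open>p\<close>. A path gets the period
  \<open>k * p\<close> provided by \<open>spine\<close>, since translating by \<open>p\<close> alone
  may lead into another tree.\<close>

lemma piece_inward:
  assumes i: "i \<in> star_roots \<union> path_roots"
  shows "inward_periodic_path (insert (g i) (piece i)) {(x, g x) | x. x \<in> piece i} (g i) \<or>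
         inward_shallow_star (insert (g i) (piece i)) {(x, g x) | x. x \<in> piece i} (g i)"
proof -
  have sub: "piece i \<subseteq> W" using i by (rule piece_W)
  have base: "g i \<notin> W" using piece_base[OF i] unfolding W_def by blast
  show ?thesis
  proof (cases "i \<in> star_roots")
    case True
    have ic: "i \<in> const_roots" using True by (rule star_roots_const)
    have A: "piece i = (\<Union>j. tree (i + j * p))" using True by (rule piece_star)
    have rootj: "root (i + j * p)" for j using ic by (intro const_roots_root C.shift_mult)
    have shift: "shift_closed (piece i) p"
    proof
      fix x assume "x \<in> piece i"
      then obtain j where "x \<in> tree (i + j * p)" unfolding A by blast
      then have "x + 1 * p \<in> tree (i + j * p + 1 * p)" by (intro tree_shift root_W rootj)
      then have "x + p \<in> tree (i + Suc j * p)" by (simp add: ac_simps)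
      then show "x + p \<in> piece i" unfolding A by blast
    qed (rule p_pos)
    show ?thesis
    proof (rule inward_piece[OF shift, of "g i" g i])
      show "g i \<notin> piece i" using sub base by blast
      show "g x \<in> piece i \<or> g x = g i" if "x \<in> piece i" for x using i that by (rule piece_step)
      show "\<exists>n. (g ^^ n) x = g i" if "x \<in> piece i" for x using i that by (rule piece_reach)
      show "g (x + p) = g x + p" if "x \<in> piece i" "g x \<in> piece i" for x
        using W_local[of x] W_ge_M0[of "g x"] that sub by blast
      show "\<exists>x'\<in>piece i. x = x' + p" if xy: "x \<in> piece i" "y \<in> piece i" "g x = y + p" for x y
      proof -
        have "\<exists>x'\<in>W. x = x' + 1 * p \<and> g x' = y"
          using xy sub W_in by (intro W_pull) auto
        then obtain x' where "x' \<in> W" "x = x' + p" "g x' = y" by auto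
        then show ?thesis using piece_pre W_in xy by blast
      qed
      show "i \<in> shift_gen (piece i) p"
      proof -
        have "i \<in> piece i" unfolding A using tree_self[OF W_in[OF root_W[OF rootj[of 0]]]] by (auto intro: exI[of _ 0])
        moreover have "i \<noteq> y + p" if "y \<in> piece i" for y
        proof
          assume eq: "i = y + p"
          have y: "y \<in> W" using that sub by blast
          \<comment> \<open>If the step at \<open>y\<close> were local, translating it by
            \<open>p\<close> would give \<open>g i\<close> a value above \<open>M0\<close>, against
            the constancy at \<open>i\<close>.\<close>
          have "g y < M0"
          proof (rule ccontr)
            assume "\<not> g y < M0"
            then have "g i = g y + p" using W_local[OF y] eq by simp
            then show False using ic \<open>\<not> g y < M0\<close> unfolding const_roots_def by simp
          qed
          then have "y \<in> const_roots" using y unfolding const_roots_def by simp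
          then show False using True eq unfolding star_roots_def shift_gen_def by blast
        qed
        ultimately show ?thesis unfolding shift_gen_def by blast
      qed
      show "x = i" if x: "x \<in> shift_gen (piece i) p" "g x = g i" for x
      proof -
        have "x \<in> piece i" using x(1) unfolding shift_gen_def by blast
        then obtain j where "x \<in> tree (i + j * p)" unfolding A by blast
        then have xj: "x = i + j * p" using tree_root[OF rootj] x(2) base by metis
        have "j = 0"
        proof (cases j)
          case (Suc k)
          have "i + k * p \<in> piece i"
            unfolding A using tree_self[OF W_in[OF root_W[OF rootj]]] by blast
          moreover have "x = (i + k * p) + p" using xj Suc by simp
          ultimately show ?thesis using x(1) unfolding shift_gen_def by blast
        qed
        then show ?thesis using xj by simp
      qed
      have "g (x + p) = g i" if "x \<in> piece i" "g x = g i" for x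
        using W_const[of x] that sub ic unfolding const_roots_def by auto
      then show "(\<forall>x\<in>piece i. g x = g i \<longrightarrow> g (x + p) = g i) \<or>
        g i + p \<in> piece i \<and> (\<forall>x\<in>piece i. g x = g i \<longrightarrow> g (x + p) = g i + p)" by blast
    qed simp
  next
    case False
    then have ip: "i \<in> path_roots" using i by blast
    then obtain k n where k: "root i" "M0 \<le> g i" "0 < k" "(g ^^ n) (i + k * p) = i"
      unfolding path_roots_def spine_def by blast
    have A: "piece i = tree i" using ip by (rule piece_path)
    have iW: "i \<in> W" using k(1) by (rule root_W)
    have shift: "shift_closed (piece i) (k * p)"
    proof
      fix x assume "x \<in> piece i"
      then have "x + k * p \<in> tree (i + k * p)" unfolding A using iW by (intro tree_shift)
      then obtain m where m: "x + k * p \<in> V" "(g ^^ m) (x + k * p) = i + k * p" unfolding tree_def by blast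
      then have "(g ^^ (n + m)) (x + k * p) = i" using k(4) by (simp add: pow_add)
      then show "x + k * p \<in> piece i" using m(1) unfolding A tree_def by blast
    qed (use p_pos k(3) in simp)
    have only: "x = i" if "x \<in> piece i" "g x = g i" for x
      using tree_root[OF k(1), of x] that base unfolding A by simp
    show ?thesis
    proof (rule inward_piece[OF shift, of "g i" g i])
      show "g i \<notin> piece i" using sub base by blast
      show "g x \<in> piece i \<or> g x = g i" if "x \<in> piece i" for x using i that by (rule piece_step)
      show "\<exists>n. (g ^^ n) x = g i" if "x \<in> piece i" for x using i that by (rule piece_reach)
      show "g (x + k * p) = g x + k * p" if "x \<in> piece i" "g x \<in> piece i" for x
        using W_local_mult[of x k] W_ge_M0[of "g x"] that sub by blast
      show "\<exists>x'\<in>piece i. x = x' + k * p" if xy: "x \<in> piece i" "y \<in> piece i" "g x = y + k * p" for x y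
      proof -
        have "\<exists>x'\<in>W. x = x' + k * p \<and> g x' = y"
          using xy sub W_in by (intro W_pull) auto
        then show ?thesis using piece_pre W_in xy by blast
      qed
      \<comment> \<open>If \<open>i = y + k * p\<close> with \<open>y\<close> above \<open>i\<close>
        in the tree, the path from \<open>y\<close> to \<open>i\<close>, translated by
        \<open>k * p\<close>, leads from \<open>i\<close> to \<open>i + k * p\<close> inside
        \<open>W\<close>. But a root leaves \<open>W\<close> at once.\<close>
      show "i \<in> shift_gen (piece i) (k * p)"
      proof -
        have "i \<in> piece i" unfolding A using iW W_in tree_self by blast
        moreover have "i \<noteq> y + k * p" if "y \<in> piece i" for y
        proof
          assume eq: "i = y + k * p"
          obtain m where m: "y \<in> V" "(g ^^ m) y = i" using \<open>y \<in> piece i\<close> unfolding A tree_def by blast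
          then have m': "(g ^^ m) i = i + k * p" using W_pow_shift[of y m k] iW eq by simp
          have "m \<noteq> 0" using m' k(3) p_pos by (cases m) auto
          moreover have "(g ^^ m) i \<in> W" using m' W.shift_mult[OF iW, of k] by simp
          ultimately have "(g ^^ Suc 0) i \<in> W" using W_pow_le[OF W_in[OF iW], of m "Suc 0"] by simp
          then show False using base by simp
        qed
        ultimately show ?thesis unfolding shift_gen_def by blast
      qed
      show "x = i" if "x \<in> shift_gen (piece i) (k * p)" "g x = g i" for x
        using only[of x] that unfolding shift_gen_def by blast
      show "(\<forall>x\<in>piece i. g x = g i \<longrightarrow> g (x + k * p) = g i) \<or>
        g i + k * p \<in> piece i \<and> (\<forall>x\<in>piece i. g x = g i \<longrightarrow> g (x + k * p) = g i + k * p)"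
        using spine_root_step(2,3)[OF k] only unfolding A by blast
    qed simp
  qed
qed

section \<open>Splitting off the pieces\<close>

definition good :: "nat set" where "good = (\<Union>i\<in>star_roots \<union> path_roots. piece i)"

lemma good_W: "good \<subseteq> W"
  unfolding good_def using piece_W by blast

lemma good_pre: "x \<in> V \<Longrightarrow> g x \<in> good \<Longrightarrow> x \<in> good"
  unfolding good_def using piece_pre by blast

text \<open>\<open>Dm\<close> is the set of vertices with an out-edge: all of \<open>V\<close>, or
  \<open>V\<close> without the sink that was turned into a fixed point.\<close>

lemma attach_paths_stars_good:
  assumes dom: "W \<subseteq> Dm" "Dm \<subseteq> V"
  shows "attach_paths_stars V {(x, g x) | x. x \<in> Dm} (V - good) {(x, g x) | x. x \<in> Dm - good}"
proof -
  let ?I = "star_roots \<union> path_roots"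
  obtain e where e: "bij_betw e {0..<card ?I} ?I"
    using ex_bij_betw_nat_finite[OF finite_piece_roots] by blast
  have eI: "e k \<in> ?I" if "k < card ?I" for k using e that unfolding bij_betw_def by auto
  have e_surj: "\<exists>k<card ?I. i = e k" if "i \<in> ?I" for i
  proof -
    have "i \<in> e ` {0..<card ?I}" using e that by (simp add: bij_betw_def)
    then show ?thesis by auto
  qed
  have e_inj: "e k \<noteq> e l" if "k < card ?I" "l < card ?I" "k \<noteq> l" for k l
    using e that unfolding bij_betw_def inj_on_def by auto
  have base: "g (e k) \<in> V - good" if "k < card ?I" for k
    using piece_base[OF eI[OF that]] F_in good_W unfolding W_def by blast
  have good_eq: "good = (\<Union>k<card ?I. piece (e k))"
    unfolding good_def using eI e_surj by blast
  have "attached V {(x, g x) | x. x \<in> Dm} (V - good) {(x, g x) | x. x \<in> Dm - good} (card ?I)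
    (\<lambda>k. insert (g (e k)) (piece (e k))) (\<lambda>k. {(x, g x) | x. x \<in> piece (e k)}) (\<lambda>k. g (e k))"
    unfolding attached_def
  proof (intro conjI allI impI)
    show "{(x, g x) | x. x \<in> Dm - good} \<subseteq> (V - good) \<times> (V - good)"
      using dom g_in good_pre by blast
    fix k assume k: "k < card ?I"
    show "{(x, g x) | x. x \<in> piece (e k)} \<subseteq> insert (g (e k)) (piece (e k)) \<times> insert (g (e k)) (piece (e k))"
      using piece_step[OF eI[OF k]] by blast
    show "g (e k) \<in> V - good" using k by (rule base)
    show "(V - good) \<inter> insert (g (e k)) (piece (e k)) = {g (e k)}"
      using base[OF k] good_eq k by blast
    fix l assume l: "l < card ?I" "k \<noteq> l"
    have "piece (e k) \<inter> piece (e l) = {}"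
      using piece_disjoint[OF eI[OF k] eI[OF l(1)]] e_inj[OF k l] by blast
    then show "insert (g (e k)) (piece (e k)) \<inter> insert (g (e l)) (piece (e l)) \<subseteq> V - good"
      using base[OF k] base[OF l(1)] by blast
  next
    have "(\<Union>k<card ?I. insert (g (e k)) (piece (e k))) \<subseteq> V"
      using base good_eq good_W W_in by blast
    then show "V = V - good \<union> (\<Union>k<card ?I. insert (g (e k)) (piece (e k)))"
      using good_eq by blast
    show "{(x, g x) | x. x \<in> Dm} = {(x, g x) | x. x \<in> Dm - good} \<union> (\<Union>k<card ?I. {(x, g x) | x. x \<in> piece (e k)})"
    proof -
      have "(\<Union>k<card ?I. {(x, g x) | x. x \<in> piece (e k)}) = {(x, g x) | x. x \<in> good}"
        unfolding good_eq by blast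
      moreover have "good \<subseteq> Dm" using good_W dom by blast
      ultimately show ?thesis by auto
    qed
  qed
  then show ?thesis
    unfolding attach_paths_stars_def using piece_inward[OF eI]
    by (intro exI[of _ "card ?I"] exI[of _ "\<lambda>k. insert (g (e k)) (piece (e k))"]
        exI[of _ "\<lambda>k. {(x, g x) | x. x \<in> piece (e k)}"] exI[of _ "\<lambda>k. g (e k)"]) blast
qed

text \<open>A long orbit inside \<open>W\<close> repeats a residue class modulo \<open>p\<close>; it can neither return to the
  same vertex nor climb, since it would then never leave \<open>W\<close>, so it descends and its root is a
  spine vertex.\<close>

lemma finite_leftover:
  assumes "finite G"
  shows "finite {x \<in> W - good. \<exists>r. root r \<and> x \<in> tree r \<and> g r \<in> G}"
proof -
  have "x \<le> Max (insert 0 G) + p * N"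
    if x: "x \<in> W" "x \<notin> good" and r: "root r" "x \<in> tree r" "g r \<in> G" for x r
  proof -
    obtain n where n: "x \<in> V" "(g ^^ n) x = r" using r unfolding tree_def by blast
    have rW: "r \<in> W" using r(1) by (rule root_W)
    have inW: "(g ^^ i) x \<in> W" if "i \<le> n" for i using W_pow_le[of x n i] n rW that by simp
    have loc: "M0 \<le> g r"
    proof (rule ccontr)
      assume "\<not> M0 \<le> g r"
      then have "r \<in> const_roots" using rW unfolding const_roots_def by simp
      then obtain d j where d: "d \<in> star_roots" "r = d + j * p"
        using C.shift_gen_decomp unfolding star_roots_def by blast
      then have "x \<in> piece d" using r(2) piece_star by auto
      then show False using x(2) d(1) unfolding good_def by blast
    qed
    have not_spine: "\<not> spine r"
    proof
      assume "spine r"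
      then have "r \<in> path_roots" using r(1) loc unfolding path_roots_def by blast
      then show False using x(2) r(2) piece_path unfolding good_def by blast
    qed
    have "n < p"
    proof (rule ccontr)
      assume "\<not> n < p"
      have "\<not> inj_on (\<lambda>i. (g ^^ i) x mod p) {..p}"
      proof
        assume "inj_on (\<lambda>i. (g ^^ i) x mod p) {..p}"
        then have "card {..p} \<le> card {..<p}"
          by (rule card_inj_on_le) (use p_pos in auto)
        then show False by simp
      qed
      then obtain i j where "i \<le> p" "j \<le> p" "(g ^^ i) x mod p = (g ^^ j) x mod p" "i \<noteq> j"
        unfolding inj_on_def by blast
      then obtain i j where ij: "i < j" "j \<le> p" "(g ^^ i) x mod p = (g ^^ j) x mod p"
        by (metis linorder_neqE_nat)
      define m where "m = j - i"
      define y where "y = (g ^^ j) x"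
      define z where "z = (g ^^ i) x"
      have zy: "(g ^^ m) z = y" "0 < m" unfolding m_def z_def y_def using ij by (simp_all flip: pow_add)
      have yz_W: "y \<in> W" "z \<in> W" unfolding y_def z_def using inW ij \<open>\<not> n < p\<close> by simp_all
      show False
      proof (cases "z \<le> y")
        case True
        then obtain k where k: "y = z + k * p"
          using ij(3) unfolding y_def[symmetric] z_def[symmetric]
          by (metis dvdE le_add_diff_inverse mod_eq_dvd_iff_nat mult.commute)
        have climb: "(g ^^ (m * t)) z = z + t * k * p" for t
        proof (induction t)
          case (Suc t)
          have "(g ^^ (m * Suc t)) z = (g ^^ m) ((g ^^ (m * t)) z)" by (simp add: pow_add)
          also have "\<dots> = (g ^^ m) (z + (t * k) * p)" using Suc by simp
          also have "\<dots> = y + (t * k) * p"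
            using W_pow_shift[of z m "t * k"] zy yz_W W_in by simp
          finally show ?case using k by (simp add: algebra_simps)
        qed simp
        obtain l where l: "(g ^^ l) z \<notin> W" using W_exit yz_W by blast
        have "(g ^^ (m * l)) z \<in> W" unfolding climb using W.shift_mult yz_W by blast
        moreover have "l \<le> m * l" using zy(2) by simp
        ultimately show False using l W_pow_le yz_W W_in by blast
      next
        case False
        then obtain k where k: "z = y + k * p"
          using ij(3) unfolding y_def[symmetric] z_def[symmetric]
          by (metis dvdE le_add_diff_inverse mod_eq_dvd_iff_nat mult.commute nat_le_linear)
        have "0 < k" using k False by (cases k) auto
        \<comment> \<open>The \<open>m\<close> steps from \<open>z = y + k * p\<close> down to
          \<open>y\<close> commute with the \<open>l\<close> steps from \<open>y\<close> to the
          root. Hence \<open>m\<close> steps lead from \<open>r + k * p\<close> to \<open>r\<close>,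
          which makes \<open>r\<close> a spine vertex.\<close>
        define l where "l = n - j"
        have yr: "(g ^^ l) y = r"
          unfolding l_def y_def n(2)[symmetric] using ij \<open>\<not> n < p\<close> by (simp flip: pow_add)
        then have "(g ^^ l) (y + k * p) = r + k * p"
          using W_pow_shift[of y l k] rW yz_W W_in by simp
        moreover have "(g ^^ m) ((g ^^ l) (y + k * p)) = (g ^^ l) ((g ^^ m) (y + k * p))"
          by (simp add: add.commute flip: pow_add)
        ultimately have "(g ^^ m) (r + k * p) = r" using zy(1) k yr by simp
        then show False using not_spine \<open>0 < k\<close> unfolding spine_def by blast
      qed
    qed
    \<comment> \<open>All steps up to and including the one out of the root are local. As
      \<open>n < p\<close>, at most \<open>p\<close> steps, each descending by at most
      \<open>N\<close>, lead from \<open>x\<close> to \<open>g r\<close>; this is the bound claimed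
      above.\<close>
    have "x \<le> (g ^^ i) x + i * N" if "i \<le> Suc n" for i
      using that
    proof (induction i)
      case (Suc i)
      let ?u = "(g ^^ i) x"
      have "M0 \<le> g ?u"
      proof (cases "i = n")
        case True
        then show ?thesis using loc n by simp
      next
        case False
        then have "(g ^^ Suc i) x \<in> W" using Suc(2) by (intro inW) simp
        then show ?thesis using W_ge_M0 by simp
      qed
      then have "?u \<le> g ?u + N" using W_local inW Suc(2) by simp
      then show ?case using Suc by simp
    qed simp
    from this[of "Suc n"] have "x \<le> g r + Suc n * N" using n by simp
    moreover have "Suc n * N \<le> p * N" using \<open>n < p\<close> by (intro mult_right_mono) auto
    moreover have "g r \<le> Max (insert 0 G)" using r(3) assms by (intro Max_ge) auto
    ultimately show ?thesis by linarith
  qed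
  then have "{x \<in> W - good. \<exists>r. root r \<and> x \<in> tree r \<and> g r \<in> G} \<subseteq> {..Max (insert 0 G) + p * N}"
    by blast
  then show ?thesis by (rule finite_subset) simp
qed

end

section \<open>The three kinds of orbits\<close>

lemma finite_dcycle_orbit:
  assumes n: "0 < n" "(g ^^ n) c = c" and minimal: "\<And>m. 0 < m \<Longrightarrow> m < n \<Longrightarrow> (g ^^ m) c \<noteq> c"
  shows "finite_dcycle ((\<lambda>i. (g ^^ i) c) ` {0..<n}) {(x, g x) | x. x \<in> (\<lambda>i. (g ^^ i) c) ` {0..<n}}"
    and "inj_on (\<lambda>i. (g ^^ i) c) {0..<n}"
proof -
  let ?e = "\<lambda>i. (g ^^ i) c"
  have ne: "?e i \<noteq> ?e j" if "i < j" "j < n" for i j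
  proof
    assume eq: "?e i = ?e j"
    have "(g ^^ (n - j + i)) c = (g ^^ (n - j)) (?e j)" by (simp add: funpow_add eq)
    also have "\<dots> = (g ^^ (n - j + j)) c" by (simp only: funpow_add comp_apply)
    also have "\<dots> = c" using n that by simp
    finally show False using minimal[of "n - j + i"] that by linarith
  qed
  show inj: "inj_on ?e {0..<n}"
  proof (rule inj_onI)
    fix i j assume "i \<in> {0..<n}" "j \<in> {0..<n}" "?e i = ?e j"
    then show "i = j" using ne[of i j] ne[of j i] by (cases i j rule: linorder_cases) auto
  qed
  have step: "g (?e i) = ?e (Suc i mod n)" for i
    using funpow_mod_eq[OF n(2), of "Suc i"] by simp
  let ?h = "inv_into {0..<n} ?e"
  have h: "?h (?e i) = i" if "i < n" for i using inv_into_f_f[OF inj] that by simp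
  have "bij_betw ?h (?e ` {0..<n}) (cycle_graph_V n)"
    unfolding cycle_graph_V_def by (intro bij_betw_inv_into inj_on_imp_bij_betw inj)
  moreover have "(x, y) \<in> {(x, g x) | x. x \<in> ?e ` {0..<n}} \<longleftrightarrow> (?h x, ?h y) \<in> cycle_graph_E n"
    if xy: "x \<in> ?e ` {0..<n}" "y \<in> ?e ` {0..<n}" for x y
  proof -
    obtain i j where i: "i < n" "x = ?e i" and j: "j < n" "y = ?e j" using xy by auto
    have "(x, y) \<in> {(x, g x) | x. x \<in> ?e ` {0..<n}} \<longleftrightarrow> y = g x" using xy by blast
    also have "\<dots> \<longleftrightarrow> ?e j = ?e (Suc i mod n)" using i j step by simp
    also have "\<dots> \<longleftrightarrow> j = Suc i mod n" using inj j(1) n(1) by (auto dest: inj_onD)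
    also have "\<dots> \<longleftrightarrow> (?h x, ?h y) \<in> cycle_graph_E n"
      unfolding cycle_graph_E_def using i j h by auto
    finally show ?thesis .
  qed
  ultimately show "finite_dcycle (?e ` {0..<n}) {(x, g x) | x. x \<in> ?e ` {0..<n}}"
    unfolding finite_dcycle_def graph_iso_def using n(1)
    by (intro exI[of _ n] conjI exI[of _ ?h]) auto
qed

lemma cycle_with_trees_orbit:
  assumes fin: "finite B" and closed: "\<And>x. x \<in> B \<Longrightarrow> g x \<in> B"
    and c: "c \<in> B" "0 < n" "(g ^^ n) c = c" and reach: "\<And>x. x \<in> B \<Longrightarrow> \<exists>n. (g ^^ n) x = c"
  shows "cycle_with_trees B {(x, g x) | x. x \<in> B}"
proof -
  define m where "m = (LEAST m. 0 < m \<and> (g ^^ m) c = c)"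
  have m: "0 < m" "(g ^^ m) c = c"
    using LeastI[of "\<lambda>m. 0 < m \<and> (g ^^ m) c = c" n] c unfolding m_def by auto
  have minimal: "(g ^^ k) c \<noteq> c" if "0 < k" "k < m" for k
    using not_less_Least[of k "\<lambda>m. 0 < m \<and> (g ^^ m) c = c"] that unfolding m_def by auto
  let ?e = "\<lambda>i. (g ^^ i) c"
  define C where "C = ?e ` {0..<m}"
  have e_C: "?e k \<in> C" if "k < m" for k unfolding C_def using that by simp
  have C_e: "\<exists>k<m. x = ?e k" if "x \<in> C" for x using that unfolding C_def by auto
  note cyc = finite_dcycle_orbit[OF m minimal]
  have eB: "?e i \<in> B" for i by (induction i) (use c closed in auto)
  have C_closed: "g x \<in> C" if x: "x \<in> C" for x
  proof -
    obtain i where "x = ?e i" using C_e[OF x] by blast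
    then have "g x = ?e (Suc i mod m)" using funpow_mod_eq[OF m(2), of "Suc i"] by simp
    then show ?thesis using m(1) e_C by simp
  qed
  \<comment> \<open>Vertices are sorted by the first vertex of the cycle on their orbit; the clause
    on smaller \<open>i\<close> makes the trees disjoint and keeps other cycle vertices out.\<close>
  define T where "T k = {x \<in> B. \<exists>n. (g ^^ n) x = ?e k \<and> (\<forall>i<n. (g ^^ i) x \<notin> C)}" for k
  have T_C: "x = ?e k" if "x \<in> T k" "x \<in> C" for x k
  proof -
    obtain n where n: "(g ^^ n) x = ?e k" "\<forall>i<n. (g ^^ i) x \<notin> C" using \<open>x \<in> T k\<close> unfolding T_def by blast
    have "n = 0" using n(2) \<open>x \<in> C\<close> by (cases n) (auto dest: spec[of _ 0])
    then show ?thesis using n by simp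
  qed
  have e_T: "?e k \<in> T k" for k unfolding T_def using eB by (auto intro: exI[of _ 0])
  have T_step: "g x \<in> T k" if x: "x \<in> T k" "x \<noteq> ?e k" for x k
  proof -
    obtain n where n: "x \<in> B" "(g ^^ n) x = ?e k" "\<forall>i<n. (g ^^ i) x \<notin> C"
      using x unfolding T_def by blast
    then obtain n' where n': "n = Suc n'" using x(2) by (cases n) auto
    have "(g ^^ n') (g x) = ?e k" using n n' by (simp add: funpow_swap1)
    moreover have "(g ^^ i) (g x) \<notin> C" if "i < n'" for i
      using n(3)[rule_format, of "Suc i"] n' that by (simp add: funpow_swap1)
    ultimately show ?thesis unfolding T_def using closed n(1) by blast
  qed
  have T_disj: "T k \<inter> T l = {}" if kl: "k < m" "l < m" "k \<noteq> l" for k l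
  proof (rule ccontr)
    assume "T k \<inter> T l \<noteq> {}"
    then obtain x a b where a: "(g ^^ a) x = ?e k" "\<forall>i<a. (g ^^ i) x \<notin> C"
      and b: "(g ^^ b) x = ?e l" "\<forall>i<b. (g ^^ i) x \<notin> C" unfolding T_def by blast
    have "?e k \<in> C" "?e l \<in> C" using kl e_C by auto
    then have "a = b" using a b by (metis linorder_neqE_nat)
    then have "?e k = ?e l" using a b by simp
    then show False using inj_onD[OF cyc(2), of k l] kl by simp
  qed
  have T_cover: "\<exists>k<m. x \<in> T k" if x: "x \<in> B" for x
  proof -
    define a where "a = (LEAST a. (g ^^ a) x \<in> C)"
    have ex: "\<exists>a. (g ^^ a) x \<in> C"
      using reach[OF x] e_C[OF m(1)] by auto
    have "(g ^^ a) x \<in> C" unfolding a_def using ex by (rule LeastI_ex)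
    moreover have "(g ^^ i) x \<notin> C" if "i < a" for i
      using not_less_Least[OF that[unfolded a_def]] .
    moreover from calculation obtain k where "k < m" "(g ^^ a) x = ?e k" using C_e by blast
    ultimately have "x \<in> T k" unfolding T_def using x by blast
    then show ?thesis using \<open>k < m\<close> by blast
  qed
  have "attached B {(x, g x) | x. x \<in> B} C {(x, g x) | x. x \<in> C} m
    T (\<lambda>k. {(x, g x) | x. x \<in> T k - {?e k}}) ?e"
    unfolding attached_def
  proof (intro conjI allI impI)
    show "{(x, g x) | x. x \<in> C} \<subseteq> C \<times> C" using C_closed by blast
    show "{(x, g x) | x. x \<in> T k - {?e k}} \<subseteq> T k \<times> T k" for k using T_step by blast
    show "?e k \<in> C" if "k < m" for k using that by (rule e_C)
    show "C \<inter> T k = {?e k}" if "k < m" for k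
    proof
      show "C \<inter> T k \<subseteq> {?e k}" using T_C by (metis IntD1 IntD2 singletonI subsetI)
      show "{?e k} \<subseteq> C \<inter> T k" using e_T e_C that by auto
    qed
    show "T k \<inter> T l \<subseteq> C" if "k < m" "l < m" "k \<noteq> l" for k l using T_disj[OF that] by blast
    have CB: "C \<subseteq> B" "\<And>k. T k \<subseteq> B" using eB C_e unfolding T_def by auto
    then show "B = C \<union> (\<Union>k<m. T k)" using T_cover by blast
    show "{(x, g x) | x. x \<in> B} = {(x, g x) | x. x \<in> C} \<union> (\<Union>k<m. {(x, g x) | x. x \<in> T k - {?e k}})"
    proof -
      have "x \<in> C \<or> (\<exists>k<m. x \<in> T k - {?e k})" if "x \<in> B" for x
      proof -
        obtain k where "k < m" "x \<in> T k" using T_cover[OF \<open>x \<in> B\<close>] by blast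
        then show ?thesis using e_C[of k] by (cases "x = ?e k") auto
      qed
      then have "B \<subseteq> C \<union> (\<Union>k<m. T k - {?e k})" by auto
      moreover have "C \<union> (\<Union>k<m. T k - {?e k}) \<subseteq> B" using CB by auto
      ultimately have B_eq: "B = C \<union> (\<Union>k<m. T k - {?e k})" by (rule equalityI)
      show ?thesis by (subst B_eq) auto
    qed
  qed
  moreover have "inward_rooted_tree (T k) {(x, g x) | x. x \<in> T k - {?e k}} (?e k)" for k
  proof (rule inward_rooted_treeI)
    show "finite (T k)" using fin unfolding T_def by simp
    show "\<exists>n. (g ^^ n) x = ?e k" if "x \<in> T k" for x using that unfolding T_def by blast
  qed (use e_T T_step in auto)
  ultimately show ?thesis
    unfolding cycle_with_trees_def using cyc(1)[folded C_def] by blast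
qed

context equivariant_cut
begin

section \<open>Orbits that end in a cycle or a sink\<close>

lemma reach_periodic:
  assumes c: "c \<in> V" "0 < n" "(g ^^ n) c = c" and x: "x \<in> V"
  shows "\<exists>a. (g ^^ a) x = c"
proof -
  obtain a b where ab: "(g ^^ a) x = (g ^^ b) c" using conn[OF x c(1)] by blast
  \<comment> \<open>After \<open>b\<close> steps from \<open>c\<close>, another
    \<open>n * b - b\<close> steps complete \<open>b\<close> full rounds of the cycle.\<close>
  have "b \<le> n * b" using c(2) by simp
  then have "(g ^^ (n * b - b + a)) x = (g ^^ (n * b)) c"
    unfolding pow_add ab by (simp flip: pow_add)
  also have "\<dots> = c" using funpow_mod_eq[OF c(3), of "n * b"] by simp
  finally show ?thesis by blast
qed

lemma periodic_F:
  assumes c: "c \<in> V" "0 < n" "(g ^^ n) c = c"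
  shows "c \<in> F"
proof -
  obtain z where z: "z \<in> V" "z < K" using K_small by blast
  obtain a where "(g ^^ a) z = c" using reach_periodic[OF c z(1)] by blast
  then show ?thesis using F_pow[OF small_F[OF z]] by metis
qed

text \<open>Every orbit runs into the cycle and is finite, so \<open>F\<close>, a union of finitely
  many orbits, is finite as well; \<open>finite_leftover\<close> bounds what remains of
  \<open>W\<close>.\<close>

lemma finite_base:
  assumes c: "c \<in> V" "0 < n" "(g ^^ n) c = c"
  shows "finite (V - good)"
proof -
  have orbit: "finite (range (\<lambda>i. (g ^^ i) x))" if x: "x \<in> V" for x
  proof -
    obtain a where a: "(g ^^ a) x = c" using reach_periodic[OF c x] by blast
    have "(g ^^ i) x \<in> (\<lambda>i. (g ^^ i) x) ` {..a + n}" for i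
    proof (cases "i \<le> a")
      case False
      then have "(g ^^ i) x = (g ^^ (i - a)) c" using pow_add[of "i - a" a x] a by simp
      also have "\<dots> = (g ^^ ((i - a) mod n)) c" using funpow_mod_eq[OF c(3)] by metis
      also have "\<dots> = (g ^^ ((i - a) mod n + a)) x" by (simp add: pow_add a)
      finally show ?thesis
        using mod_less_divisor[OF c(2), of "i - a"] by (intro image_eqI[of _ _ "(i - a) mod n + a"]) auto
    qed auto
    then have "range (\<lambda>i. (g ^^ i) x) \<subseteq> (\<lambda>i. (g ^^ i) x) ` {..a + n}" by blast
    then show ?thesis by (rule finite_subset) simp
  qed
  have "F = (\<Union>z\<in>{z \<in> V. z < K}. range (\<lambda>i. (g ^^ i) z))" unfolding F_def by blast
  then have fin: "finite F" using orbit by simp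
  have "V - good \<subseteq> F \<union> {x \<in> W - good. \<exists>r. root r \<and> x \<in> tree r \<and> g r \<in> F}"
    using root_tree root_F W_F by blast
  then show ?thesis using finite_leftover[OF fin] fin by (meson finite_Un finite_subset)
qed

lemma base_closed: "x \<in> V - good \<Longrightarrow> g x \<in> V - good"
  using g_in good_pre by blast

lemma way1_if_periodic:
  assumes c: "c \<in> V" "0 < n" "(g ^^ n) c = c"
  shows "way1 V {(x, g x) | x. x \<in> V}"
proof -
  have "cycle_with_trees (V - good) {(x, g x) | x. x \<in> V - good}"
  proof (rule cycle_with_trees_orbit)
    show "finite (V - good)" using c by (rule finite_base)
    show "c \<in> V - good" using periodic_F[OF c] F_in good_W unfolding W_def by blast
    show "\<exists>n. (g ^^ n) x = c" if "x \<in> V - good" for x using reach_periodic[OF c] that by blast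
  qed (use base_closed c in blast)+
  moreover have "W \<subseteq> V" using W_in by blast
  ultimately show ?thesis
    unfolding way1_def using attach_paths_stars_good[of V] by blast
qed

text \<open>The fixed point stands for a vertex where the partial map is undefined, so its loop is
  not an edge of the graph.\<close>

lemma way3_if_fixpoint:
  assumes c: "c \<in> V" "g c = c"
  shows "way3 V {(x, g x) | x. x \<in> V - {c}}"
proof -
  have c': "c \<in> V" "0 < (1::nat)" "(g ^^ 1) c = c" using c by simp_all
  have cF: "c \<in> F" using c' by (rule periodic_F)
  have "inward_rooted_tree (V - good) {(x, g x) | x. x \<in> V - good - {c}} c"
  proof (rule inward_rooted_treeI)
    show "finite (V - good)" using c' by (rule finite_base)
    show "c \<in> V - good" using cF F_in good_W unfolding W_def by blast
    show "\<exists>n. (g ^^ n) x = c" if "x \<in> V - good" for x using reach_periodic[OF c'] that by blast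
  qed (use base_closed in blast)
  moreover have "V - good - {c} = V - {c} - good" by blast
  moreover have "W \<subseteq> V - {c}" using W_in cF unfolding W_def by blast
  ultimately show ?thesis
    unfolding way3_def using attach_paths_stars_good[of "V - {c}"] by auto
qed

section \<open>Orbits that contain an outward ray\<close>

lemma way2_if_ray:
  assumes aperiodic: "\<And>x n. x \<in> V \<Longrightarrow> 0 < n \<Longrightarrow> (g ^^ n) x \<noteq> x"
    and y: "y \<in> V" "y < K" and s: "0 < s" "(g ^^ s) y = y + p" and y_ge: "\<And>t. M \<le> (g ^^ t) y"
  shows "way2 V {(x, g x) | x. x \<in> V}"
proof -
  let ?y = "\<lambda>t. (g ^^ t) y"
  have yV: "?y t \<in> V" for t using y(1) by (rule pow_in)
  have yF: "?y t \<in> F" for t using F_pow[OF small_F[OF y]] .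
  have y_shift: "?y (t + s) = ?y t + p" for t
  proof (induction t)
    case (Suc t)
    have "g (?y t + p) = g (?y t) + p"
      using local_step[OF yV y_ge, of t] y_ge[of "Suc t"] M0_le by simp
    then show ?case using Suc by simp
  qed (simp add: s)
  have y_inj: "t = t'" if "?y t = ?y t'" for t t'
  proof -
    have "\<not> i < j" if "?y i = ?y j" for i j
    proof
      assume "i < j"
      then have "(g ^^ (j - i)) (?y i) = ?y i" using that pow_add[of "j - i" i y] by simp
      then show False using aperiodic[OF yV, of "j - i"] \<open>i < j\<close> by simp
    qed
    then show ?thesis using that by (metis linorder_neqE_nat)
  qed
  have "\<exists>b a. (g ^^ a) z = ?y b" if "z \<in> V" for z using conn[OF that y(1)] by blast
  then obtain \<beta> where \<beta>: "\<And>z. z \<in> V \<Longrightarrow> \<exists>a. (g ^^ a) z = ?y (\<beta> z)" by metis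
  \<comment> \<open>Far enough along the ray that the orbits of all small vertices have joined it;
    hence they all pass through \<open>r\<close>.\<close>
  define t0 where "t0 = Max (insert 0 (\<beta> ` {z \<in> V. z < K}))"
  define r where "r = ?y t0"
  have small_r: "\<exists>a. (g ^^ a) z = r" if z: "z \<in> V" "z < K" for z
  proof -
    obtain a where a: "(g ^^ a) z = ?y (\<beta> z)" using \<beta>[OF z(1)] by blast
    have "\<beta> z \<le> t0" unfolding t0_def using z by (intro Max_ge) auto
    then have "(g ^^ (t0 - \<beta> z + a)) z = r" unfolding pow_add a r_def by (simp flip: pow_add)
    then show ?thesis by blast
  qed
  define R where "R = {?y t | t. t0 < t}"
  have rV: "r \<in> V" and rF: "r \<in> F" unfolding r_def using yV yF by auto
  have R_F: "R \<subseteq> F" unfolding R_def using yF by blast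
  have R_ge: "M0 \<le> x" if "x \<in> R" for x using that y_ge M0_le order_trans unfolding R_def by blast
  have r_R: "r \<notin> R" unfolding R_def r_def using y_inj by blast
  have R_shift: "x + p \<in> R" if x: "x \<in> insert r R" for x
  proof -
    obtain t where "t0 \<le> t" "x = ?y t" using x unfolding R_def r_def by (auto intro: less_imp_le)
    then have "x + p = ?y (t + s)" "t0 < t + s" using y_shift s(1) by auto
    then show ?thesis unfolding R_def by blast
  qed
  have R_step: "g x \<in> R" if x: "x \<in> insert r R" for x
  proof -
    obtain t where "t0 \<le> t" "x = ?y t" using x unfolding R_def r_def by (auto intro: less_imp_le)
    then have "g x = ?y (Suc t)" "t0 < Suc t" by auto
    then show ?thesis unfolding R_def by blast
  qed
  \<comment> \<open>\<open>F\<close> contains the whole ray and is infinite. Without the part of the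
    ray beyond \<open>r\<close>, finitely many vertices remain, and all of them flow into
    \<open>r\<close>.\<close>
  define F0 where "F0 = F - R"
  obtain \<alpha> where \<alpha>: "\<And>z. z \<in> V \<Longrightarrow> z < K \<Longrightarrow> (g ^^ \<alpha> z) z = r" using small_r by metis
  have F0_form: "i \<le> \<alpha> z" if z: "z \<in> V" "z < K" "(g ^^ i) z \<notin> R" for z i
  proof (rule ccontr)
    assume "\<not> i \<le> \<alpha> z"
    then have "(g ^^ i) z = (g ^^ (i - \<alpha> z)) r" using \<alpha>[OF z(1,2)] pow_add[of "i - \<alpha> z" "\<alpha> z" z] by simp
    also have "\<dots> = ?y (i - \<alpha> z + t0)" unfolding r_def by (simp add: pow_add)
    finally show False using z(3) \<open>\<not> i \<le> \<alpha> z\<close> unfolding R_def by auto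
  qed
  have F0_reach: "\<exists>a. (g ^^ a) x = r" if x: "x \<in> F0" for x
  proof -
    obtain i z where z: "x = (g ^^ i) z" "z \<in> V" "z < K" "x \<notin> R" using x unfolding F0_def F_def by blast
    then have "i \<le> \<alpha> z" using F0_form by blast
    then have "(g ^^ (\<alpha> z - i)) x = r" using \<alpha>[OF z(2,3)] z(1) by (simp flip: pow_add)
    then show ?thesis by blast
  qed
  have fin_F0: "finite F0"
  proof -
    have "F0 \<subseteq> (\<Union>z\<in>{z \<in> V. z < K}. (\<lambda>i. (g ^^ i) z) ` {..\<alpha> z})"
      unfolding F0_def F_def using F0_form by fastforce
    then show ?thesis by (rule finite_subset) simp
  qed
  \<comment> \<open>Otherwise \<open>g x\<close> would lie beyond \<open>r\<close> on the ray and
    still have \<open>r\<close> on its orbit, so the ray would repeat a vertex.\<close>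
  have F0_step: "g x \<notin> R" if x: "x \<in> F0" "x \<noteq> r" for x
  proof
    assume "g x \<in> R"
    then obtain t where t: "t0 < t" "g x = ?y t" unfolding R_def by blast
    obtain a where a: "(g ^^ a) x = r" using F0_reach[OF x(1)] by blast
    then obtain a' where "a = Suc a'" using x(2) by (cases a) auto
    then have "?y (a' + t) = ?y t0" using a t unfolding pow_add r_def by (simp add: funpow_swap1)
    then have "a' + t = t0" by (rule y_inj)
    then show False using t by simp
  qed
  \<comment> \<open>The parts of \<open>W\<close> hanging on the ray beyond \<open>r\<close> become
    side branches of the outward path.\<close>
  define Wr where "Wr = {x \<in> W. \<exists>\<rho>. root \<rho> \<and> g \<rho> \<in> R \<and> M0 \<le> g \<rho> \<and> x \<in> tree \<rho>}"
  define A where "A = R \<union> Wr"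
  have Wr_pre: "x \<in> Wr" if "x \<in> V" "g x \<in> Wr" for x
    using that W_pre tree_pre unfolding Wr_def by blast
  have Wr_root: "x \<in> Wr" if "x \<in> W" "g x \<in> R" for x
  proof -
    have "root x" unfolding root_def using that R_F unfolding W_def by blast
    moreover have "x \<in> tree x" using that W_in tree_self by blast
    ultimately show ?thesis unfolding Wr_def using that R_ge by blast
  qed
  have Wr_step: "g x \<in> A \<and> M0 \<le> g x" if x: "x \<in> Wr" for x
  proof -
    obtain \<rho> where \<rho>: "root \<rho>" "g \<rho> \<in> R" "M0 \<le> g \<rho>" "x \<in> tree \<rho>" using x unfolding Wr_def by blast
    show ?thesis
    proof (cases "x = \<rho>")
      case False
      then have "g x \<in> tree \<rho>" using \<rho> tree_step by blast
      moreover from this have "g x \<in> W" using tree_W root_W \<rho>(1) by blast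
      ultimately show ?thesis using \<rho> W_ge_M0 unfolding A_def Wr_def by blast
    qed (use \<rho> in \<open>auto simp: A_def\<close>)
  qed
  have Wr_W: "Wr \<subseteq> W" unfolding Wr_def by blast
  have Wr_shift: "x + p \<in> Wr" if x: "x \<in> Wr" for x
  proof -
    obtain \<rho> where \<rho>: "root \<rho>" "g \<rho> \<in> R" "M0 \<le> g \<rho>" "x \<in> tree \<rho>" using x unfolding Wr_def by blast
    have \<rho>W: "\<rho> \<in> W" using \<rho>(1) by (rule root_W)
    have g\<rho>: "g (\<rho> + p) = g \<rho> + p" using W_local[OF \<rho>W \<rho>(3)] by blast
    then have "\<rho> + p \<in> Wr" using R_shift \<rho>(2) W_shift[OF \<rho>W] by (intro Wr_root) auto
    moreover have "root (\<rho> + p)"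
      unfolding root_def using g\<rho> R_shift \<rho>(2) W_shift[OF \<rho>W] R_F unfolding W_def by auto
    moreover have "x + p \<in> tree (\<rho> + p)" using tree_shift[OF \<rho>W \<rho>(4), of 1] by simp
    moreover have "g (\<rho> + p) \<in> R" using g\<rho> R_shift \<rho>(2) by simp
    ultimately show ?thesis unfolding Wr_def using tree_W W_shift[OF \<rho>W] R_ge by blast
  qed
  have A_V: "A \<subseteq> V" unfolding A_def using R_F F_in Wr_W W_in by blast
  have shift: "shift_closed A p"
    by unfold_locales (use p_pos R_shift Wr_shift in \<open>auto simp: A_def\<close>)
  have outward: "outward_periodic_path (insert r A) {(x, g x) | x. x \<in> insert r A} r"
  proof (rule outward_piece[OF shift])
    show "r \<notin> A" using r_R rF Wr_W unfolding A_def W_def by blast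
    show "r + p \<in> A" using R_shift unfolding A_def by blast
    show "g x \<in> A" if "x \<in> insert r A" for x using that R_step Wr_step unfolding A_def by blast
    show "(g ^^ n) x \<noteq> x" if "x \<in> A" "0 < n" for x n using that A_V aperiodic by blast
    show "g (x + p) = g x + p" if "x \<in> insert r A" for x
    proof (cases "x \<in> Wr")
      case True
      then show ?thesis using W_local Wr_W Wr_step by blast
    next
      case False
      then have x: "x \<in> insert r R" using that unfolding A_def by blast
      then obtain t where "x = ?y t" unfolding R_def r_def by blast
      then have "M \<le> x" "x \<in> V" using y_ge yV by auto
      then show ?thesis using local_step R_ge[OF R_step[OF x]] by blast
    qed
    \<comment> \<open>On the ray, the index equation from \<open>y_shift\<close> gives the
      predecessor. On a branch whose image stays in a branch, \<open>W_pull\<close> applies. The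
      case of an edge from a branch into the ray needs the separation of \<open>F0\<close> from
      \<open>R\<close>.\<close>
    show "\<exists>x'\<in>insert r A. x = x' + p" if xz: "x \<in> insert r A" "z \<in> A" "g x = z + p" for x z
    proof -
      have z_W: "g x \<in> W" if "z \<in> W" using W_shift[OF that] xz(3) by simp
      have z_R: "g x \<in> R" if "z \<in> R" using R_shift that xz(3) by simp
      show ?thesis
      proof (cases "x \<in> Wr")
        case False
        then have x: "x \<in> insert r R" using xz unfolding A_def by blast
        then have "g x \<in> R" by (rule R_step)
        then have "z \<in> R" using z_W xz(2) Wr_W R_F unfolding A_def W_def by blast
        then obtain u where u: "t0 < u" "z = ?y u" unfolding R_def by blast
        obtain t where t: "x = ?y t" using x unfolding R_def r_def by blast
        have "?y (Suc t) = ?y (u + s)" using xz(3) u t y_shift by simp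
        then have "Suc t = u + s" by (rule y_inj)
        then have "t = (u - 1) + s" using u by simp
        then have "x = ?y (u - 1) + p" using t y_shift by metis
        moreover have "?y (u - 1) \<in> insert r A"
        proof (cases "u - 1 = t0")
          case False
          then have "t0 < u - 1" using u by simp
          then show ?thesis unfolding A_def R_def by blast
        qed (simp add: r_def)
        ultimately show ?thesis by blast
      next
        case True
        then have xW: "x \<in> W" using Wr_W by blast
        show ?thesis
        proof (cases "z \<in> R")
          case False
          then have zWr: "z \<in> Wr" using xz(2) unfolding A_def by blast
          then have "\<exists>x'\<in>W. x = x' + 1 * p \<and> g x' = z"
            using xz(3) Wr_W W_in[OF xW] by (intro W_pull) auto
          then obtain x' where "x' \<in> W" "x = x' + p" "g x' = z" by auto
          then show ?thesis using Wr_pre zWr W_in unfolding A_def by blast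
        next
          \<comment> \<open>Here \<open>x - p\<close> maps to \<open>z\<close> on the ray. It is not
            \<open>r\<close> or on the ray beyond \<open>r\<close>, as \<open>x\<close> would then
            be on the ray; nor is it another vertex of \<open>F0\<close>, by \<open>F0_step\<close>.
            So it belongs to \<open>W\<close> and is a root over the ray.\<close>
          case zR: True
          have "g x = g (x - p) + p" using W_unshift(3)[OF xW] R_ge[OF z_R[OF zR]] by blast
          then have gz: "g (x - p) = z" using xz(3) by simp
          have x_R: "x \<notin> R" using xW R_F unfolding W_def by blast
          have x_eq: "x = (x - p) + p" using xW by (rule W_unshift(2))
          have "x - p \<notin> insert r R" using x_eq R_shift x_R by metis
          then have "x - p \<notin> F" using F0_step gz zR unfolding F0_def by blast
          then have "x - p \<in> W" using W_unshift(1)[OF xW] unfolding W_def by blast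
          then have "x - p \<in> Wr" using Wr_root gz zR by blast
          then show ?thesis using x_eq unfolding A_def by blast
        qed
      qed
    qed
  qed
  \<comment> \<open>A root over the ray is not a spine vertex: its image translated by
    \<open>k * p\<close> would lie in \<open>W\<close> as part of the tree, and in \<open>F\<close>
    because \<open>R\<close> is closed under translation.\<close>
  have A_good: "x \<notin> good" if x: "x \<in> A" for x
  proof
    assume good: "x \<in> good"
    then have "x \<in> Wr" using x good_W R_F unfolding A_def W_def by blast
    then obtain \<rho> where \<rho>: "root \<rho>" "g \<rho> \<in> R" "M0 \<le> g \<rho>" "x \<in> tree \<rho>" unfolding Wr_def by blast
    obtain i where i: "i \<in> star_roots \<union> path_roots" "x \<in> piece i" using good unfolding good_def by blast
    obtain j where j: "root (i + j * p)" "x \<in> tree (i + j * p)" "g (i + j * p) = g i" "i \<in> path_roots \<longrightarrow> j = 0"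
      using piece_root[OF i] by blast
    have eq: "i + j * p = \<rho>" using tree_unique \<rho> j by blast
    then have "M0 \<le> g i" using j(3) \<rho>(3) by simp
    then have "i \<in> path_roots" using i(1) star_roots_const unfolding const_roots_def by force
    then have "\<rho> \<in> path_roots" using j(4) eq by simp
    then obtain k n where k: "0 < k" "(g ^^ n) (\<rho> + k * p) = \<rho>" unfolding path_roots_def spine_def by blast
    have "g \<rho> + k * p \<in> tree \<rho>" using spine_root_step(2)[OF \<rho>(1,3) k] .
    then have "g \<rho> + k * p \<in> W" using tree_W root_W \<rho>(1) by blast
    moreover have "g \<rho> + l * p \<in> R" for l
    proof (induction l)
      case (Suc l)
      then show ?case using R_shift[of "g \<rho> + l * p"] by (simp add: ac_simps)
    qed (simp add: \<rho>)
    ultimately show False using R_F unfolding W_def by blast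
  qed
  define B where "B = V - good"
  define T where "T = B - A"
  have rT: "r \<in> T"
    unfolding T_def B_def using rV rF r_R good_W Wr_W unfolding A_def W_def by blast
  have T_F: "x \<in> F0" if "x \<in> T" "x \<in> F" for x
    using that unfolding T_def A_def F0_def by blast
  have T_W: "\<exists>\<rho>. root \<rho> \<and> x \<in> tree \<rho> \<and> g \<rho> \<in> F0" if x: "x \<in> T" "x \<in> W" for x
  proof -
    obtain \<rho> where \<rho>: "root \<rho>" "x \<in> tree \<rho>" using root_tree[OF x(2)] by blast
    have "g \<rho> \<notin> R"
    proof
      assume "g \<rho> \<in> R"
      then have "x \<in> Wr" unfolding Wr_def using \<rho> x(2) R_ge by blast
      then show False using x(1) unfolding T_def A_def by blast
    qed
    then show ?thesis using \<rho> root_F unfolding F0_def by blast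
  qed
  have T_cases: "x \<in> F \<or> x \<in> W" if "x \<in> T" for x
    using that W_F unfolding T_def B_def by blast
  have T_step: "g x \<in> T" if x: "x \<in> T" "x \<noteq> r" for x
  proof -
    have xB: "x \<in> V - good" using x(1) unfolding T_def B_def by blast
    have "g x \<notin> R"
      using T_cases[OF x(1)] F0_step[OF T_F[OF x(1)] x(2)] Wr_root x(1) unfolding T_def A_def by blast
    moreover have "g x \<notin> Wr" using Wr_pre xB x(1) unfolding T_def A_def by blast
    ultimately show ?thesis using base_closed[OF xB] unfolding T_def B_def A_def by blast
  qed
  have "inward_rooted_tree T {(x, g x) | x. x \<in> T - {r}} r"
  proof (rule inward_rooted_treeI)
    have "T \<subseteq> F0 \<union> {x \<in> W - good. \<exists>\<rho>. root \<rho> \<and> x \<in> tree \<rho> \<and> g \<rho> \<in> F0}"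
      using T_F T_W T_cases unfolding T_def B_def by blast
    then show "finite T" using finite_leftover[OF fin_F0] fin_F0 by (meson finite_Un finite_subset)
    show "g x \<in> T" if "x \<in> T" "x \<noteq> r" for x using that by (rule T_step)
    show "\<exists>n. (g ^^ n) x = r" if x: "x \<in> T" for x
    proof (cases "x \<in> F")
      case True
      then show ?thesis using F0_reach T_F x by blast
    next
      case False
      then obtain \<rho> where \<rho>: "x \<in> tree \<rho>" "g \<rho> \<in> F0" using T_W T_cases x by blast
      obtain n where n: "(g ^^ n) x = \<rho>" using \<rho>(1) unfolding tree_def by blast
      obtain a where a: "(g ^^ a) (g \<rho>) = r" using F0_reach[OF \<rho>(2)] by blast
      have "(g ^^ (a + Suc n)) x = r" unfolding pow_add using n a by simp
      then show ?thesis by blast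
    qed
  qed (rule rT)
  moreover have "attached B {(x, g x) | x. x \<in> B} T {(x, g x) | x. x \<in> T - {r}} 1
      (\<lambda>_. insert r A) (\<lambda>_. {(x, g x) | x. x \<in> insert r A}) (\<lambda>_. r)"
  proof -
    have AB: "A \<subseteq> B" using A_V A_good unfolding B_def by blast
    have "{(x, g x) | x. x \<in> T - {r}} \<subseteq> T \<times> T" using T_step by blast
    moreover have "{(x, g x) | x. x \<in> insert r A} \<subseteq> insert r A \<times> insert r A"
      using R_step Wr_step unfolding A_def by blast
    moreover have "T \<inter> insert r A = {r}" using rT unfolding T_def by blast
    moreover have B_eq: "B = T \<union> insert r A" using AB rT unfolding T_def by blast
    moreover have "{(x, g x) | x. x \<in> B} = {(x, g x) | x. x \<in> T - {r}} \<union> {(x, g x) | x. x \<in> insert r A}"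
      unfolding B_eq by blast
    ultimately show ?thesis unfolding attached_def using rT by (simp add: lessThan_Suc)
  qed
  ultimately have "tree_with_outward_path B {(x, g x) | x. x \<in> B}"
    unfolding tree_with_outward_path_def using outward by blast
  moreover have "W \<subseteq> V" using W_in by blast
  ultimately show ?thesis
    unfolding way2_def B_def using attach_paths_stars_good[of V] by blast
qed

end

context equivariant_map
begin

text \<open>\<open>y < K\<close> puts a prescribed vertex into \<open>F\<close>; for the start of
  the ray this means that the whole ray lies in \<open>F\<close>.\<close>

lemma exists_cut:
  assumes "y \<in> V"
  shows "\<exists>K. y < K \<and> equivariant_cut V g p M0 M N K"
proof -
  define K where "K = M + p + y + 1 + Max (insert 0 (g ` {..<M}))"
  have "g z < K" if "z < M" for z
  proof -
    have "g z \<le> Max (insert 0 (g ` {..<M}))" using that by (intro Max_ge) auto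
    then show ?thesis unfolding K_def by simp
  qed
  moreover have "y < K" "M + p \<le> K" unfolding K_def by simp_all
  ultimately show ?thesis
    using assms by (intro exI[of _ K] conjI) (unfold_locales, auto)
qed

lemma fixpoint_way3:
  assumes "c \<in> V" "g c = c"
  shows "way3 V {(x, g x) | x. x \<in> V - {c}}"
  using exists_cut[OF assms(1)] equivariant_cut.way3_if_fixpoint assms by blast

lemma total_way1_or_way2:
  "way1 V {(x, g x) | x. x \<in> V} \<or> way2 V {(x, g x) | x. x \<in> V}"
proof (cases "\<exists>c\<in>V. \<exists>n>0. (g ^^ n) c = c")
  case True
  then obtain c n where c: "c \<in> V" "0 < n" "(g ^^ n) c = c" by blast
  then show ?thesis using exists_cut[OF c(1)] equivariant_cut.way1_if_periodic[OF _ c] by blast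
next
  case False
  then have aperiodic: "\<And>x n. x \<in> V \<Longrightarrow> 0 < n \<Longrightarrow> (g ^^ n) x \<noteq> x" by blast
  obtain y s where y: "y \<in> V" "0 < s" "(g ^^ s) y = y + p" "\<And>t. M \<le> (g ^^ t) y"
    using exists_ray[OF aperiodic] by blast
  obtain K where K: "y < K" "equivariant_cut V g p M0 M N K" using exists_cut[OF y(1)] by blast
  have "way2 V {(x, g x) | x. x \<in> V}"
    by (rule equivariant_cut.way2_if_ray[OF K(2) _ y(1) K(1) y(2-4)]) (rule aperiodic)
  then show ?thesis by blast
qed

end

section \<open>From presentations to equivariant maps\<close>

text \<open>A vertex outside the domain of \<open>f\<close> becomes a fixed point. Whether a fixed
  point carries a genuine loop has to be read off from \<open>f\<close>.\<close>

definition total_step :: "('x \<Rightarrow> 'x option) \<Rightarrow> 'x \<Rightarrow> 'x" where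
  "total_step f x = (case f x of None \<Rightarrow> x | Some y \<Rightarrow> y)"

text \<open>An undirected step along an edge of a functional graph shifts one of the two orbits by a
  single application of the map.\<close>

lemma orbits_meet:
  assumes "(x, y) \<in> (graph_edges X f \<union> (graph_edges X f)\<inverse>)\<^sup>*"
  shows "\<exists>a b. (total_step f ^^ a) x = (total_step f ^^ b) y"
  using assms
proof (induction rule: rtrancl_induct)
  case base
  show ?case by blast
next
  case (step y z)
  then obtain a b where ab: "(total_step f ^^ a) x = (total_step f ^^ b) y" by blast
  from step(2) consider "total_step f y = z" | "total_step f z = y"
    unfolding graph_edges_def total_step_def by auto
  then show ?case
  proof cases
    case 1
    then have "(total_step f ^^ Suc a) x = (total_step f ^^ b) z"
      using ab by (simp add: funpow_swap1)
    then show ?thesis by blast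
  next
    case 2
    then have "(total_step f ^^ a) x = (total_step f ^^ Suc b) z"
      using ab by (simp add: funpow_swap1)
    then show ?thesis by blast
  qed
qed

lemma ways_if_unary_FA_presentable:
  fixes X :: "'x set" and f :: "'x \<Rightarrow> 'x option"
  assumes pm: "partial_map_on X f" and orb: "single_orbit X f" and pres: "unary_FA_presentable X f"
  shows "way1 X (graph_edges X f) \<or> way2 X (graph_edges X f) \<or> way3 X (graph_edges X f)"
proof -
  from pres obtain L :: "unary list set" and \<phi> :: "unary list \<Rightarrow> 'x" where X: "\<phi> ` L = X"
    and reg_eq: "regular_rel {(u, v). u \<in> L \<and> v \<in> L \<and> \<phi> u = \<phi> v}"
    and reg_f: "regular_rel {(u, v). u \<in> L \<and> v \<in> L \<and> f (\<phi> u) = Some (\<phi> v)}"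
    unfolding unary_FA_presentable_def by (elim exE conjE) (rule that)
  define w where "w m = replicate m Ltr_a" for m
  have w_length: "w (length u) = u" for u
  proof -
    have "\<forall>c\<in>set u. c = Ltr_a" using unary.exhaust by blast
    then show ?thesis unfolding w_def by (rule replicate_length_same)
  qed
  define \<chi> where "\<chi> m = \<phi> (w m)" for m
  define EQ where "EQ m n \<longleftrightarrow> w m \<in> L \<and> w n \<in> L \<and> \<chi> m = \<chi> n" for m n
  define FR where "FR m n \<longleftrightarrow> w m \<in> L \<and> w n \<in> L \<and> f (\<chi> m) = Some (\<chi> n)" for m n
  have "\<exists>N p. ult_periodic N p EQ"
    by (rule ult_periodic_if_regular_rel) (use reg_eq in \<open>simp add: EQ_def \<chi>_def w_length\<close>)
  then obtain N1 p1 where per1: "ult_periodic N1 p1 EQ" by blast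
  have "\<exists>N p. ult_periodic N p FR"
    by (rule ult_periodic_if_regular_rel) (use reg_f in \<open>simp add: FR_def \<chi>_def w_length\<close>)
  then obtain N2 p2 where per2: "ult_periodic N2 p2 FR" by blast
  define N where "N = max N1 N2"
  \<comment> \<open>A common multiple of both periods; the factor \<open>Suc N\<close> makes it at
    least \<open>N\<close>, as the cut requires.\<close>
  define p where "p = Suc N * p1 * p2"
  have pos: "0 < p1" "0 < p2" using per1 per2 unfolding ult_periodic_def by auto
  have p_pos: "0 < p" unfolding p_def using pos by simp
  have N_le: "N \<le> p"
  proof -
    have "N \<le> Suc N * 1" by simp
    also have "\<dots> \<le> Suc N * (p1 * p2)" using pos by (intro mult_le_mono2) simp
    finally show ?thesis unfolding p_def mult.assoc .
  qed
  have EQ: "ult_periodic N p EQ"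
    using ult_periodic_mult[OF per1, of N "Suc N * p2"] pos unfolding p_def N_def by (simp add: algebra_simps)
  have FR: "ult_periodic N p FR"
    using ult_periodic_mult[OF per2, of N "Suc N * p1"] pos unfolding p_def N_def by (simp add: algebra_simps)
  have EQ1: "EQ (m + p) (n + p) = EQ m n" if "N \<le> m" "N \<le> n" for m n
    using EQ that unfolding ult_periodic_def by blast
  have EQ2: "EQ m (n + p) = EQ m n" if "m + N \<le> n" for m n
    using EQ that unfolding ult_periodic_def by blast
  have FR1: "FR (m + p) (n + p) = FR m n" if "N \<le> m" "N \<le> n" for m n
    using FR that unfolding ult_periodic_def by blast
  have FR2: "FR m (n + p) = FR m n" if "m + N \<le> n" for m n
    using FR that unfolding ult_periodic_def by blast
  have FR3: "FR (m + p) n = FR m n" if "n + N \<le> m" for m n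
    using FR that unfolding ult_periodic_def by blast

  define V where "V = {m. w m \<in> L \<and> (\<forall>k<m. \<not> EQ k m)}"
  have V_L: "w m \<in> L" if "m \<in> V" for m using that unfolding V_def by blast
  have inj: "inj_on \<chi> V"
  proof (rule linorder_inj_onI)
    fix m n assume "m < n" "m \<in> V" "n \<in> V"
    then show "\<chi> m \<noteq> \<chi> n" unfolding V_def EQ_def by blast
  qed auto
  have img: "\<chi> ` V = X"
  proof (intro equalityI subsetI)
    fix x assume "x \<in> \<chi> ` V"
    then show "x \<in> X" using V_L X unfolding \<chi>_def by blast
  next
    fix x assume "x \<in> X"
    then obtain u where "u \<in> L" "x = \<phi> u" using X by blast
    then have ex: "w (length u) \<in> L \<and> \<chi> (length u) = x" unfolding \<chi>_def w_length by simp
    define m where "m = (LEAST m. w m \<in> L \<and> \<chi> m = x)"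
    have m: "w m \<in> L \<and> \<chi> m = x" unfolding m_def using ex by (rule LeastI)
    have "\<not> EQ k m" if "k < m" for k
      using not_less_Least[OF that[unfolded m_def]] m unfolding EQ_def by auto
    then show "x \<in> \<chi> ` V" using m unfolding V_def by blast
  qed
  \<comment> \<open>A shorter word of length \<open>k\<close> for the same element either satisfies
    \<open>k \<ge> N + p\<close>, so that both lengths can be lowered by \<open>p\<close>, or it has
    \<open>k + N < M0 \<le> m\<close>, so that only the longer length is moved.\<close>
  define M0 where "M0 = 2 * N + p"
  have V_shift: "m + p \<in> V \<longleftrightarrow> m \<in> V" if m: "M0 \<le> m" for m
  proof -
    have L: "w (m + p) \<in> L \<longleftrightarrow> w m \<in> L"
      using EQ1[of m m] m unfolding EQ_def M0_def by simp
    have "(\<exists>k<m + p. EQ k (m + p)) \<longleftrightarrow> (\<exists>k<m. EQ k m)"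
    proof
      assume "\<exists>k<m + p. EQ k (m + p)"
      then obtain k where k: "k < m + p" "EQ k (m + p)" by blast
      show "\<exists>k<m. EQ k m"
      proof (cases "N + p \<le> k")
        case True
        then have "EQ (k - p) m" using EQ1[of "k - p" m] k m unfolding M0_def by simp
        then show ?thesis using k True p_pos by (intro exI[of _ "k - p"]) auto
      next
        case False
        then have "k + N \<le> m" "k < m" using m p_pos N_le unfolding M0_def by auto
        then show ?thesis using EQ2[of k m] k by blast
      qed
    next
      assume "\<exists>k<m. EQ k m"
      then obtain k where k: "k < m" "EQ k m" by blast
      show "\<exists>k<m + p. EQ k (m + p)"
      proof (cases "N \<le> k")
        case True
        then have "EQ (k + p) (m + p)" using EQ1[of k m] k by simp
        then show ?thesis using k by (intro exI[of _ "k + p"]) auto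
      next
        case False
        then have "EQ k (m + p)" using EQ2[of k m] k m unfolding M0_def by simp
        then show ?thesis using k by (intro exI[of _ k]) auto
      qed
    qed
    then show ?thesis unfolding V_def using L by blast
  qed
  define g where "g m = inv_into V \<chi> (total_step f (\<chi> m))" for m
  have step_X: "total_step f x \<in> X" if "x \<in> X" for x
    using pm that unfolding partial_map_on_def total_step_def by (auto split: option.split)
  have \<chi>_X: "\<chi> m \<in> X" if "m \<in> V" for m using img that by blast
  have g_in: "g m \<in> V" and \<chi>_g: "\<chi> (g m) = total_step f (\<chi> m)" if "m \<in> V" for m
  proof -
    have "total_step f (\<chi> m) \<in> \<chi> ` V" using step_X \<chi>_X that img by simp
    then show "g m \<in> V" "\<chi> (g m) = total_step f (\<chi> m)"
      unfolding g_def by (rule inv_into_into, rule f_inv_into_f)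
  qed
  have g_pow: "(g ^^ a) m \<in> V \<and> \<chi> ((g ^^ a) m) = (total_step f ^^ a) (\<chi> m)" if "m \<in> V" for a m
    by (induction a) (use that g_in \<chi>_g in auto)
  have meet: "\<exists>a b. (total_step f ^^ a) x = (total_step f ^^ b) y" if "x \<in> X" "y \<in> X" for x y
    by (rule orbits_meet[of _ _ X]) (use orb that in \<open>simp add: single_orbit_def\<close>)
  have conn: "\<exists>a b. (g ^^ a) m = (g ^^ b) n" if mn: "m \<in> V" "n \<in> V" for m n
  proof -
    obtain a b where "(total_step f ^^ a) (\<chi> m) = (total_step f ^^ b) (\<chi> n)"
      using meet \<chi>_X mn by blast
    then have "(g ^^ a) m = (g ^^ b) n"
      using g_pow mn by (intro inj_onD[OF inj]) auto
    then show ?thesis by blast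
  qed
  have FR_V: "FR m n \<longleftrightarrow> f (\<chi> m) = Some (\<chi> n)" if "m \<in> V" "n \<in> V" for m n
    using that V_L unfolding FR_def by blast
  have FR_g: "g m = n" if mn: "m \<in> V" "n \<in> V" "FR m n" for m n
  proof -
    have "\<chi> (g m) = \<chi> n" using \<chi>_g[OF mn(1)] mn FR_V unfolding total_step_def by simp
    then show ?thesis using inj_onD[OF inj] g_in mn by blast
  qed
  have g_FR: "FR m (g m)" if m: "m \<in> V" "f (\<chi> m) \<noteq> None" for m
    using \<chi>_g[OF m(1)] m FR_V[OF m(1) g_in[OF m(1)]] unfolding total_step_def by auto
  \<comment> \<open>Sinks are fixed points of \<open>total_step\<close>, and two different fixed
    points have orbits that never meet.\<close>
  have sink_unique: "m = n" if mn: "m \<in> V" "n \<in> V" "f (\<chi> m) = None" "f (\<chi> n) = None" for m n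
  proof -
    have fix_m: "(total_step f ^^ a) x = x" if "f x = None" for x a
      by (induction a) (use that in \<open>auto simp: total_step_def\<close>)
    have "\<chi> m = \<chi> n" using meet[OF \<chi>_X[OF mn(1)] \<chi>_X[OF mn(2)]] fix_m mn by metis
    then show ?thesis using inj_onD[OF inj] mn by blast
  qed
  have "\<exists>S. \<forall>m\<in>V. f (\<chi> m) = None \<longrightarrow> m < S"
  proof (cases "\<exists>c\<in>V. f (\<chi> c) = None")
    case True
    then obtain c where "c \<in> V" "f (\<chi> c) = None" by blast
    then show ?thesis using sink_unique by (intro exI[of _ "Suc c"]) blast
  qed blast
  then obtain S where S: "\<And>m. m \<in> V \<Longrightarrow> S \<le> m \<Longrightarrow> f (\<chi> m) \<noteq> None" by (meson linorder_not_less)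
  \<comment> \<open>\<open>S\<close> leaves every sink behind, and the summand \<open>N\<close> puts
    values below \<open>M0\<close> far enough below the diagonal for one-sided periodicity.\<close>
  define M where "M = M0 + N + S"
  interpret equivariant_map V g p M0 M N
  proof
    show "V \<noteq> {}" using orb img unfolding single_orbit_def by blast
    show "M0 \<le> M" unfolding M_def by simp
  next
    fix m assume m: "m \<in> V" "M \<le> m"
    have FRg: "FR m (g m)" using g_FR S m unfolding M_def by simp
    have mp: "m + p \<in> V" using V_shift[of m] m unfolding M_def by simp
    have gV: "g m \<in> V" using g_in m by blast
    show "g (m + p) = g m" if "g m < M0"
      using FR3[of "g m" m] FRg m that unfolding M_def by (intro FR_g mp gV) simp
    assume ge: "M0 \<le> g m"
    have gp: "g m + p \<in> V" using V_shift[OF ge] gV by simp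
    have "FR (m + p) (g m + p)"
      using FR1[of m "g m"] FRg m ge unfolding M_def M0_def by simp
    then have eq: "g (m + p) = g m + p" using FR_g mp gp by blast
    \<comment> \<open>Far from the diagonal, one-sided periodicity would give \<open>m\<close> a
      second value \<open>g m + p\<close>; in the other direction below, it would contradict the
      value already found for \<open>m + p\<close>.\<close>
    moreover have "g m \<le> m + N"
    proof (rule ccontr)
      assume "\<not> g m \<le> m + N"
      then have "FR m (g m + p)" using FR2[of m "g m"] FRg by simp
      then have "g m = g m + p" using FR_g[OF m(1) gp] by simp
      then show False using p_pos by simp
    qed
    moreover have "m \<le> g m + N"
    proof (rule ccontr)
      assume "\<not> m \<le> g m + N"
      then have "FR (m + p) (g m)" using FR3[of "g m" m] FRg by simp
      then have "g (m + p) = g m" using FR_g[OF mp gV] by simp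
      then show False using p_pos eq by simp
    qed
    ultimately show "g (m + p) = g m + p \<and> g m \<le> m + N \<and> m \<le> g m + N" by blast
  qed (use g_in conn p_pos N_le V_shift in auto)
  have edges: "graph_edges X f = map_prod \<chi> \<chi> ` {(m, g m) | m. m \<in> {m \<in> V. f (\<chi> m) \<noteq> None}}"
  proof (intro equalityI subsetI)
    fix e assume "e \<in> graph_edges X f"
    then obtain x y where e: "e = (x, y)" "x \<in> X" "f x = Some y" unfolding graph_edges_def by blast
    then obtain m where m: "m \<in> V" "x = \<chi> m" using img by blast
    then have "\<chi> (g m) = y" using \<chi>_g e unfolding total_step_def by simp
    then have "e = map_prod \<chi> \<chi> (m, g m)" "f (\<chi> m) \<noteq> None" using e m by auto
    then show "e \<in> map_prod \<chi> \<chi> ` {(m, g m) | m. m \<in> {m \<in> V. f (\<chi> m) \<noteq> None}}"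
      using m(1) by blast
  next
    fix e assume "e \<in> map_prod \<chi> \<chi> ` {(m, g m) | m. m \<in> {m \<in> V. f (\<chi> m) \<noteq> None}}"
    then obtain m where m: "m \<in> V" "f (\<chi> m) \<noteq> None" "e = (\<chi> m, \<chi> (g m))" by auto
    then show "e \<in> graph_edges X f"
      unfolding graph_edges_def using \<chi>_g[OF m(1)] \<chi>_X[OF m(1)] by (auto simp: total_step_def)
  qed
  show ?thesis
  proof (cases "\<exists>c\<in>V. f (\<chi> c) = None")
    case True
    then obtain c where c: "c \<in> V" "f (\<chi> c) = None" by blast
    then have "\<chi> (g c) = \<chi> c" using \<chi>_g unfolding total_step_def by simp
    then have "g c = c" using inj_onD[OF inj] g_in c by blast
    then have "way3 V {(m, g m) | m. m \<in> V - {c}}" using c(1) fixpoint_way3 by blast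
    moreover have "{m \<in> V. f (\<chi> m) \<noteq> None} = V - {c}" using c sink_unique by blast
    ultimately have "way3 X (graph_edges X f)"
      using way3_image[OF _ inj] unfolding edges img by simp
    then show ?thesis by blast
  next
    case False
    then have "{m \<in> V. f (\<chi> m) \<noteq> None} = V" by auto
    then have edges: "graph_edges X f = map_prod \<chi> \<chi> ` {(m, g m) | m. m \<in> V}" using edges by simp
    show ?thesis
      using total_way1_or_way2 way1_image[OF _ inj] way2_image[OF _ inj] unfolding edges img by blast
  qed
qed

theorem theorem7p3:
  fixes X :: "'x set" and f :: "'x \<Rightarrow> 'x option"
  assumes "partial_map_on X f"
      and "single_orbit X f"
  shows "unary_FA_presentable X f \<longleftrightarrow>
           (way1 X (graph_edges X f) \<or> way2 X (graph_edges X f) \<or> way3 X (graph_edges X f))"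
  using ways_if_unary_FA_presentable[OF assms] unary_FA_presentable_if_ways by blast

end
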